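(* Let $\varrho\in\mathcal{Q}_{e,2}$ and $\ell\in\mathbf{W}_{e,2}$. Assume that $r\mapsto\int_{\mathbb{R}}\ell(\lambda+r)e^{-\lambda^2/2}\,d\lambda$ has a strict minimum at $r=0$, and that $\widetilde\beta_N$ is well defined with respect to $\ell$ for every $N\in\mathbb{N}$. Let $B\subset\mathbb{R}_+$ be any compact set. Then: (a) For any $\varepsilon>0$, $\lim_{N\to\infty}\sup_{\theta_0\in B}\mathbb{P}\big(|\widetilde\beta_N-\theta_0|>\varepsilon\big)=0$. (b) Uniformly in $\theta_0\in B$, $\sqrt{I_N}\big(\widetilde\beta_N-\theta_0\big)$ converges in distribution to $\mathcal{N}(0,1)$ as $N\to\infty$. (c) For any $\varepsilon>0$, $\lim_{N\to\infty}\sup_{\theta_0\in B}\mathbb{P}\big(\big|\sqrt{I_N}(\widetilde\beta_N-\theta_0)-\xi_N\big|>\varepsilon\big)=0$. Moreover, $\widetilde\beta_N$ is strongly consistent: $\lim_{N\to\infty}\widetilde\beta_N=\theta_0$, $\mathbb{P}$-a.s. If in addition $\varrho=\mathbf{1}_{\mathbb{R}_+}$ (the uniform/uninformed prior), then: (d) For any $\varpi\in\mathbf{W}_p$, with $\varpi_N(x):=\varpi(\sqrt{I_N}x)$, and any $\theta_0\in B$, $$\lim_{\delta\to0+}\liminf_{N\to\infty}\sup_{|\theta-\theta_0|<\delta}\mathbb{E}\big(\varpi_N(\widetilde\beta_N-\theta)\big)=\mathbb{E}(\varpi(\xi)),$$ where $\xi\sim\mathcal{N}(0,1)$ under $\m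athbb{P}$.
   Context: $\mathbb{R}_+:=(0,\infty)$. $(\Omega,\mathscr{F},\{\mathscr{F}_t\},\mathbb{P})$ is a stochastic basis satisfying the usual assumptions, with independent standard Brownian motions $\{w_k\}_{k\in\mathbb{N}}$. $\{\mu_k\}\subset(0,\infty)$ with $\mu_k\to\infty$ (the eigenvalues of a positive definite self-adjoint operator $A$ on a separable Hilbert space), $\{q_k\}\subset(0,\infty)$, $\sigma>0$ and $T>0$ are fixed and known. For $\theta\in\mathbb{R}_+$, $u_k^\theta$ is the $k$-th Fourier mode of the solution of $du+\theta Au\,dt=\sigma\sum_ku_kh_kq_k\,dw_k$ ($h_k$ the eigenvectors of $A$), i.e. $du_k^\theta=-\theta\mu_ku_k^\theta\,dt+\sigma q_ku_k^\theta\,dw_k$, so $u_k^\theta(t)=u_k(0)\exp\big(-(\theta\mu_k+\tfrac12\sigma^2q_k^2)t+\sigma q_kw_k(t)\big)$, $t\in[0,T]$, with $\mathscr{F}_0$-measurable $u_k(0)\ne0$ not depending on $\theta$. Standing assumption: the well-posedness condition of the equation holds for at least one parameter value, i.e. there exist $\bar\theta>0$, $N_0\in\mathbb{N}$, $c>0$ with $2\bar\theta-\sigma^2q_k^2/\mu_k\ge c$ for all $k\ge N_0$. $\theta_0\in\mathbb{R}_+$ is the true parameter value and the observation is $U_N=U_N^{\theta_0}=(u_1,\dots,u_N)$ on $[0,T]$, $u_k:=u_k^{\theta_0}$. The Fisher information is $I_N:=\frac{T}{\sigma^2}\sum_{k=1}^N\mu_k^2q_k^{-2}$. Put $$\widehat\theta_N:=-\frac{\sum_{k=1}^N\mu_kq_k^{-2}\int_0^T\frac{du_k(t)}{u_k(t)}}{T\sum_{k=1}^N\mu_k^2q_k^{-2}},\qquad\xi_N:=-\frac{1}{\sigma\sqrt{I_N}}\sum_{k=1}^N\mu_kq_k^{-1}w_k(T).$$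 For a prior $\varrho$ the posterior density is $$p(\theta\,|\,U_N)=\frac{e^{-I_N(\theta-\widehat\theta_N)^2/2}\varrho(\theta)}{\int_{\mathbb{R}_+}e^{-I_N(\eta-\widehat\theta_N)^2/2}\varrho(\eta)\,d\eta},\quad\theta\in\mathbb{R}_+,$$ it being understood that the denominator is finite and positive, and $$\widetilde\beta_N:=\operatorname*{arg\,min}_{\beta\in\mathbb{R}_+}\int_{\mathbb{R}_+}\ell\big(\sqrt{I_N}(\eta-\beta)\big)\,p(\eta\,|\,U_N)\,d\eta,$$ which is well defined when this minimum is strict and attained. $\mathcal{Q}_{e,2}$ is the set of $\varrho:\mathbb{R}_+\to[0,\infty)$ that are continuous and positive on $\mathbb{R}_+$ and whose growth as $\theta\to\infty$ is bounded by one of the functions $e^{c\theta^r}$ with $c>0$, $r\in(0,2)$. $\mathbf{W}$ is the set of Borel measurable $\ell:\mathbb{R}\to[0,\infty)$ that are symmetric, non-decreasing on $[0,\infty)$, with $\ell(0)=0$, continuous at $0$ and not identically $0$; $\mathbf{W}_{e,2}$ is the set of $\ell\in\mathbf{W}$ whose growth as $|x|\to\infty$ is bounded by one of the functions $e^{c|x|^r}$ with $c>0$, $r\in(0,2)$; $\mathbf{W}_p$ is the set of $\ell\in\mathbf{W}$ possessing a polynomial majorant as $|x|\to\infty$. In suprema over $\theta_0$ (resp. over $\theta$ in (d), where $\theta\in\mathbb{R}_+$), the estimator is computed from data generated under that parameter value. "Converges in distribution uniformly in $\theta_0\in B$" means that for every bounded continuous $g$, $\sup_{\theta_0\in B}|\mathbb{E}g(\cdot)-\mathbb{E}g(\xi)|\to0$,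 $\xi\sim\mathcal{N}(0,1)$. *)

theory Defs
  imports "HOL-Probability.Probability"
begin

definition usual_stochastic_basis :: "'a measure \<Rightarrow> (real \<Rightarrow> 'a measure) \<Rightarrow> bool" where
  "usual_stochastic_basis M F \<longleftrightarrow>
     prob_space M \<and> complete_measure M \<and>
     (\<forall>t\<ge>0. subalgebra M (F t)) \<and>
     (\<forall>s t. 0 \<le> s \<and> s \<le> t \<longrightarrow> sets (F s) \<subseteq> sets (F t)) \<and>
     null_sets M \<subseteq> sets (F 0) \<and>
     (\<forall>s\<ge>0. sets (F s) = (\<Inter>t\<in>{s<..}. sets (F t)))"

definition standard_brownian_motion ::
  "'a measure \<Rightarrow> (real \<Rightarrow> 'a measure) \<Rightarrow> (real \<Rightarrow> 'a \<Rightarrow> real) \<Rightarrow> bool" where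
  "standard_brownian_motion M F W \<longleftrightarrow>
     (\<forall>t\<ge>0. W t \<in> borel_measurable (F t)) \<and>
     (AE \<omega> in M. W 0 \<omega> = 0) \<and>
     (AE \<omega> in M. continuous_on {0..} (\<lambda>t. W t \<omega>)) \<and>
     (\<forall>s t. 0 \<le> s \<and> s < t \<longrightarrow>
        distributed M lborel (\<lambda>\<omega>. W t \<omega> - W s \<omega>) (normal_density 0 (sqrt (t - s))) \<and>
        prob_space.indep_set M (sets (F s))
          (sets (vimage_algebra (space M) (\<lambda>\<omega>. W t \<omega> - W s \<omega>) borel)))"

text \<open>Independence of the processes, as random elements of the path space.\<close>

definition independent_brownian_motions ::
  "'a measure \<Rightarrow> (real \<Rightarrow> 'a measure) \<Rightarrow> (nat \<Rightarrow> real \<Rightarrow> 'a \<Rightarrow> real) \<Rightarrow> bool" where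
  "independent_brownian_motions M F w \<longleftrightarrow>
     (\<forall>k\<ge>1. standard_brownian_motion M F (w k)) \<and>
     prob_space.indep_vars M (\<lambda>_. Pi\<^sub>M {0..} (\<lambda>_. borel))
       (\<lambda>k \<omega>. \<lambda>t\<in>{0..}. w k t \<omega>) {1..}"

text \<open>The Ito integral of \<open>H\<close> against \<open>X\<close> over \<open>[0, T]\<close>, as the limit in probability of the
  left-endpoint Riemann sums when the mesh of the (deterministic) partition tends to zero. This
  is the Ito integral for continuous adapted \<open>H\<close> and continuous semimartingales \<open>X\<close>. It is
  determined up to null sets, and \<open>ito_integral\<close> chooses a version.\<close>

definition has_ito_integral ::
  "'a measure \<Rightarrow> real \<Rightarrow> (real \<Rightarrow> 'a \<Rightarrow> real) \<Rightarrow> (real \<Rightarrow> 'a \<Rightarrow> real) \<Rightarrow> ('a \<Rightarrow> real) \<Rightarrow> bool" where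
  "has_ito_integral M T H X J \<longleftrightarrow>
     J \<in> borel_measurable M \<and>
     (\<forall>\<epsilon>>0. \<exists>\<delta>>0. \<forall>n t.
        t 0 = 0 \<and> t n = T \<and> (\<forall>i<n. t i < t (Suc i) \<and> t (Suc i) - t i < \<delta>) \<longrightarrow>
        measure M {\<omega> \<in> space M.
          \<bar>(\<Sum>i<n. H (t i) \<omega> * (X (t (Suc i)) \<omega> - X (t i) \<omega>)) - J \<omega>\<bar> > \<epsilon>} < \<epsilon>)"

definition ito_integral ::
  "'a measure \<Rightarrow> real \<Rightarrow> (real \<Rightarrow> 'a \<Rightarrow> real) \<Rightarrow> (real \<Rightarrow> 'a \<Rightarrow> real) \<Rightarrow> 'a \<Rightarrow> real" where
  "ito_integral M T H X = (SOME J. has_ito_integral M T H X J)"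

text \<open>The solution of \<open>du = - \<theta> \<mu>\<^sub>k u dt + \<sigma> q\<^sub>k u dw\<^sub>k\<close> with initial value \<open>u0 k\<close>. Modes are numbered
  from 1; the entries with index 0 of all sequences are irrelevant.\<close>

definition fourier_mode ::
  "real \<Rightarrow> (nat \<Rightarrow> real) \<Rightarrow> (nat \<Rightarrow> real) \<Rightarrow> (nat \<Rightarrow> real \<Rightarrow> 'a \<Rightarrow> real) \<Rightarrow> (nat \<Rightarrow> 'a \<Rightarrow> real) \<Rightarrow>
   real \<Rightarrow> nat \<Rightarrow> real \<Rightarrow> 'a \<Rightarrow> real" where
  "fourier_mode \<sigma> \<mu> q w u0 \<theta> k t \<omega> =
     u0 k \<omega> * exp (- (\<theta> * \<mu> k + \<sigma>\<^sup>2 * (q k)\<^sup>2 / 2) * t + \<sigma> * q k * w k t \<omega>)"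

definition fisher_info :: "real \<Rightarrow> real \<Rightarrow> (nat \<Rightarrow> real) \<Rightarrow> (nat \<Rightarrow> real) \<Rightarrow> nat \<Rightarrow> real" where
  "fisher_info T \<sigma> \<mu> q N = T / \<sigma>\<^sup>2 * (\<Sum>k=1..N. (\<mu> k)\<^sup>2 / (q k)\<^sup>2)"

definition theta_hat ::
  "'a measure \<Rightarrow> real \<Rightarrow> (nat \<Rightarrow> real) \<Rightarrow> (nat \<Rightarrow> real) \<Rightarrow> (nat \<Rightarrow> real \<Rightarrow> 'a \<Rightarrow> real) \<Rightarrow>
   nat \<Rightarrow> 'a \<Rightarrow> real" where
  "theta_hat M T \<mu> q u N \<omega> =
     - (\<Sum>k=1..N. \<mu> k / (q k)\<^sup>2 * ito_integral M T (\<lambda>t \<omega>. 1 / u k t \<omega>) (u k) \<omega>)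
       / (T * (\<Sum>k=1..N. (\<mu> k)\<^sup>2 / (q k)\<^sup>2))"

definition xi_stat ::
  "real \<Rightarrow> real \<Rightarrow> (nat \<Rightarrow> real) \<Rightarrow> (nat \<Rightarrow> real) \<Rightarrow> (nat \<Rightarrow> real \<Rightarrow> 'a \<Rightarrow> real) \<Rightarrow>
   nat \<Rightarrow> 'a \<Rightarrow> real" where
  "xi_stat T \<sigma> \<mu> q w N \<omega> =
     - (1 / (\<sigma> * sqrt (fisher_info T \<sigma> \<mu> q N))) * (\<Sum>k=1..N. \<mu> k / q k * w k T \<omega>)"

text \<open>In the following, \<open>I\<close> is the Fisher information and \<open>x\<close> the observed value of the
  estimator \<open>theta_hat\<close>, through which alone the posterior depends on the data. Priors are only
  relevant on \<open>{0<..}\<close>.\<close>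

definition posterior_weight :: "(real \<Rightarrow> real) \<Rightarrow> real \<Rightarrow> real \<Rightarrow> real \<Rightarrow> real" where
  "posterior_weight \<rho> I x \<theta> = exp (- (I * (\<theta> - x)\<^sup>2 / 2)) * \<rho> \<theta>"

definition posterior_density :: "(real \<Rightarrow> real) \<Rightarrow> real \<Rightarrow> real \<Rightarrow> real \<Rightarrow> real" where
  "posterior_density \<rho> I x \<theta> =
     posterior_weight \<rho> I x \<theta> / (LBINT \<eta>:{0<..}. posterior_weight \<rho> I x \<eta>)"

definition posterior_risk ::
  "(real \<Rightarrow> real) \<Rightarrow> (real \<Rightarrow> real) \<Rightarrow> real \<Rightarrow> real \<Rightarrow> real \<Rightarrow> ennreal" where
  "posterior_risk \<rho> l I x \<beta> =
     (\<integral>\<^sup>+\<eta>\<in>{0<..}. ennreal (l (sqrt I * (\<eta> - \<beta>)) * posterior_density \<rho> I x \<eta>) \<partial>lborel)"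

definition bayes_well_defined ::
  "(real \<Rightarrow> real) \<Rightarrow> (real \<Rightarrow> real) \<Rightarrow> real \<Rightarrow> real \<Rightarrow> bool" where
  "bayes_well_defined \<rho> l I x \<longleftrightarrow>
     set_integrable lborel {0<..} (posterior_weight \<rho> I x) \<and>
     0 < (LBINT \<eta>:{0<..}. posterior_weight \<rho> I x \<eta>) \<and>
     (\<exists>\<beta>>0. \<forall>\<beta>'>0. \<beta>' \<noteq> \<beta> \<longrightarrow> posterior_risk \<rho> l I x \<beta> < posterior_risk \<rho> l I x \<beta>')"

definition bayes_estimate ::
  "(real \<Rightarrow> real) \<Rightarrow> (real \<Rightarrow> real) \<Rightarrow> real \<Rightarrow> real \<Rightarrow> real" where
  "bayes_estimate \<rho> l I x = arg_min_on (posterior_risk \<rho> l I x) {0<..}"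

definition Q_e2 :: "(real \<Rightarrow> real) set" where
  "Q_e2 = {\<rho>. continuous_on {0<..} \<rho> \<and> (\<forall>\<theta>>0. \<rho> \<theta> > 0) \<and>
     (\<exists>c>0. \<exists>r. 0 < r \<and> r < 2 \<and> \<rho> \<in> O[at_top](\<lambda>\<theta>. exp (c * \<theta> powr r)))}"

definition W_loss :: "(real \<Rightarrow> real) set" where
  "W_loss = {l. l \<in> borel_measurable borel \<and> (\<forall>x. l x \<ge> 0) \<and> (\<forall>x. l (- x) = l x) \<and>
     mono_on {0..} l \<and> l 0 = 0 \<and> isCont l 0 \<and> (\<exists>x. l x \<noteq> 0)}"

definition W_e2 :: "(real \<Rightarrow> real) set" where
  "W_e2 = {l \<in> W_loss.
     \<exists>c>0. \<exists>r. 0 < r \<and> r < 2 \<and> l \<in> O[at_infinity](\<lambda>x. exp (c * \<bar>x\<bar> powr r))}"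

definition W_p :: "(real \<Rightarrow> real) set" where
  "W_p = {l \<in> W_loss. \<exists>p :: real poly. \<forall>\<^sub>F x in at_infinity. l x \<le> poly p x}"

end

theory Submission
  imports Defs
begin

text \<open>
  Everything is reduced to a normal location experiment. The logarithmic differential
  \<open>du\<^sub>k / u\<^sub>k\<close> has drift \<open>- \<theta> \<mu>\<^sub>k dt\<close> and martingale part \<open>\<sigma> q\<^sub>k dw\<^sub>k\<close>, so its Ito integral over
  \<open>[0, T]\<close> equals \<open>- \<theta> \<mu>\<^sub>k T + \<sigma> q\<^sub>k w\<^sub>k(T)\<close> almost surely (\<open>fourier_mode_log_integral\<close>). Hence
  \<open>theta_hat = \<theta> + \<xi>\<^sub>N / sqrt I\<^sub>N\<close> almost surely, with \<open>\<xi>\<^sub>N\<close> exactly standard normal, and the Bayes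
  estimate is a deterministic function \<open>\<beta>\<^sub>N(x)\<close> of the value \<open>x\<close> of \<open>theta_hat\<close>. The Fisher
  information tends to infinity because well-posedness bounds \<open>q\<^sub>k\<^sup>2 / \<mu>\<^sub>k\<close> while \<open>\<mu>\<^sub>k\<close> tends to
  infinity; it is even eventually at least \<open>N\<close>.

  In the rescaled variables \<open>t = sqrt I (\<eta> - x)\<close> and \<open>r = sqrt I (\<beta> - x)\<close> the posterior risk
  becomes, up to a constant factor, the integral of \<open>l(t - r) exp(- t\<^sup>2 / 2) \<rho>(x + t / sqrt I)\<close>.
  For large \<open>I\<close> and \<open>x\<close> in a compact set its value at \<open>r = 0\<close> is at most about \<open>\<rho>(x)\<close> times the
  Gaussian risk at \<open>0\<close>. For \<open>\<bar>r\<bar> \<ge> \<epsilon>\<close> it is at least about \<open>\<rho>(x)\<close> times the risk at \<open>r\<close> under a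
  truncated Gaussian weight, which by the one-dimensional Anderson inequality (\<open>anderson_inequality\<close>) is no less than the
  truncated risk at \<open>\<epsilon>\<close>; since the Gaussian risk has a strict minimum at \<open>0\<close>, the latter exceeds
  the Gaussian risk at \<open>0\<close> once the truncation is far enough out. So
  \<open>\<bar>sqrt I (\<beta>\<^sub>N(x) - x)\<bar> < \<epsilon>\<close> uniformly on compact sets (\<open>risk_localization\<close>), without any separate
  discussion of \<open>r\<close> tending to infinity. This gives the stochastic expansion with remainder, from
  which consistency and asymptotic normality follow; strong consistency follows with the
  Borel-Cantelli lemma, since \<open>\<xi>\<^sub>N / sqrt I\<^sub>N\<close> has fourth moment at most \<open>3 / N\<^sup>2\<close> eventually.

  Two facts come from \<open>weighted_risk_single_crossing\<close>: shifting \<open>x\<close> multiplies the Gaussian likelihood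
  by a monotone exponential, while \<open>l(\<eta> - b') - l(\<eta> - b)\<close> changes sign only once. Therefore
  \<open>\<beta>\<^sub>N\<close> is nondecreasing in \<open>x\<close> (\<open>bayes_estimate_mono\<close>). Monotonicity makes the estimator measurable, which the convergence
  in distribution needs, and under the uniform prior it bounds \<open>\<beta>\<^sub>N(x)\<close> for small or negative \<open>x\<close>,
  where localization says nothing. That bound supplies an integrable majorant for the risk under an
  arbitrary loss of polynomial growth.
\<close>

section \<open>Rearrangement and single crossing of risks\<close>

lemma nn_integral_reflect:
  fixes f :: "real \<Rightarrow> ennreal"
  assumes [measurable]: "f \<in> borel_measurable borel"
  shows "(\<integral>\<^sup>+x. f (c - x) \<partial>lborel) = (\<integral>\<^sup>+x. f x \<partial>lborel)"
  using nn_integral_real_affine[of f "-1" c] by simp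

lemma nn_integral_shift:
  fixes f :: "real \<Rightarrow> ennreal"
  assumes [measurable]: "f \<in> borel_measurable borel"
  shows "(\<integral>\<^sup>+x. f (c + x) \<partial>lborel) = (\<integral>\<^sup>+x. f x \<partial>lborel)"
  using nn_integral_real_affine[of f 1 c] by simp

text \<open>The reflection \<open>u \<mapsto> - (r + r') - u\<close> exchanges the weights \<open>f(r + u)\<close> and \<open>f(r' + u)\<close>. On each pair of
  points exchanged by it, the larger loss meets the larger weight for the shift \<open>r'\<close>, so the
  inequality holds after summing over the pair, and integrating counts each pair twice. Adding over
  pairs instead of subtracting the two risks keeps all integrands nonnegative, so that the risks may
  be infinite.\<close>

lemma anderson_inequality:
  fixes l f :: "real \<Rightarrow> real"
  assumes [measurable]: "l \<in> borel_measurable borel" "f \<in> borel_measurable borel"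
    and l0: "\<And>x. 0 \<le> l x" and f0: "\<And>x. 0 \<le> f x"
    and l_mono: "\<And>x y. \<bar>x\<bar> \<le> \<bar>y\<bar> \<Longrightarrow> l x \<le> l y"
    and f_anti: "\<And>x y. \<bar>x\<bar> \<le> \<bar>y\<bar> \<Longrightarrow> f y \<le> f x"
    and r: "\<bar>r\<bar> \<le> \<bar>r'\<bar>"
  shows "(\<integral>\<^sup>+x. ennreal (l (x - r) * f x) \<partial>lborel) \<le> (\<integral>\<^sup>+x. ennreal (l (x - r') * f x) \<partial>lborel)"
proof -
  define g where "g s u = l u * f (s + u)" for s u
  have [measurable]: "g s \<in> borel_measurable borel" for s
    unfolding g_def by measurable
  have g0: "0 \<le> g s u" for s u
    by (simp add: g_def l0 f0)
  have shift: "(\<integral>\<^sup>+x. ennreal (l (x - s) * f x) \<partial>lborel) = (\<integral>\<^sup>+u. ennreal (g s u) \<partial>lborel)" for s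
    using nn_integral_shift[of "\<lambda>x. ennreal (l (x - s) * f x)" s] by (simp add: g_def)
  define c where "c = - (r + r')"
  \<comment> \<open>Each pair of points exchanged by the reflection contributes more for the shift \<open>r'\<close>.\<close>
  have four: "g r u + g r (c - u) \<le> g r' u + g r' (c - u)" for u
  proof -
    define D where "D = 2 * u + r + r'"
    have f_swap: "f (r + (c - u)) = f (r' + u)" "f (r' + (c - u)) = f (r + u)"
      unfolding c_def using f_anti[of "r + (- (r + r') - u)" "r' + u"] f_anti[of "r' + u" "r + (- (r + r') - u)"]
        f_anti[of "r' + (- (r + r') - u)" "r + u"] f_anti[of "r + u" "r' + (- (r + r') - u)"]
      by (auto intro!: antisym simp: abs_if split: if_splits)
    have prod: "0 \<le> (l u - l (c - u)) * (f (r' + u) - f (r + u))"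
    proof -
      have e1: "u\<^sup>2 - (c - u)\<^sup>2 = - (r + r') * D" and e2: "(r + u)\<^sup>2 - (r' + u)\<^sup>2 = (r - r') * D"
        by (auto simp: c_def D_def power2_eq_square algebra_simps)
      have "r\<^sup>2 \<le> r'\<^sup>2" using r by (simp add: abs_le_square_iff)
      then have "0 \<le> (r'\<^sup>2 - r\<^sup>2) * D\<^sup>2" by simp
      also have "\<dots> = (u\<^sup>2 - (c - u)\<^sup>2) * ((r + u)\<^sup>2 - (r' + u)\<^sup>2)"
        unfolding e1 e2 by (simp add: power2_eq_square algebra_simps)
      finally have P: "0 \<le> (u\<^sup>2 - (c - u)\<^sup>2) * ((r + u)\<^sup>2 - (r' + u)\<^sup>2)" .
      consider "u\<^sup>2 = (c - u)\<^sup>2" | "u\<^sup>2 < (c - u)\<^sup>2" | "u\<^sup>2 > (c - u)\<^sup>2" by linarith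
      then show ?thesis
      proof cases
        case 1
        then have "\<bar>u\<bar> = \<bar>c - u\<bar>" by (metis power2_eq_iff abs_eq_iff)
        then have "l u = l (c - u)" by (auto intro!: antisym l_mono)
        then show ?thesis by simp
      next
        case 2
        then have "(r + u)\<^sup>2 \<le> (r' + u)\<^sup>2" using P by (simp add: zero_le_mult_iff)
        then have "f (r' + u) \<le> f (r + u)" "l u \<le> l (c - u)"
          using 2 by (auto intro!: f_anti l_mono simp: abs_le_square_iff)
        then show ?thesis by (simp add: zero_le_mult_iff)
      next
        case 3
        then have "(r' + u)\<^sup>2 \<le> (r + u)\<^sup>2" using P by (simp add: zero_le_mult_iff)
        then have "f (r + u) \<le> f (r' + u)" "l (c - u) \<le> l u"
          using 3 by (auto intro!: f_anti l_mono simp: abs_le_square_iff)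
        then show ?thesis by (simp add: zero_le_mult_iff)
      qed
    qed
    then show ?thesis unfolding g_def f_swap by (simp add: algebra_simps)
  qed
  have double: "2 * (\<integral>\<^sup>+u. ennreal (g s u) \<partial>lborel) = (\<integral>\<^sup>+u. ennreal (g s u + g s (c - u)) \<partial>lborel)" for s
    using nn_integral_reflect[of "\<lambda>u. ennreal (g s u)" c]
    by (simp add: ennreal_plus g0 nn_integral_add mult_2)
  have "2 * (\<integral>\<^sup>+u. ennreal (g r u) \<partial>lborel) \<le> 2 * (\<integral>\<^sup>+u. ennreal (g r' u) \<partial>lborel)"
    unfolding double by (intro nn_integral_mono ennreal_leI four)
  then show ?thesis
    unfolding shift by (simp add: ennreal_mult_le_mult_iff)
qed

text \<open>The posterior risk without its normalizing constant. The prior is meant to be extended by zero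
  to the whole line, which allows affine substitutions without tracking the domain.\<close>

definition weighted_risk :: "(real \<Rightarrow> real) \<Rightarrow> (real \<Rightarrow> real) \<Rightarrow> real \<Rightarrow> real \<Rightarrow> real \<Rightarrow> ennreal" where
  "weighted_risk \<rho> l I x \<beta> =
     (\<integral>\<^sup>+\<eta>. ennreal (l (sqrt I * (\<eta> - \<beta>)) * exp (- (I * (\<eta> - x)\<^sup>2 / 2)) * \<rho> \<eta>) \<partial>lborel)"

text \<open>The likelihoods at \<open>x\<close> and \<open>x'\<close> differ by a factor \<open>k\<close> that decreases in \<open>\<eta>\<close>, and the loss for
  \<open>b'\<close> exceeds that for \<open>b\<close> to the left of the midpoint and falls below it to the right. Hence
  \<open>(L b' - L b) (k - k m)\<close> is nonnegative everywhere. The integrated four-term inequality forbids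
  the two data values to disagree strictly about the order of \<open>b\<close> and \<open>b'\<close> in the wrong direction.\<close>

lemma weighted_risk_single_crossing:
  fixes l \<rho> :: "real \<Rightarrow> real"
  assumes [measurable]: "l \<in> borel_measurable borel" "\<rho> \<in> borel_measurable borel"
    and l0: "\<And>x. 0 \<le> l x" and \<rho>0: "\<And>x. 0 \<le> \<rho> x"
    and l_mono: "\<And>x y. \<bar>x\<bar> \<le> \<bar>y\<bar> \<Longrightarrow> l x \<le> l y"
    and I: "0 \<le> I" and x: "x \<le> x'" and b: "b < b'"
    and better: "weighted_risk \<rho> l I x' b < weighted_risk \<rho> l I x' b'"
  shows "weighted_risk \<rho> l I x b \<le> weighted_risk \<rho> l I x b'"
proof (rule ccontr)
  assume "\<not> ?thesis"
  then have worse: "weighted_risk \<rho> l I x b' < weighted_risk \<rho> l I x b" by simp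
  define L where "L \<beta> \<eta> = l (sqrt I * (\<eta> - \<beta>))" for \<beta> \<eta>
  define g where "g y \<eta> = exp (- (I * (\<eta> - y)\<^sup>2 / 2))" for y \<eta>
  have [measurable]: "L \<beta> \<in> borel_measurable borel" "g y \<in> borel_measurable borel" for \<beta> y
    unfolding L_def g_def by measurable
  define m where "m = (b + b') / 2"
  define k where "k \<eta> = exp (- (I * (x' - x) * (2 * \<eta> - x - x') / 2))" for \<eta>
  have gk: "g x \<eta> = k \<eta> * g x' \<eta>" for \<eta>
    by (simp add: g_def k_def exp_add[symmetric] power2_eq_square field_simps)
  have k_pos: "0 < k \<eta>" for \<eta> by (simp add: k_def)
  have k_anti: "k \<eta>' \<le> k \<eta>" if "\<eta> \<le> \<eta>'" for \<eta> \<eta>'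
    using I x that unfolding k_def
    by (auto intro!: mult_left_mono divide_right_mono)
  have cross: "0 \<le> (L b' \<eta> - L b \<eta>) * (k \<eta> - k m)" for \<eta>
  proof (cases "\<eta> \<le> m")
    case True
    then have "\<bar>sqrt I * (\<eta> - b)\<bar> \<le> \<bar>sqrt I * (\<eta> - b')\<bar>"
      using b I by (auto simp: abs_mult m_def intro!: mult_left_mono)
    then have "L b \<eta> \<le> L b' \<eta>" unfolding L_def by (rule l_mono)
    then show ?thesis using k_anti[OF True] by simp
  next
    case False
    then have "\<bar>sqrt I * (\<eta> - b')\<bar> \<le> \<bar>sqrt I * (\<eta> - b)\<bar>"
      using b I by (auto simp: abs_mult m_def intro!: mult_left_mono)
    then have "L b' \<eta> \<le> L b \<eta>" unfolding L_def by (rule l_mono)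
    then show ?thesis using k_anti[of m \<eta>] False by (simp add: zero_le_mult_iff)
  qed
  \<comment> \<open>Two data values and two estimates: the integrand form of the claim, free of subtractions.\<close>
  have four: "L b \<eta> * g x \<eta> * \<rho> \<eta> + k m * (L b' \<eta> * g x' \<eta> * \<rho> \<eta>)
      \<le> L b' \<eta> * g x \<eta> * \<rho> \<eta> + k m * (L b \<eta> * g x' \<eta> * \<rho> \<eta>)" for \<eta>
  proof -
    have "0 \<le> (L b' \<eta> - L b \<eta>) * (k \<eta> - k m) * (g x' \<eta> * \<rho> \<eta>)"
      by (intro mult_nonneg_nonneg cross \<rho>0) (simp add: g_def)
    then show ?thesis unfolding gk by (simp add: algebra_simps)
  qed
  have nonneg: "0 \<le> L \<beta> \<eta> * g y \<eta> * \<rho> \<eta>" for \<beta> y \<eta>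
    by (simp add: L_def g_def l0 \<rho>0)
  have wr: "weighted_risk \<rho> l I y \<beta> = (\<integral>\<^sup>+\<eta>. ennreal (L \<beta> \<eta> * g y \<eta> * \<rho> \<eta>) \<partial>lborel)" for y \<beta>
    by (simp add: weighted_risk_def L_def g_def)
  have sum: "weighted_risk \<rho> l I x \<beta> + ennreal (k m) * weighted_risk \<rho> l I x' \<beta>'
     = (\<integral>\<^sup>+\<eta>. ennreal (L \<beta> \<eta> * g x \<eta> * \<rho> \<eta> + k m * (L \<beta>' \<eta> * g x' \<eta> * \<rho> \<eta>)) \<partial>lborel)" for \<beta> \<beta>'
    unfolding wr using k_pos[of m] nonneg
    by (simp add: ennreal_plus ennreal_mult' nn_integral_add nn_integral_cmult)
  have "weighted_risk \<rho> l I x b + ennreal (k m) * weighted_risk \<rho> l I x' b'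
      \<le> weighted_risk \<rho> l I x b' + ennreal (k m) * weighted_risk \<rho> l I x' b"
    unfolding sum by (intro nn_integral_mono ennreal_leI four)
  moreover have "ennreal (k m) * weighted_risk \<rho> l I x' b < ennreal (k m) * weighted_risk \<rho> l I x' b'"
    using better k_pos[of m] by (intro ennreal_mult_strict_left_mono) (auto simp: less_top)
  with worse have "weighted_risk \<rho> l I x b' + ennreal (k m) * weighted_risk \<rho> l I x' b
      < weighted_risk \<rho> l I x b + ennreal (k m) * weighted_risk \<rho> l I x' b'"
    by (rule add_strict_mono)
  ultimately show False by simp
qed

section \<open>Growth of losses and priors; the gap in the Gaussian risk\<close>

lemma W_loss_nonneg: "l \<in> W_loss \<Longrightarrow> 0 \<le> l x"
  by (simp add: W_loss_def)

lemma W_loss_measurable: "l \<in> W_loss \<Longrightarrow> l \<in> borel_measurable borel"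
  by (simp add: W_loss_def)

lemma W_loss_abs: "l \<in> W_loss \<Longrightarrow> l \<bar>x\<bar> = l x"
  by (simp add: W_loss_def abs_if)

lemma W_loss_mono:
  assumes "l \<in> W_loss" "\<bar>x\<bar> \<le> \<bar>y\<bar>"
  shows "l x \<le> l y"
proof -
  have "l \<bar>x\<bar> \<le> l \<bar>y\<bar>"
    using assms by (auto simp: W_loss_def elim!: mono_onD)
  then show ?thesis using assms(1) by (simp add: W_loss_abs)
qed

lemma powr_le_square_eventually:
  fixes c r \<kappa> :: real
  assumes "0 < c" "r < 2" "0 < \<kappa>"
  shows "\<exists>A>0. \<forall>y\<ge>A. c * y powr r \<le> \<kappa> * y\<^sup>2"
proof -
  have "filterlim (\<lambda>y::real. y powr (2 - r)) at_top at_top"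
    using assms by real_asymp
  then have "eventually (\<lambda>y. c / \<kappa> \<le> y powr (2 - r)) at_top"
    by (simp add: filterlim_at_top)
  then obtain A0 where A0: "\<And>y. A0 \<le> y \<Longrightarrow> c / \<kappa> \<le> y powr (2 - r)"
    by (auto simp: eventually_at_top_linorder)
  have "c * y powr r \<le> \<kappa> * y\<^sup>2" if "max 1 A0 \<le> y" for y
  proof -
    have "c * y powr r \<le> (\<kappa> * y powr (2 - r)) * y powr r"
      using A0[of y] that assms by (intro mult_right_mono) (auto simp: field_simps)
    also have "\<dots> = \<kappa> * (y powr (2 - r) * y powr r)" by simp
    also have "y powr (2 - r) * y powr r = y\<^sup>2"
      using that by (simp add: powr_add[symmetric])
    finally show ?thesis .
  qed
  then show ?thesis by (intro exI[of _ "max 1 A0"]) auto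
qed

text \<open>The growth of a loss enters the estimates only through this Gaussian bound with an arbitrarily
  small rate \<open>\<kappa>\<close>; it holds for all arguments because a loss is bounded on bounded sets by monotonicity.\<close>

lemma W_e2_subgaussian:
  assumes l: "l \<in> W_e2" and \<kappa>: "0 < \<kappa>"
  shows "\<exists>C>0. \<forall>x. l x \<le> C * exp (\<kappa> * x\<^sup>2)"
proof -
  from l obtain c r where cr: "0 < c" "0 < r" "r < 2"
    and O: "l \<in> O[at_infinity](\<lambda>x. exp (c * \<bar>x\<bar> powr r))" and W: "l \<in> W_loss"
    by (auto simp: W_e2_def)
  from O obtain C where C: "0 < C" and "eventually (\<lambda>x. norm (l x) \<le> C * norm (exp (c * \<bar>x\<bar> powr r))) at_infinity"
    by (auto elim: landau_o.bigE)
  then obtain A0 where A0: "\<And>x. A0 \<le> \<bar>x\<bar> \<Longrightarrow> l x \<le> C * exp (c * \<bar>x\<bar> powr r)"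
    by (force simp: eventually_at_infinity)
  obtain A1 where A1: "\<And>y. A1 \<le> y \<Longrightarrow> c * y powr r \<le> \<kappa> * y\<^sup>2"
    using powr_le_square_eventually[OF cr(1,3) \<kappa>] by auto
  define A where "A = max 0 (max A0 A1)"
  \<comment> \<open>Beyond \<open>A\<close> the growth condition applies; below \<open>A\<close> the loss is at most \<open>l A\<close>.\<close>
  have "l x \<le> (C + l A) * exp (\<kappa> * x\<^sup>2)" for x
  proof (cases "A \<le> \<bar>x\<bar>")
    case True
    have "l x \<le> C * exp (c * \<bar>x\<bar> powr r)" using A0 True by (simp add: A_def)
    also have "\<dots> \<le> C * exp (\<kappa> * x\<^sup>2)"
      using A1[of "\<bar>x\<bar>"] True C by (simp add: A_def)
    also have "\<dots> \<le> (C + l A) * exp (\<kappa> * x\<^sup>2)"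
      using W_loss_nonneg[OF W] by (intro mult_right_mono) auto
    finally show ?thesis .
  next
    case False
    moreover have "0 \<le> A" by (simp add: A_def)
    ultimately have "l x \<le> l A * 1" using W_loss_mono[OF W, of x A] by simp
    also have "\<dots> \<le> (C + l A) * exp (\<kappa> * x\<^sup>2)"
      using W_loss_nonneg[OF W] C \<kappa> by (intro mult_mono) (auto intro: add_nonneg_nonneg less_imp_le)
    finally show ?thesis .
  qed
  moreover have "0 < C + l A" using C W_loss_nonneg[OF W] by (rule add_pos_nonneg)
  ultimately show ?thesis by blast
qed

text \<open>The bound is restricted to large arguments: a prior may be unbounded near \<open>0\<close>.\<close>

lemma Q_e2_subgaussian:
  assumes "\<rho> \<in> Q_e2" and \<kappa>: "0 < \<kappa>"
  shows "\<exists>A>0. \<exists>C>0. \<forall>x\<ge>A. \<rho> x \<le> C * exp (\<kappa> * x\<^sup>2)"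
proof -
  from assms obtain c r where cr: "0 < c" "0 < r" "r < 2"
    and O: "\<rho> \<in> O[at_top](\<lambda>\<theta>. exp (c * \<theta> powr r))"
    by (auto simp: Q_e2_def)
  from O obtain C where C: "0 < C" and "eventually (\<lambda>x. norm (\<rho> x) \<le> C * norm (exp (c * x powr r))) at_top"
    by (auto elim: landau_o.bigE)
  then obtain A0 where A0: "\<And>x. A0 \<le> x \<Longrightarrow> \<rho> x \<le> C * exp (c * x powr r)"
    by (force simp: eventually_at_top_linorder)
  obtain A1 where A1: "0 < A1" "\<And>y. A1 \<le> y \<Longrightarrow> c * y powr r \<le> \<kappa> * y\<^sup>2"
    using powr_le_square_eventually[OF cr(1,3) \<kappa>] by auto
  have "\<rho> x \<le> C * exp (\<kappa> * x\<^sup>2)" if "max A0 A1 \<le> x" for x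
    using A0[of x] A1(2)[of x] that C by (smt (verit) exp_le_cancel_iff mult_left_mono max.bounded_iff)
  then show ?thesis using A1(1) C by (intro exI[of _ "max A0 A1"]) auto
qed

lemma nn_integral_gaussian: "(\<integral>\<^sup>+t. ennreal (exp (- (t\<^sup>2 / 2))) \<partial>lborel) = ennreal (sqrt (2 * pi))"
proof -
  have "(\<integral>\<^sup>+t. ennreal (exp (- (t\<^sup>2 / 2))) \<partial>lborel)
      = (\<integral>\<^sup>+t. ennreal (sqrt (2 * pi)) * ennreal (std_normal_density t) \<partial>lborel)"
    by (intro nn_integral_cong) (simp add: std_normal_density_def ennreal_mult'[symmetric])
  also have "\<dots> = ennreal (sqrt (2 * pi)) * (\<integral>\<^sup>+t. ennreal (std_normal_density t) \<partial>lborel)"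
    by (rule nn_integral_cmult) simp
  also have "(\<integral>\<^sup>+t. ennreal (std_normal_density t) \<partial>lborel) = 1"
    by (subst nn_integral_eq_integral) auto
  finally show ?thesis by simp
qed

definition gaussian_risk :: "(real \<Rightarrow> real) \<Rightarrow> real \<Rightarrow> ennreal" where
  "gaussian_risk l r = (\<integral>\<^sup>+t. ennreal (l (t - r) * exp (- (t\<^sup>2 / 2))) \<partial>lborel)"

text \<open>Truncation to \<open>[- \<Lambda>, \<Lambda>]\<close> keeps the weight symmetric and unimodal, so that the Anderson inequality
  applies, and confines the prior to a small neighbourhood of the observed value.\<close>

definition truncated_risk :: "(real \<Rightarrow> real) \<Rightarrow> real \<Rightarrow> real \<Rightarrow> ennreal" where
  "truncated_risk l \<Lambda> r =
     (\<integral>\<^sup>+t. ennreal (l (t - r) * (exp (- (t\<^sup>2 / 2)) * indicator {-\<Lambda>..\<Lambda>} t)) \<partial>lborel)"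

lemma truncated_risk_mono:
  assumes "l \<in> W_loss" "\<bar>r\<bar> \<le> \<bar>r'\<bar>"
  shows "truncated_risk l \<Lambda> r \<le> truncated_risk l \<Lambda> r'"
  unfolding truncated_risk_def
proof (rule anderson_inequality)
  fix x y :: real assume "\<bar>x\<bar> \<le> \<bar>y\<bar>"
  then have "exp (- (y\<^sup>2 / 2)) \<le> exp (- (x\<^sup>2 / 2))"
    and "indicator {-\<Lambda>..\<Lambda>} y \<le> (indicator {-\<Lambda>..\<Lambda>} x :: real)"
    by (simp add: abs_le_square_iff, auto simp: indicator_def)
  then show "exp (- (y\<^sup>2 / 2)) * indicator {-\<Lambda>..\<Lambda>} y \<le> exp (- (x\<^sup>2 / 2)) * indicator {-\<Lambda>..\<Lambda>} x"
    by (intro mult_mono) auto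
qed (use assms in \<open>auto simp: W_loss_nonneg W_loss_measurable W_loss_mono\<close>)

lemma truncated_risk_SUP:
  assumes l: "l \<in> W_loss"
  shows "(SUP n::nat. truncated_risk l (real n) r) = gaussian_risk l r"
proof -
  note [measurable] = W_loss_measurable[OF l]
  let ?f = "\<lambda>n t. ennreal (l (t - r) * (exp (- (t\<^sup>2 / 2)) * indicator {- real n..real n} t))"
  have inc: "incseq ?f"
    using W_loss_nonneg[OF l]
    by (auto simp: incseq_def le_fun_def indicator_def intro!: ennreal_leI)
  have "(SUP n. ?f n t) = ennreal (l (t - r) * exp (- (t\<^sup>2 / 2)))" for t
  proof (rule antisym)
    show "(SUP n. ?f n t) \<le> ennreal (l (t - r) * exp (- (t\<^sup>2 / 2)))"
      using W_loss_nonneg[OF l] by (auto simp: indicator_def intro!: SUP_least ennreal_leI)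
    obtain n where "\<bar>t\<bar> \<le> real n" using real_arch_simple by blast
    then have "?f n t = ennreal (l (t - r) * exp (- (t\<^sup>2 / 2)))" by (auto simp: indicator_def abs_le_iff)
    then show "ennreal (l (t - r) * exp (- (t\<^sup>2 / 2))) \<le> (SUP n. ?f n t)"
      by (intro SUP_upper2[of n] UNIV_I) (simp only: order_refl)
  qed
  then have "gaussian_risk l r = (\<integral>\<^sup>+t. (SUP n. ?f n t) \<partial>lborel)"
    by (simp only: gaussian_risk_def)
  also have "\<dots> = (SUP n. \<integral>\<^sup>+t. ?f n t \<partial>lborel)"
    by (rule nn_integral_monotone_convergence_SUP[OF inc]) measurable
  finally show ?thesis by (simp only: truncated_risk_def)
qed

lemma gaussian_risk_zero_finite:
  assumes l: "l \<in> W_e2"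
  shows "gaussian_risk l 0 < \<infinity>"
proof -
  obtain C where C: "0 < C" "\<And>x. l x \<le> C * exp (1/4 * x\<^sup>2)"
    using W_e2_subgaussian[OF l, of "1/4"] by auto
  have "gaussian_risk l 0 \<le> (\<integral>\<^sup>+t. ennreal (C * exp (- (t\<^sup>2 / 4))) \<partial>lborel)"
    unfolding gaussian_risk_def
  proof (intro nn_integral_mono ennreal_leI)
    fix t :: real
    have "l t * exp (- (t\<^sup>2 / 2)) \<le> C * exp (1/4 * t\<^sup>2) * exp (- (t\<^sup>2 / 2))"
      by (intro mult_right_mono C) auto
    also have "\<dots> = C * exp (- (t\<^sup>2 / 4))" by (simp add: exp_add[symmetric])
    finally show "l (t - 0) * exp (- (t\<^sup>2 / 2)) \<le> C * exp (- (t\<^sup>2 / 4))" by simp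
  qed
  also have "\<dots> = ennreal (sqrt 2) * (\<integral>\<^sup>+t. ennreal (C * exp (- (t\<^sup>2 / 2))) \<partial>lborel)"
    by (subst nn_integral_real_affine[where c = "sqrt 2" and t = 0]) (auto simp: power_mult_distrib)
  also have "\<dots> = ennreal (sqrt 2) * (ennreal C * ennreal (sqrt (2 * pi)))"
    using C by (simp add: ennreal_mult' nn_integral_cmult nn_integral_gaussian)
  also have "\<dots> < \<infinity>" by (simp add: ennreal_mult_less_top)
  finally show ?thesis .
qed

text \<open>The truncated risks increase to the full risk at \<open>\<epsilon>\<close>, which is strictly larger than the risk at
  \<open>0\<close>. The Bochner integral at \<open>0\<close> exists by the growth condition. If the one at \<open>\<epsilon>\<close> did not
  exist, its value would be \<open>0\<close> by convention, contradicting the strict minimum; so both agree with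
  the nonnegative integrals.\<close>

lemma gaussian_risk_strict_gap:
  assumes l: "l \<in> W_e2" and "\<epsilon> \<noteq> 0"
    and strict: "\<And>r. r \<noteq> 0 \<Longrightarrow>
      (LBINT y. l y * exp (- (y\<^sup>2 / 2))) < (LBINT y. l (y + r) * exp (- (y\<^sup>2 / 2)))"
  shows "\<exists>\<Lambda>>0. gaussian_risk l 0 < truncated_risk l \<Lambda> \<epsilon>"
proof -
  have W: "l \<in> W_loss" using l by (simp add: W_e2_def)
  note [measurable] = W_loss_measurable[OF W]
  define f where "f r y = l (y - r) * exp (- (y\<^sup>2 / 2))" for r y
  have [measurable]: "f r \<in> borel_measurable lborel" for r
    unfolding f_def by measurable
  have f0: "AE y in lborel. 0 \<le> f r y" for r
    using W_loss_nonneg[OF W] by (simp add: f_def)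
  have gr: "gaussian_risk l r = (\<integral>\<^sup>+y. ennreal (f r y) \<partial>lborel)" for r
    by (simp add: gaussian_risk_def f_def)
  have i0: "integrable lborel (f 0)"
    using gaussian_risk_zero_finite[OF l] by (intro integrableI_nonneg f0) (auto simp: gr)
  have g0: "gaussian_risk l 0 = ennreal (integral\<^sup>L lborel (f 0))"
    unfolding gr by (rule nn_integral_eq_integral[OF i0 f0])
  have lt: "integral\<^sup>L lborel (f 0) < integral\<^sup>L lborel (f \<epsilon>)"
    using strict[of "- \<epsilon>"] \<open>\<epsilon> \<noteq> 0\<close> by (simp add: f_def[abs_def])
  have ge0: "0 \<le> integral\<^sup>L lborel (f 0)"
    by (intro integral_nonneg_AE f0)
  have i1: "integrable lborel (f \<epsilon>)"
    using lt ge0 not_integrable_integral_eq[of lborel "f \<epsilon>"] by fastforce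
  have g1: "gaussian_risk l \<epsilon> = ennreal (integral\<^sup>L lborel (f \<epsilon>))"
    unfolding gr by (rule nn_integral_eq_integral[OF i1 f0])
  have "gaussian_risk l 0 < (SUP n::nat. truncated_risk l (real n) \<epsilon>)"
    unfolding truncated_risk_SUP[OF W] g0 g1 using lt ge0 by (simp add: ennreal_less_iff)
  then obtain n :: nat where n: "gaussian_risk l 0 < truncated_risk l (real n) \<epsilon>"
    by (auto simp: less_SUP_iff)
  have "truncated_risk l (real n) \<epsilon> \<le> truncated_risk l (real (Suc n)) \<epsilon>"
    unfolding truncated_risk_def using W_loss_nonneg[OF W]
    by (intro nn_integral_mono ennreal_leI mult_left_mono) (auto simp: indicator_def)
  with n show ?thesis by (intro exI[of _ "real (Suc n)"]) auto
qed

section \<open>Localization of the posterior risk\<close>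

text \<open>The risk in the local variables \<open>t = s (\<eta> - x)\<close> and \<open>r = s (\<beta> - x)\<close> with \<open>s = sqrt I\<close>.\<close>

definition scaled_risk :: "(real \<Rightarrow> real) \<Rightarrow> (real \<Rightarrow> real) \<Rightarrow> real \<Rightarrow> real \<Rightarrow> real \<Rightarrow> ennreal" where
  "scaled_risk \<rho> l s x r =
     (\<integral>\<^sup>+t. ennreal (l (t - r) * exp (- (t\<^sup>2 / 2)) * \<rho> (x + t / s)) \<partial>lborel)"

lemma weighted_risk_rescale:
  assumes [measurable]: "l \<in> borel_measurable borel" "\<rho> \<in> borel_measurable borel"
    and I: "0 < I"
  shows "weighted_risk \<rho> l I x \<beta> = ennreal (1 / sqrt I) * scaled_risk \<rho> l (sqrt I) x (sqrt I * (\<beta> - x))"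
proof -
  have eq: "l (sqrt I * (x + 1 / sqrt I * t - \<beta>)) * exp (- (I * (x + 1 / sqrt I * t - x)\<^sup>2 / 2)) * \<rho> (x + 1 / sqrt I * t)
     = l (t - sqrt I * (\<beta> - x)) * exp (- (t\<^sup>2 / 2)) * \<rho> (x + t / sqrt I)" for t
  proof -
    have "sqrt I * (x + 1 / sqrt I * t - \<beta>) = t - sqrt I * (\<beta> - x)"
      using I by (simp add: field_simps)
    moreover have "I * (x + 1 / sqrt I * t - x)\<^sup>2 = t\<^sup>2"
      using I by (simp add: power_divide)
    ultimately show ?thesis by simp
  qed
  show ?thesis
    unfolding weighted_risk_def scaled_risk_def
    by (subst nn_integral_real_affine[where c = "1 / sqrt I" and t = x]) (use I in \<open>simp_all only: eq, simp_all\<close>)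
qed

lemma scaled_risk_lower:
  assumes l: "l \<in> W_loss" and [measurable]: "\<rho> \<in> borel_measurable borel" and \<rho>0: "\<And>x. 0 \<le> \<rho> x"
    and a: "0 \<le> a" and near: "\<And>t. \<bar>t\<bar> \<le> \<Lambda> \<Longrightarrow> a \<le> \<rho> (x + t / s)" and r: "0 \<le> \<epsilon>" "\<epsilon> \<le> \<bar>r\<bar>"
  shows "ennreal a * truncated_risk l \<Lambda> \<epsilon> \<le> scaled_risk \<rho> l s x r"
proof -
  note [measurable] = W_loss_measurable[OF l]
  have "ennreal a * truncated_risk l \<Lambda> \<epsilon> \<le> ennreal a * truncated_risk l \<Lambda> r"
    using r by (intro mult_left_mono truncated_risk_mono[OF l]) auto
  also have "\<dots> = (\<integral>\<^sup>+t. ennreal (a * (l (t - r) * (exp (- (t\<^sup>2 / 2)) * indicator {-\<Lambda>..\<Lambda>} t))) \<partial>lborel)"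
    unfolding truncated_risk_def using a
    by (simp add: ennreal_mult' nn_integral_cmult)
  also have "\<dots> \<le> scaled_risk \<rho> l s x r"
    unfolding scaled_risk_def
  proof (intro nn_integral_mono ennreal_leI)
    fix t :: real
    show "a * (l (t - r) * (exp (- (t\<^sup>2 / 2)) * indicator {-\<Lambda>..\<Lambda>} t))
        \<le> l (t - r) * exp (- (t\<^sup>2 / 2)) * \<rho> (x + t / s)"
    proof (cases "\<bar>t\<bar> \<le> \<Lambda>")
      case True
      then have "a * (l (t - r) * exp (- (t\<^sup>2 / 2))) \<le> \<rho> (x + t / s) * (l (t - r) * exp (- (t\<^sup>2 / 2)))"
        using W_loss_nonneg[OF l] by (intro mult_right_mono near) auto
      then show ?thesis using True by (simp add: indicator_def abs_le_iff mult.commute)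
    next
      case False
      then have "t \<notin> {-\<Lambda>..\<Lambda>}" by (auto simp: abs_le_iff)
      then show ?thesis using W_loss_nonneg[OF l] \<rho>0 by simp
    qed
  qed
  finally show ?thesis .
qed

text \<open>Near \<open>x\<close> the prior is at most \<open>a\<close>. Farther away, \<open>l(t) exp(- t\<^sup>2 / 2)\<close> is at most a multiple of
  \<open>exp(- t\<^sup>2 / 4)\<close>, and of the available exponent \<open>s\<^sup>2 h\<^sup>2 / 4\<close> the amount \<open>2 h\<^sup>2\<close> is reserved to make the
  prior integrable while the rest is small uniformly for \<open>\<bar>h\<bar> > \<delta>\<close>.\<close>

lemma scaled_risk_upper:
  assumes l: "l \<in> W_loss" and [measurable]: "\<rho> \<in> borel_measurable borel" and \<rho>0: "\<And>x. 0 \<le> \<rho> x"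
    and C: "0 \<le> C" "\<And>t. l t \<le> C * exp (1/4 * t\<^sup>2)"
    and s: "8 \<le> s\<^sup>2" "0 < s" and \<delta>: "0 < \<delta>" and a: "0 \<le> a"
    and near: "\<And>h. \<bar>h\<bar> \<le> \<delta> \<Longrightarrow> \<rho> (x + h) \<le> a"
  shows "scaled_risk \<rho> l s x 0 \<le> ennreal a * gaussian_risk l 0
     + ennreal (C * exp (2 * x\<^sup>2) * (s * exp (- ((s\<^sup>2 - 8) * \<delta>\<^sup>2 / 4)))) * (\<integral>\<^sup>+\<eta>. ennreal (exp (- \<eta>\<^sup>2) * \<rho> \<eta>) \<partial>lborel)"
proof -
  note [measurable] = W_loss_measurable[OF l]
  define D where "D = C * exp (2 * x\<^sup>2) * exp (- ((s\<^sup>2 - 8) * \<delta>\<^sup>2 / 4))"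
  have D0: "0 \<le> D" using C by (simp add: D_def)
  have pt: "l t * exp (- (t\<^sup>2 / 2)) * \<rho> (x + t / s)
      \<le> a * (l t * exp (- (t\<^sup>2 / 2))) + D * (exp (- (x + t / s)\<^sup>2) * \<rho> (x + t / s))" for t
  proof (cases "\<bar>t / s\<bar> \<le> \<delta>")
    case True
    have "l t * exp (- (t\<^sup>2 / 2)) * \<rho> (x + t / s) \<le> l t * exp (- (t\<^sup>2 / 2)) * a"
      using W_loss_nonneg[OF l] near[OF True] by (intro mult_left_mono) auto
    moreover have "0 \<le> D * (exp (- (x + t / s)\<^sup>2) * \<rho> (x + t / s))" using D0 \<rho>0 by simp
    ultimately show ?thesis by (simp add: mult.commute)
  next
    case False
    define h where "h = t / s"
    have t: "t = s * h" using s by (simp add: h_def)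
    have "\<delta>\<^sup>2 \<le> h\<^sup>2" using False \<delta> by (simp add: h_def abs_le_square_iff[symmetric])
    then have "(s\<^sup>2 - 8) * \<delta>\<^sup>2 \<le> (s\<^sup>2 - 8) * h\<^sup>2" using s by (intro mult_left_mono) auto
    have "0 \<le> (h - x)\<^sup>2" by simp
    \<comment> \<open>After \<open>\<delta>\<close> is replaced by \<open>\<bar>h\<bar>\<close>, the slack in this inequality is \<open>(h - x)\<^sup>2\<close>.\<close>
    have ex: "1/4 * t\<^sup>2 + - (t\<^sup>2 / 2) \<le> 2 * x\<^sup>2 + - ((s\<^sup>2 - 8) * \<delta>\<^sup>2 / 4) + - (x + h)\<^sup>2"
    proof -
      have "(s\<^sup>2 - 8) * h\<^sup>2 = s\<^sup>2 * h\<^sup>2 - 8 * h\<^sup>2" by (simp add: algebra_simps)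
      moreover have "(h - x)\<^sup>2 = h\<^sup>2 - 2 * (x * h) + x\<^sup>2" "(x + h)\<^sup>2 = x\<^sup>2 + 2 * (x * h) + h\<^sup>2" "t\<^sup>2 = s\<^sup>2 * h\<^sup>2"
        by (simp_all add: t power2_eq_square algebra_simps)
      ultimately show ?thesis
        using \<open>(s\<^sup>2 - 8) * \<delta>\<^sup>2 \<le> (s\<^sup>2 - 8) * h\<^sup>2\<close> \<open>0 \<le> (h - x)\<^sup>2\<close> by linarith
    qed
    have "l t * exp (- (t\<^sup>2 / 2)) \<le> C * exp (1/4 * t\<^sup>2) * exp (- (t\<^sup>2 / 2))"
      by (intro mult_right_mono C) auto
    also have "\<dots> = C * exp (1/4 * t\<^sup>2 + - (t\<^sup>2 / 2))" by (simp only: exp_add mult.assoc)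
    also have "\<dots> \<le> C * exp (2 * x\<^sup>2 + - ((s\<^sup>2 - 8) * \<delta>\<^sup>2 / 4) + - (x + h)\<^sup>2)"
      using C ex by (intro mult_left_mono) auto
    also have "\<dots> = D * exp (- (x + h)\<^sup>2)" by (simp only: exp_add D_def mult.assoc)
    finally have "l t * exp (- (t\<^sup>2 / 2)) * \<rho> (x + h) \<le> D * exp (- (x + h)\<^sup>2) * \<rho> (x + h)"
      by (rule mult_right_mono) (rule \<rho>0)
    moreover have "0 \<le> a * (l t * exp (- (t\<^sup>2 / 2)))" using a W_loss_nonneg[OF l] by simp
    ultimately show ?thesis by (simp add: h_def mult.assoc)
  qed
  have "scaled_risk \<rho> l s x 0 \<le> (\<integral>\<^sup>+t. ennreal (a * (l t * exp (- (t\<^sup>2 / 2))) + D * (exp (- (x + t / s)\<^sup>2) * \<rho> (x + t / s))) \<partial>lborel)"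
    unfolding scaled_risk_def by (intro nn_integral_mono ennreal_leI) (simp add: pt)
  also have "\<dots> = ennreal a * gaussian_risk l 0 + ennreal D * (\<integral>\<^sup>+t. ennreal (exp (- (x + t / s)\<^sup>2) * \<rho> (x + t / s)) \<partial>lborel)"
    unfolding gaussian_risk_def using a D0 W_loss_nonneg[OF l] \<rho>0
    by (simp add: ennreal_plus ennreal_mult' nn_integral_add nn_integral_cmult)
  also have "(\<integral>\<^sup>+t. ennreal (exp (- (x + t / s)\<^sup>2) * \<rho> (x + t / s)) \<partial>lborel)
      = ennreal s * (\<integral>\<^sup>+\<eta>. ennreal (exp (- \<eta>\<^sup>2) * \<rho> \<eta>) \<partial>lborel)"
    using s nn_integral_real_affine[of "\<lambda>\<eta>. ennreal (exp (- \<eta>\<^sup>2) * \<rho> \<eta>)" "1 / s" x]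
    by (simp add: ennreal_mult'[symmetric] mult.assoc[symmetric])
  also have "ennreal D * (ennreal s * (\<integral>\<^sup>+\<eta>. ennreal (exp (- \<eta>\<^sup>2) * \<rho> \<eta>) \<partial>lborel))
     = ennreal (C * exp (2 * x\<^sup>2) * (s * exp (- ((s\<^sup>2 - 8) * \<delta>\<^sup>2 / 4)))) * (\<integral>\<^sup>+\<eta>. ennreal (exp (- \<eta>\<^sup>2) * \<rho> \<eta>) \<partial>lborel)"
  proof -
    have "C * exp (2 * x\<^sup>2) * (s * exp (- ((s\<^sup>2 - 8) * \<delta>\<^sup>2 / 4))) = D * s"
      by (simp add: D_def mult_ac)
    moreover have "ennreal (D * s) = ennreal D * ennreal s" using D0 by (rule ennreal_mult')
    ultimately show ?thesis by (simp only: mult.assoc)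
  qed
  finally show ?thesis .
qed

text \<open>The gap between the Gaussian risk \<open>P\<close> at \<open>0\<close> and a truncated risk \<open>A\<close> at \<open>\<epsilon>\<close> survives a relative
  perturbation of the prior by \<open>\<tau>\<close> and a tail of size \<open>\<tau> \<rho>(x)\<close>. The former is available on a fixed
  neighbourhood of the compact interval by uniform continuity, the latter for large \<open>s\<close>.\<close>

lemma risk_localization:
  assumes l: "l \<in> W_e2" and [measurable]: "\<rho> \<in> borel_measurable borel" and \<rho>0: "\<And>x. 0 \<le> \<rho> x"
    and cont: "continuous_on {0<..} \<rho>" and pos: "\<And>x. 0 < x \<Longrightarrow> 0 < \<rho> x"
    and fin: "(\<integral>\<^sup>+\<eta>. ennreal (exp (- \<eta>\<^sup>2) * \<rho> \<eta>) \<partial>lborel) < \<infinity>"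
    and ab: "0 < a" "a \<le> b" and \<epsilon>: "0 < \<epsilon>"
    and gap: "gaussian_risk l 0 < truncated_risk l \<Lambda> \<epsilon>" and \<Lambda>: "0 < \<Lambda>"
  shows "\<exists>S>0. \<forall>s\<ge>S. \<forall>x\<in>{a..b}. \<forall>r. \<epsilon> \<le> \<bar>r\<bar> \<longrightarrow> scaled_risk \<rho> l s x 0 < scaled_risk \<rho> l s x r"
proof -
  have W: "l \<in> W_loss" using l by (simp add: W_e2_def)
  note [measurable] = W_loss_measurable[OF W]
  obtain C where C: "0 < C" "\<And>t. l t \<le> C * exp (1/4 * t\<^sup>2)"
    using W_e2_subgaussian[OF l, of "1/4"] by auto
  obtain J where J: "0 \<le> J" "(\<integral>\<^sup>+\<eta>. ennreal (exp (- \<eta>\<^sup>2) * \<rho> \<eta>) \<partial>lborel) = ennreal J"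
    using fin by (cases "(\<integral>\<^sup>+\<eta>. ennreal (exp (- \<eta>\<^sup>2) * \<rho> \<eta>) \<partial>lborel)") auto
  obtain P where P: "0 \<le> P" "gaussian_risk l 0 = ennreal P"
    using gap by (cases "gaussian_risk l 0") auto
  obtain A where A: "P < A" "ennreal A \<le> truncated_risk l \<Lambda> \<epsilon>"
  proof (cases "truncated_risk l \<Lambda> \<epsilon>")
    case (real u)
    then show ?thesis using gap P that[of u] by (auto simp: ennreal_less_iff)
  next
    case top
    then show ?thesis using that[of "P + 1"] by simp
  qed
  \<comment> \<open>Any \<open>\<tau>\<close> with \<open>\<tau> (A + P + 1) < A - P\<close> closes the argument below.\<close>
  define \<tau> where "\<tau> = (A - P) / (2 * (A + P + 1))"
  have \<tau>: "0 < \<tau>" "\<tau> < 1" "(1 + \<tau>) * P + \<tau> < (1 - \<tau>) * A"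
  proof -
    show "0 < \<tau>" "\<tau> < 1" using A P by (auto simp: \<tau>_def field_simps)
    have "\<tau> * (A + P + 1) = (A - P) / 2" using A P by (simp add: \<tau>_def field_simps)
    then have "\<tau> * (A + P + 1) < A - P" using A by simp
    then show "(1 + \<tau>) * P + \<tau> < (1 - \<tau>) * A" by (simp add: algebra_simps)
  qed
  have "compact {a/2..b+1}" by simp
  have sub: "{a/2..b+1} \<subseteq> {0<..}" using ab by auto
  have uc: "uniformly_continuous_on {a/2..b+1} \<rho>"
    by (intro compact_uniformly_continuous continuous_on_subset[OF cont sub]) simp
  obtain m where m: "0 < m" "\<And>x. x \<in> {a..b} \<Longrightarrow> m \<le> \<rho> x"
  proof -
    have "\<exists>y\<in>{a..b}. \<forall>z\<in>{a..b}. \<rho> y \<le> \<rho> z"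
      using ab by (intro continuous_attains_inf continuous_on_subset[OF cont]) auto
    then show ?thesis using that pos ab by (metis atLeastAtMost_iff less_le_trans)
  qed
  obtain \<delta>0 where \<delta>0: "0 < \<delta>0" "\<And>x y. x \<in> {a/2..b+1} \<Longrightarrow> y \<in> {a/2..b+1} \<Longrightarrow> \<bar>y - x\<bar> < \<delta>0 \<Longrightarrow> \<bar>\<rho> y - \<rho> x\<bar> < \<tau> * m"
    using uc \<tau>(1) m(1) unfolding uniformly_continuous_on_def dist_real_def by (metis mult_pos_pos)
  define \<delta> where "\<delta> = Min {\<delta>0 / 2, a / 2, 1}"
  have \<delta>: "0 < \<delta>" "\<delta> < \<delta>0" "\<delta> \<le> a / 2" "\<delta> \<le> 1" using \<delta>0 ab by (auto simp: \<delta>_def)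
  have near: "(1 - \<tau>) * \<rho> x \<le> \<rho> (x + h)" "\<rho> (x + h) \<le> (1 + \<tau>) * \<rho> x" if "x \<in> {a..b}" "\<bar>h\<bar> \<le> \<delta>" for x h
  proof -
    have "x \<in> {a/2..b+1}" "x + h \<in> {a/2..b+1}" "\<bar>(x + h) - x\<bar> < \<delta>0" using that \<delta> ab by auto
    from \<delta>0(2)[OF this] have "\<bar>\<rho> (x + h) - \<rho> x\<bar> < \<tau> * m" .
    also have "\<tau> * m \<le> \<tau> * \<rho> x" using m(2)[OF that(1)] \<tau> by (intro mult_left_mono) auto
    finally show "(1 - \<tau>) * \<rho> x \<le> \<rho> (x + h)" "\<rho> (x + h) \<le> (1 + \<tau>) * \<rho> x" by (auto simp: algebra_simps)
  qed
  define K where "K = C * exp (2 * b\<^sup>2) * J"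
  have "((\<lambda>s. K * (s * exp (- ((s\<^sup>2 - 8) * \<delta>\<^sup>2 / 4)))) \<longlongrightarrow> 0) at_top"
    using \<delta>(1) by real_asymp
  then have "eventually (\<lambda>s. K * (s * exp (- ((s\<^sup>2 - 8) * \<delta>\<^sup>2 / 4))) < \<tau> * m) at_top"
    using \<tau> m by (intro order_tendstoD) auto
  then obtain S0 where S0: "\<And>s. S0 \<le> s \<Longrightarrow> K * (s * exp (- ((s\<^sup>2 - 8) * \<delta>\<^sup>2 / 4))) < \<tau> * m"
    by (auto simp: eventually_at_top_linorder)
  define S where "S = Max {S0, 3, \<Lambda> / \<delta>}"
  show ?thesis
  proof (intro exI[of _ S] conjI allI ballI impI)
    show "0 < S" by (simp add: S_def less_max_iff_disj)
    fix s x r assume s: "S \<le> s" and x: "x \<in> {a..b}" and r: "\<epsilon> \<le> \<bar>r\<bar>"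
    have s': "S0 \<le> s" "3 \<le> s" "\<Lambda> / \<delta> \<le> s" using s by (auto simp: S_def)
    have "3\<^sup>2 \<le> s\<^sup>2" using s' by (intro power_mono) auto
    then have s8: "8 \<le> s\<^sup>2" by simp
    have rx: "0 < \<rho> x" using x ab by (intro pos) auto
    define E where "E = s * exp (- ((s\<^sup>2 - 8) * \<delta>\<^sup>2 / 4))"
    have E0: "0 \<le> E" using s' by (simp add: E_def)
    have "scaled_risk \<rho> l s x 0 \<le> ennreal ((1 + \<tau>) * \<rho> x) * gaussian_risk l 0
      + ennreal (C * exp (2 * x\<^sup>2) * (s * exp (- ((s\<^sup>2 - 8) * \<delta>\<^sup>2 / 4)))) * (\<integral>\<^sup>+\<eta>. ennreal (exp (- \<eta>\<^sup>2) * \<rho> \<eta>) \<partial>lborel)"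
      using s' s8 \<delta> near(2)[OF x] \<tau> rx C
      by (intro scaled_risk_upper[OF W _ \<rho>0]) auto
    also have "\<dots> = ennreal ((1 + \<tau>) * \<rho> x * P + C * exp (2 * x\<^sup>2) * E * J)"
      unfolding J P E_def[symmetric] using P J C E0 \<tau> rx
      by (simp add: ennreal_mult'[symmetric] ennreal_plus[symmetric] del: ennreal_plus)
    also have "\<dots> < ennreal ((1 - \<tau>) * \<rho> x * A)"
    proof (rule ennreal_lessI)
      show "0 < (1 - \<tau>) * \<rho> x * A" using \<tau> rx A P by simp
      have "x\<^sup>2 \<le> b\<^sup>2" using x ab by (intro power_mono) auto
      then have "C * exp (2 * x\<^sup>2) * E * J \<le> C * exp (2 * b\<^sup>2) * E * J"
        using C E0 J by (intro mult_right_mono mult_left_mono) auto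
      also have "\<dots> = K * E" by (simp add: K_def)
      also have "\<dots> < \<tau> * m" using S0[OF s'(1)] by (simp add: E_def)
      also have "\<dots> \<le> \<tau> * \<rho> x" using m(2)[OF x] \<tau> by simp
      finally have "(1 + \<tau>) * \<rho> x * P + C * exp (2 * x\<^sup>2) * E * J < \<rho> x * ((1 + \<tau>) * P + \<tau>)"
        by (simp add: algebra_simps)
      also have "\<dots> < \<rho> x * ((1 - \<tau>) * A)" using \<tau>(3) rx by simp
      finally show "(1 + \<tau>) * \<rho> x * P + C * exp (2 * x\<^sup>2) * E * J < (1 - \<tau>) * \<rho> x * A"
        by (simp add: mult_ac)
    qed
    also have "\<dots> = ennreal ((1 - \<tau>) * \<rho> x) * ennreal A" using \<tau> rx by (simp add: ennreal_mult')
    also have "\<dots> \<le> ennreal ((1 - \<tau>) * \<rho> x) * truncated_risk l \<Lambda> \<epsilon>"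
      using A by (intro mult_left_mono) auto
    also have "\<dots> \<le> scaled_risk \<rho> l s x r"
    proof (rule scaled_risk_lower[OF W _ \<rho>0])
      fix t assume "\<bar>t\<bar> \<le> \<Lambda>"
      have "\<Lambda> \<le> \<delta> * s" using s'(3) \<delta>(1) by (simp add: field_simps)
      then have "\<bar>t / s\<bar> \<le> \<delta>" using \<open>\<bar>t\<bar> \<le> \<Lambda>\<close> s' by (simp add: field_simps)
      then show "(1 - \<tau>) * \<rho> x \<le> \<rho> (x + t / s)" by (rule near(1)[OF x])
    qed (use r \<epsilon> \<tau> rx in auto)
    finally show "scaled_risk \<rho> l s x 0 < scaled_risk \<rho> l s x r" .
  qed
qed

text \<open>For the uniform prior the only perturbation is the boundary at \<open>0\<close>, which lies outside the
  truncation window as soon as \<open>s x > \<Lambda>\<close>. In contrast to the general case, the condition involves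
  the product \<open>s x\<close> only, so \<open>x\<close> may be arbitrarily close to \<open>0\<close>.\<close>

lemma uniform_prior_risk_localization:
  assumes l: "l \<in> W_loss" and \<epsilon>: "0 \<le> \<epsilon>" "\<epsilon> \<le> \<bar>r\<bar>" and s: "0 < s" "\<Lambda> < s * x"
    and gap: "gaussian_risk l 0 < truncated_risk l \<Lambda> \<epsilon>"
  shows "scaled_risk (indicator {0<..}) l s x 0 < scaled_risk (indicator {0<..}) l s x r"
proof -
  have "scaled_risk (indicator {0<..}) l s x 0 \<le> gaussian_risk l 0"
    unfolding scaled_risk_def gaussian_risk_def
    by (intro nn_integral_mono ennreal_leI mult_left_le) (simp_all add: indicator_def W_loss_nonneg[OF l])
  also have "\<dots> < ennreal 1 * truncated_risk l \<Lambda> \<epsilon>" using gap by simp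
  also have "\<dots> \<le> scaled_risk (indicator {0<..}) l s x r"
  proof (rule scaled_risk_lower[OF l])
    fix t assume "\<bar>t\<bar> \<le> \<Lambda>"
    then have "0 < s * x + t" using s by linarith
    moreover have "x + t / s = (s * x + t) / s" using s by (simp add: add_divide_distrib)
    ultimately have "0 < x + t / s" using s by simp
    then show "1 \<le> (indicator {0<..} (x + t / s) :: real)" by simp
  qed (use \<epsilon> in auto)
  finally show ?thesis .
qed

section \<open>Bayes estimates\<close>

definition extended_prior :: "(real \<Rightarrow> real) \<Rightarrow> real \<Rightarrow> real" where
  "extended_prior \<rho> \<eta> = indicator {0<..} \<eta> * \<rho> \<eta>"

lemma Q_e2_extended_prior:
  assumes "\<rho> \<in> Q_e2"
  shows "extended_prior \<rho> \<in> borel_measurable borel" "0 \<le> extended_prior \<rho> \<eta>"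
    "continuous_on {0<..} (extended_prior \<rho>)" "0 < \<eta> \<Longrightarrow> 0 < extended_prior \<rho> \<eta>"
proof -
  have c: "continuous_on {0<..} \<rho>" and p: "\<And>\<theta>. 0 < \<theta> \<Longrightarrow> 0 < \<rho> \<theta>" using assms by (auto simp: Q_e2_def)
  show "extended_prior \<rho> \<in> borel_measurable borel"
    using borel_measurable_continuous_on_indicator[OF _ c] by (simp add: extended_prior_def[abs_def])
  show "0 \<le> extended_prior \<rho> \<eta>" using p by (simp add: extended_prior_def indicator_def less_imp_le)
  show "continuous_on {0<..} (extended_prior \<rho>)"
    using c by (rule continuous_on_eq) (simp add: extended_prior_def)
  show "0 < \<eta> \<Longrightarrow> 0 < extended_prior \<rho> \<eta>" using p by (simp add: extended_prior_def)
qed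

text \<open>Integrability near \<open>0\<close> is not part of the conditions on a prior. It is inherited from a single
  instance in which the posterior is well defined, since there the likelihood is bounded below on
  bounded sets; at infinity the growth condition suffices.\<close>

lemma extended_prior_gaussian_mass_finite:
  assumes \<rho>: "\<rho> \<in> Q_e2" and wd: "bayes_well_defined \<rho> l I x" and I: "0 \<le> I"
  shows "(\<integral>\<^sup>+\<eta>. ennreal (exp (- \<eta>\<^sup>2) * extended_prior \<rho> \<eta>) \<partial>lborel) < \<infinity>"
proof -
  note [measurable] = Q_e2_extended_prior(1)[OF \<rho>]
  note ext0 = Q_e2_extended_prior(2)[OF \<rho>]
  obtain A C where A: "0 < A" "0 < C" "\<And>x. A \<le> x \<Longrightarrow> \<rho> x \<le> C * exp (1/2 * x\<^sup>2)"
    using Q_e2_subgaussian[OF \<rho>, of "1/2"] by auto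
  \<comment> \<open>The posterior weight at the given data value dominates the prior on bounded sets.\<close>
  define g where "g \<eta> = exp (- (I * (\<eta> - x)\<^sup>2 / 2)) * extended_prior \<rho> \<eta>" for \<eta>
  define D where "D = exp (I * (A + \<bar>x\<bar>)\<^sup>2 / 2)"
  have "integrable lborel g"
    using wd unfolding bayes_well_defined_def set_integrable_def
    by (simp add: g_def[abs_def] extended_prior_def posterior_weight_def mult_ac)
  moreover have g0: "0 \<le> g \<eta>" for \<eta> by (simp add: g_def ext0)
  ultimately have g_fin: "(\<integral>\<^sup>+\<eta>. ennreal (g \<eta>) \<partial>lborel) < \<infinity>"
    by (simp add: nn_integral_eq_integral)
  have [measurable]: "g \<in> borel_measurable borel" unfolding g_def by measurable
  have pt: "exp (- \<eta>\<^sup>2) * extended_prior \<rho> \<eta> \<le> D * g \<eta> + C * exp (- (\<eta>\<^sup>2 / 2))" for \<eta>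
  proof -
    consider "\<eta> \<le> 0" | "0 < \<eta>" "\<eta> < A" | "0 < \<eta>" "A \<le> \<eta>" by linarith
    then show ?thesis
    proof cases
      case 1
      then show ?thesis using g0[of \<eta>] A by (simp add: extended_prior_def D_def add_nonneg_nonneg)
    next
      case 2
      have "(\<eta> - x)\<^sup>2 \<le> (A + \<bar>x\<bar>)\<^sup>2" using 2 by (simp add: abs_le_square_iff[symmetric])
      then have "I * (\<eta> - x)\<^sup>2 \<le> I * (A + \<bar>x\<bar>)\<^sup>2" using I by (rule mult_left_mono)
      then have "1 \<le> D * exp (- (I * (\<eta> - x)\<^sup>2 / 2))" by (simp add: D_def exp_add[symmetric])
      then have "1 * extended_prior \<rho> \<eta> \<le> D * exp (- (I * (\<eta> - x)\<^sup>2 / 2)) * extended_prior \<rho> \<eta>"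
        using ext0 by (rule mult_right_mono)
      moreover have "exp (- \<eta>\<^sup>2) * extended_prior \<rho> \<eta> \<le> 1 * extended_prior \<rho> \<eta>"
        using ext0 by (intro mult_right_mono) auto
      moreover have "0 \<le> C * exp (- (\<eta>\<^sup>2 / 2))" using A by simp
      ultimately show ?thesis by (simp add: g_def mult.assoc)
    next
      case 3
      have "exp (- \<eta>\<^sup>2) * extended_prior \<rho> \<eta> \<le> exp (- \<eta>\<^sup>2) * (C * exp (1/2 * \<eta>\<^sup>2))"
        using A(3)[OF 3(2)] 3 by (intro mult_left_mono) (auto simp: extended_prior_def)
      also have "\<dots> = C * exp (- (\<eta>\<^sup>2 / 2))" by (simp add: exp_add[symmetric])
      finally show ?thesis using g0[of \<eta>] by (simp add: D_def add_increasing)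
    qed
  qed
  have "(\<integral>\<^sup>+\<eta>. ennreal (exp (- \<eta>\<^sup>2) * extended_prior \<rho> \<eta>) \<partial>lborel)
      \<le> (\<integral>\<^sup>+\<eta>. ennreal (D * g \<eta> + C * exp (- (\<eta>\<^sup>2 / 2))) \<partial>lborel)"
    by (intro nn_integral_mono ennreal_leI pt)
  also have "\<dots> = ennreal D * (\<integral>\<^sup>+\<eta>. ennreal (g \<eta>) \<partial>lborel) + ennreal C * ennreal (sqrt (2 * pi))"
    using A g0 by (simp add: D_def ennreal_plus ennreal_mult' nn_integral_add nn_integral_cmult nn_integral_gaussian)
  also have "\<dots> < \<infinity>" using g_fin by (simp add: ennreal_mult_less_top)
  finally show ?thesis .
qed

context
  fixes \<rho> l :: "real \<Rightarrow> real"
  assumes prior: "\<rho> \<in> Q_e2" and loss: "l \<in> W_loss"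
begin

text \<open>A strict minimizer is unique, so the choice operator behind the minimizer has no freedom, and
  division by the positive posterior mass does not affect comparisons.\<close>

lemma bayes_estimate_minimizes:
  assumes wd: "bayes_well_defined \<rho> l I x"
  shows "0 < bayes_estimate \<rho> l I x"
    and "\<And>\<beta>. 0 < \<beta> \<Longrightarrow> \<beta> \<noteq> bayes_estimate \<rho> l I x \<Longrightarrow>
      weighted_risk (extended_prior \<rho>) l I x (bayes_estimate \<rho> l I x) < weighted_risk (extended_prior \<rho>) l I x \<beta>"
proof -
  note [measurable] = Q_e2_extended_prior(1)[OF prior] W_loss_measurable[OF loss]
  define Z where "Z = (LBINT \<eta>:{0<..}. posterior_weight \<rho> I x \<eta>)"
  have Z: "0 < Z" using wd by (simp add: bayes_well_defined_def Z_def)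
  have risk: "posterior_risk \<rho> l I x \<beta> = ennreal (1 / Z) * weighted_risk (extended_prior \<rho>) l I x \<beta>" for \<beta>
  proof -
    have "posterior_risk \<rho> l I x \<beta> = (\<integral>\<^sup>+\<eta>. ennreal (1 / Z) * ennreal (l (sqrt I * (\<eta> - \<beta>)) * exp (- (I * (\<eta> - x)\<^sup>2 / 2)) * extended_prior \<rho> \<eta>) \<partial>lborel)"
      unfolding posterior_risk_def posterior_density_def Z_def[symmetric] posterior_weight_def extended_prior_def
      using Z by (intro nn_integral_cong) (auto simp: indicator_def ennreal_mult'[symmetric] mult.assoc)
    then show ?thesis unfolding weighted_risk_def by (simp add: nn_integral_cmult)
  qed
  have iff: "posterior_risk \<rho> l I x \<beta> < posterior_risk \<rho> l I x \<beta>' \<Longrightarrow>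
      weighted_risk (extended_prior \<rho>) l I x \<beta> < weighted_risk (extended_prior \<rho>) l I x \<beta>'" for \<beta> \<beta>'
    unfolding risk using mult_left_mono[of _ _ "ennreal (1 / Z)"] by (meson not_less zero_le)
  obtain b where b: "0 < b" "\<And>\<beta>. 0 < \<beta> \<Longrightarrow> \<beta> \<noteq> b \<Longrightarrow> posterior_risk \<rho> l I x b < posterior_risk \<rho> l I x \<beta>"
    using wd by (auto simp: bayes_well_defined_def)
  have "is_arg_min (posterior_risk \<rho> l I x) (\<lambda>\<beta>. \<beta> \<in> {0<..}) b"
    using b unfolding is_arg_min_def by (metis greaterThan_iff less_asym less_irrefl)
  then have "is_arg_min (posterior_risk \<rho> l I x) (\<lambda>\<beta>. \<beta> \<in> {0<..}) (bayes_estimate \<rho> l I x)"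
    unfolding bayes_estimate_def arg_min_on_def arg_min_def by (rule someI)
  then have eq: "bayes_estimate \<rho> l I x = b"
    using b unfolding is_arg_min_def by (metis greaterThan_iff)
  show "0 < bayes_estimate \<rho> l I x" using b eq by simp
  show "weighted_risk (extended_prior \<rho>) l I x (bayes_estimate \<rho> l I x) < weighted_risk (extended_prior \<rho>) l I x \<beta>"
    if "0 < \<beta>" "\<beta> \<noteq> bayes_estimate \<rho> l I x" for \<beta>
    using iff b(2) that unfolding eq by blast
qed

lemma bayes_risk_single_crossing:
  assumes "0 \<le> I" "x \<le> x'" "b < b'"
    and "weighted_risk (extended_prior \<rho>) l I x' b < weighted_risk (extended_prior \<rho>) l I x' b'"
  shows "weighted_risk (extended_prior \<rho>) l I x b \<le> weighted_risk (extended_prior \<rho>) l I x b'"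
  using assms
  by (intro weighted_risk_single_crossing[where x' = x'] W_loss_measurable[OF loss] W_loss_nonneg[OF loss]
      W_loss_mono[OF loss] Q_e2_extended_prior[OF prior])

text \<open>If the estimate at \<open>x'\<close> were smaller than that at \<open>x \<le> x'\<close>, it would be strictly better at \<open>x'\<close>, hence
  by single crossing no worse at \<open>x\<close>, against the strict minimality there.\<close>

lemma bayes_estimate_mono:
  assumes I: "0 \<le> I"
  shows "mono_on {x. bayes_well_defined \<rho> l I x} (bayes_estimate \<rho> l I)"
proof (rule mono_onI, simp, rule ccontr)
  fix x x' assume wd: "bayes_well_defined \<rho> l I x" "bayes_well_defined \<rho> l I x'" and "x \<le> x'"
    and "\<not> bayes_estimate \<rho> l I x \<le> bayes_estimate \<rho> l I x'"
  then have lt: "bayes_estimate \<rho> l I x' < bayes_estimate \<rho> l I x" by simp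
  note m = bayes_estimate_minimizes[OF wd(1)] bayes_estimate_minimizes[OF wd(2)]
  have "weighted_risk (extended_prior \<rho>) l I x' (bayes_estimate \<rho> l I x') < weighted_risk (extended_prior \<rho>) l I x' (bayes_estimate \<rho> l I x)"
    using m(4)[OF m(1)] lt by simp
  from bayes_risk_single_crossing[OF I \<open>x \<le> x'\<close> lt this] m(2)[OF m(3)] lt show False by simp
qed

text \<open>Measurability is a consequence of monotonicity on the set where the estimate is well defined;
  on the remaining null set completeness of the measure suffices.\<close>

lemma bayes_estimate_measurable:
  assumes "complete_measure M" and I: "0 \<le> I" and X: "X \<in> borel_measurable M"
    and wd: "AE \<omega> in M. bayes_well_defined \<rho> l I (X \<omega>)"
  shows "(\<lambda>\<omega>. bayes_estimate \<rho> l I (X \<omega>)) \<in> borel_measurable M"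
proof (rule borel_measurableI_le)
  fix a :: real
  interpret complete_measure M by fact
  let ?D = "{x. bayes_well_defined \<rho> l I x}"
  define D where "D = {\<omega> \<in> space M. X \<omega> \<in> ?D}"
  obtain N where N: "N \<in> null_sets M" "{\<omega> \<in> space M. \<not> bayes_well_defined \<rho> l I (X \<omega>)} \<subseteq> N"
    using wd by (auto simp: eventually_ae_filter)
  have "space M - D \<in> sets M"
    using complete[OF _ N(1), of "space M - D"] N(2) by (auto simp: D_def)
  then have D: "D \<in> sets M" using sets.compl_sets[of "space M - D" M] by (simp add: D_def double_diff Diff_Diff_Int Int_absorb1 subset_eq)
  have "X \<in> restrict_space M D \<rightarrow>\<^sub>M restrict_space borel ?D"
    using X by (intro measurable_restrict_space3) (auto simp: D_def)
  then have "(\<lambda>\<omega>. bayes_estimate \<rho> l I (X \<omega>)) \<in> borel_measurable (restrict_space M D)"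
    using borel_measurable_mono_on_fnc[OF bayes_estimate_mono[OF I]] by (rule measurable_compose)
  then have "{\<omega> \<in> space (restrict_space M D). bayes_estimate \<rho> l I (X \<omega>) \<le> a} \<in> sets (restrict_space M D)"
    by measurable
  moreover have "{\<omega> \<in> space (restrict_space M D). bayes_estimate \<rho> l I (X \<omega>) \<le> a} = {\<omega> \<in> D. bayes_estimate \<rho> l I (X \<omega>) \<le> a}"
    by (auto simp: space_restrict_space D_def)
  moreover have "D \<inter> space M \<in> sets M" using D by simp
  ultimately have 1: "{\<omega> \<in> D. bayes_estimate \<rho> l I (X \<omega>) \<le> a} \<in> sets M"
    by (simp only: sets_restrict_space_iff)
  have 2: "{\<omega> \<in> space M - D. bayes_estimate \<rho> l I (X \<omega>) \<le> a} \<in> sets M"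
    by (rule complete[OF _ N(1)]) (use N(2) in \<open>auto simp: D_def\<close>)
  have "{\<omega> \<in> space M. bayes_estimate \<rho> l I (X \<omega>) \<le> a}
      = {\<omega> \<in> D. bayes_estimate \<rho> l I (X \<omega>) \<le> a} \<union> {\<omega> \<in> space M - D. bayes_estimate \<rho> l I (X \<omega>) \<le> a}"
    by (auto simp: D_def)
  then show "{\<omega> \<in> space M. bayes_estimate \<rho> l I (X \<omega>) \<le> a} \<in> sets M" using 1 2 by simp
qed

lemma weighted_risk_localized:
  assumes I: "0 < I" and loc: "\<And>r. \<epsilon> \<le> \<bar>r\<bar> \<Longrightarrow>
      scaled_risk (extended_prior \<rho>) l (sqrt I) x 0 < scaled_risk (extended_prior \<rho>) l (sqrt I) x r"
    and far: "\<epsilon> \<le> \<bar>sqrt I * (\<beta> - x)\<bar>"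
  shows "weighted_risk (extended_prior \<rho>) l I x x < weighted_risk (extended_prior \<rho>) l I x \<beta>"
proof -
  note resc = weighted_risk_rescale[OF W_loss_measurable[OF loss] Q_e2_extended_prior(1)[OF prior] I]
  have "scaled_risk (extended_prior \<rho>) l (sqrt I) x 0 < scaled_risk (extended_prior \<rho>) l (sqrt I) x (sqrt I * (\<beta> - x))"
    by (rule loc[OF far])
  then show ?thesis
    unfolding resc using I by (intro ennreal_mult_strict_left_mono) (auto simp: less_top)
qed

lemma bayes_estimate_localized:
  assumes wd: "bayes_well_defined \<rho> l I x" and I: "0 < I" and x: "0 < x" and \<epsilon>: "0 < \<epsilon>"
    and loc: "\<And>r. \<epsilon> \<le> \<bar>r\<bar> \<Longrightarrow>
      scaled_risk (extended_prior \<rho>) l (sqrt I) x 0 < scaled_risk (extended_prior \<rho>) l (sqrt I) x r"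
  shows "\<bar>sqrt I * (bayes_estimate \<rho> l I x - x)\<bar> < \<epsilon>"
proof (rule ccontr)
  assume "\<not> ?thesis"
  then have far: "\<epsilon> \<le> \<bar>sqrt I * (bayes_estimate \<rho> l I x - x)\<bar>" by simp
  then have "x \<noteq> bayes_estimate \<rho> l I x" using \<epsilon> by auto
  from bayes_estimate_minimizes(2)[OF wd x this] weighted_risk_localized[OF I loc far]
  show False by simp
qed

text \<open>A bound at a data value \<open>x\<close> where nothing is known about the posterior, transferred from a larger
  value \<open>x0\<close> at which the risk is localized. There the competitor \<open>x0\<close> beats every estimate above
  \<open>x0 + \<epsilon> / sqrt I\<close>, and by single crossing it is no worse than such an estimate at \<open>x\<close>.\<close>

lemma bayes_estimate_upper_bound:
  assumes wd: "bayes_well_defined \<rho> l I x" and I: "0 < I" and x: "x \<le> x0" "0 < x0" and \<epsilon>: "0 < \<epsilon>"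
    and loc: "\<And>r. \<epsilon> \<le> \<bar>r\<bar> \<Longrightarrow>
      scaled_risk (extended_prior \<rho>) l (sqrt I) x0 0 < scaled_risk (extended_prior \<rho>) l (sqrt I) x0 r"
  shows "sqrt I * bayes_estimate \<rho> l I x < sqrt I * x0 + \<epsilon>"
proof (rule ccontr)
  let ?b = "bayes_estimate \<rho> l I x"
  assume "\<not> ?thesis"
  then have gt: "\<epsilon> \<le> sqrt I * (?b - x0)" by (simp add: algebra_simps)
  then have "0 < sqrt I * (?b - x0)" using \<epsilon> by linarith
  then have "x0 < ?b" using I by (simp add: zero_less_mult_iff)
  moreover have "weighted_risk (extended_prior \<rho>) l I x0 x0 < weighted_risk (extended_prior \<rho>) l I x0 ?b"
    using gt by (intro weighted_risk_localized[OF I loc]) auto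
  ultimately have "weighted_risk (extended_prior \<rho>) l I x x0 \<le> weighted_risk (extended_prior \<rho>) l I x ?b"
    using I x by (intro bayes_risk_single_crossing[of I x x0 x0 ?b]) auto
  moreover have "weighted_risk (extended_prior \<rho>) l I x ?b < weighted_risk (extended_prior \<rho>) l I x x0"
    using bayes_estimate_minimizes(2)[OF wd x(2)] \<open>x0 < ?b\<close> by simp
  ultimately show False by simp
qed

end

section \<open>The Ito integral of the logarithmic differential\<close>

lemma normal_density_tilt:
  assumes "0 < \<Delta>"
  shows "normal_density 0 (sqrt \<Delta>) x * exp (s * x) = exp (s\<^sup>2 * \<Delta> / 2) * normal_density (s * \<Delta>) (sqrt \<Delta>) x"
proof -
  have "- (x - 0)\<^sup>2 / (2 * (sqrt \<Delta>)\<^sup>2) + s * x = s\<^sup>2 * \<Delta> / 2 + - (x - s * \<Delta>)\<^sup>2 / (2 * (sqrt \<Delta>)\<^sup>2)"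
    using assms by (simp add: field_simps power2_eq_square)
  then have "exp (- (x - 0)\<^sup>2 / (2 * (sqrt \<Delta>)\<^sup>2)) * exp (s * x) = exp (s\<^sup>2 * \<Delta> / 2) * exp (- (x - s * \<Delta>)\<^sup>2 / (2 * (sqrt \<Delta>)\<^sup>2))"
    by (simp only: exp_add[symmetric])
  then show ?thesis
    unfolding normal_density_def by (simp add: mult.assoc)
qed

text \<open>Exponential tilting turns a centred normal density into a shifted one, so these moments reduce to
  total mass and mean.\<close>

lemma normal_exponential_moments:
  assumes \<Delta>: "0 < \<Delta>"
  shows "has_bochner_integral lborel (\<lambda>x. normal_density 0 (sqrt \<Delta>) x * exp (s * x)) (exp (s\<^sup>2 * \<Delta> / 2))"
    and "has_bochner_integral lborel (\<lambda>x. normal_density 0 (sqrt \<Delta>) x * (x * exp (s * x))) (s * \<Delta> * exp (s\<^sup>2 * \<Delta> / 2))"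
proof -
  have "has_bochner_integral lborel (normal_density (s * \<Delta>) (sqrt \<Delta>)) 1"
    using \<Delta> by (simp add: has_bochner_integral_iff)
  then have "has_bochner_integral lborel (\<lambda>x. exp (s\<^sup>2 * \<Delta> / 2) * normal_density (s * \<Delta>) (sqrt \<Delta>) x) (exp (s\<^sup>2 * \<Delta> / 2) * 1)"
    by (rule has_bochner_integral_mult_right)
  then show "has_bochner_integral lborel (\<lambda>x. normal_density 0 (sqrt \<Delta>) x * exp (s * x)) (exp (s\<^sup>2 * \<Delta> / 2))"
    by (simp add: normal_density_tilt[OF \<Delta>])
  have "has_bochner_integral lborel (\<lambda>x. exp (s\<^sup>2 * \<Delta> / 2) * (normal_density (s * \<Delta>) (sqrt \<Delta>) x * x)) (exp (s\<^sup>2 * \<Delta> / 2) * (s * \<Delta>))"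
    using \<Delta> by (intro has_bochner_integral_mult_right normal_moment_nz_1) simp
  moreover have "exp (s\<^sup>2 * \<Delta> / 2) * (normal_density (s * \<Delta>) (sqrt \<Delta>) x * x) = normal_density 0 (sqrt \<Delta>) x * (x * exp (s * x))" for x
    using normal_density_tilt[OF \<Delta>, of x s] by (simp add: mult_ac)
  ultimately have "has_bochner_integral lborel (\<lambda>x. normal_density 0 (sqrt \<Delta>) x * (x * exp (s * x))) (exp (s\<^sup>2 * \<Delta> / 2) * (s * \<Delta>))"
    by (simp only:)
  then show "has_bochner_integral lborel (\<lambda>x. normal_density 0 (sqrt \<Delta>) x * (x * exp (s * x))) (s * \<Delta> * exp (s\<^sup>2 * \<Delta> / 2))"
    by (simp only: mult.commute)
qed

text \<open>The relative increment of a geometric Brownian motion minus its limiting differential, as a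
  function of the time step \<open>\<Delta>\<close> and the increment \<open>x\<close> of the driving Brownian motion.\<close>

definition ito_defect :: "real \<Rightarrow> real \<Rightarrow> real \<Rightarrow> real \<Rightarrow> real" where
  "ito_defect b s \<Delta> x = exp (- (b + s\<^sup>2 / 2) * \<Delta> + s * x) - 1 + b * \<Delta> - s * x"

definition defect_mean :: "real \<Rightarrow> real \<Rightarrow> real" where
  "defect_mean b \<Delta> = exp (- b * \<Delta>) - 1 + b * \<Delta>"

definition defect_second_moment :: "real \<Rightarrow> real \<Rightarrow> real \<Rightarrow> real" where
  "defect_second_moment b s \<Delta> =
     exp ((s\<^sup>2 - 2 * b) * \<Delta>) - 2 * (1 - b * \<Delta>) * exp (- b * \<Delta>) - 2 * s\<^sup>2 * \<Delta> * exp (- b * \<Delta>)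
     + (1 - b * \<Delta>)\<^sup>2 + s\<^sup>2 * \<Delta>"

text \<open>The correction \<open>s\<^sup>2 / 2\<close> in the exponent cancels the exponential moment of the increment, so the mean
  contains no term in \<open>s\<close>.\<close>

lemma ito_defect_moments:
  assumes \<Delta>: "0 < \<Delta>"
  shows "has_bochner_integral lborel (\<lambda>x. normal_density 0 (sqrt \<Delta>) x * ito_defect b s \<Delta> x) (defect_mean b \<Delta>)"
    and "has_bochner_integral lborel (\<lambda>x. normal_density 0 (sqrt \<Delta>) x * (ito_defect b s \<Delta> x)\<^sup>2) (defect_second_moment b s \<Delta>)"
proof -
  let ?n = "normal_density 0 (sqrt \<Delta>)"
  define A where "A = exp (- (b + s\<^sup>2 / 2) * \<Delta>)"
  define c where "c = 1 - b * \<Delta>"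
  have Z: "ito_defect b s \<Delta> x = A * exp (s * x) - c - s * x" for x
    by (simp add: ito_defect_def A_def c_def exp_add[symmetric])
  have AE: "A * exp (s\<^sup>2 * \<Delta> / 2) = exp (- b * \<Delta>)"
    by (simp add: A_def exp_add[symmetric] field_simps)
  have A2: "A\<^sup>2 * exp ((2 * s)\<^sup>2 * \<Delta> / 2) = exp ((s\<^sup>2 - 2 * b) * \<Delta>)"
    by (simp add: A_def exp_add[symmetric] field_simps power2_eq_square)
  have M0: "has_bochner_integral lborel ?n 1"
    using \<Delta> by (simp add: has_bochner_integral_iff)
  have M1: "has_bochner_integral lborel (\<lambda>x. ?n x * x) 0"
    using normal_moment_nz_1[of "sqrt \<Delta>" 0] \<Delta> by simp
  have M2: "has_bochner_integral lborel (\<lambda>x. ?n x * x\<^sup>2) \<Delta>"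
    using normal_moment_even[of "sqrt \<Delta>" 0 1] \<Delta> by simp
  note E = normal_exponential_moments[OF \<Delta>]
  have "has_bochner_integral lborel (\<lambda>x. A * (?n x * exp (s * x)) - c * ?n x - s * (?n x * x)) (A * exp (s\<^sup>2 * \<Delta> / 2) - c * 1 - s * 0)"
    by (intro has_bochner_integral_diff has_bochner_integral_mult_right E M0 M1)
  then show "has_bochner_integral lborel (\<lambda>x. ?n x * ito_defect b s \<Delta> x) (defect_mean b \<Delta>)"
    unfolding AE by (simp add: Z defect_mean_def c_def algebra_simps)
  have eq: "A\<^sup>2 * (?n x * exp ((2 * s) * x)) - 2 * A * c * (?n x * exp (s * x)) - 2 * A * s * (?n x * (x * exp (s * x)))
      + c\<^sup>2 * ?n x + 2 * c * s * (?n x * x) + s\<^sup>2 * (?n x * x\<^sup>2) = ?n x * (ito_defect b s \<Delta> x)\<^sup>2" for x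
  proof -
    have "exp ((2 * s) * x) = (exp (s * x))\<^sup>2" by (simp add: power2_eq_square exp_add[symmetric])
    then show ?thesis unfolding Z by (simp add: power2_eq_square algebra_simps)
  qed
  have "has_bochner_integral lborel (\<lambda>x. A\<^sup>2 * (?n x * exp ((2 * s) * x)) - 2 * A * c * (?n x * exp (s * x)) - 2 * A * s * (?n x * (x * exp (s * x)))
      + c\<^sup>2 * ?n x + 2 * c * s * (?n x * x) + s\<^sup>2 * (?n x * x\<^sup>2))
     (A\<^sup>2 * exp ((2 * s)\<^sup>2 * \<Delta> / 2) - 2 * A * c * exp (s\<^sup>2 * \<Delta> / 2) - 2 * A * s * (s * \<Delta> * exp (s\<^sup>2 * \<Delta> / 2)) + c\<^sup>2 * 1 + 2 * c * s * 0 + s\<^sup>2 * \<Delta>)"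
    by (intro has_bochner_integral_diff has_bochner_integral_add has_bochner_integral_mult_right E M0 M1 M2)
  moreover have "A\<^sup>2 * exp ((2 * s)\<^sup>2 * \<Delta> / 2) - 2 * A * c * exp (s\<^sup>2 * \<Delta> / 2) - 2 * A * s * (s * \<Delta> * exp (s\<^sup>2 * \<Delta> / 2)) + c\<^sup>2 * 1 + 2 * c * s * 0 + s\<^sup>2 * \<Delta>
     = defect_second_moment b s \<Delta>"
  proof -
    have "2 * A * c * exp (s\<^sup>2 * \<Delta> / 2) = 2 * c * (A * exp (s\<^sup>2 * \<Delta> / 2))"
      "2 * A * s * (s * \<Delta> * exp (s\<^sup>2 * \<Delta> / 2)) = 2 * s\<^sup>2 * \<Delta> * (A * exp (s\<^sup>2 * \<Delta> / 2))"
      by (simp_all add: power2_eq_square mult_ac)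
    then show ?thesis unfolding A2 AE by (simp add: defect_second_moment_def c_def)
  qed
  ultimately show "has_bochner_integral lborel (\<lambda>x. ?n x * (ito_defect b s \<Delta> x)\<^sup>2) (defect_second_moment b s \<Delta>)"
    by (simp only: eq)
qed

lemma small_of_zero_derivative:
  fixes f :: "real \<Rightarrow> real"
  assumes "(f has_real_derivative 0) (at 0)" "f 0 = 0" "0 < \<eta>"
  shows "\<exists>\<delta>>0. \<forall>\<Delta>. 0 < \<Delta> \<and> \<Delta> < \<delta> \<longrightarrow> \<bar>f \<Delta>\<bar> \<le> \<eta> * \<Delta>"
proof -
  have "(\<lambda>h. f h / h) \<midarrow>0\<rightarrow> 0" using DERIV_D[OF assms(1)] assms(2) by simp
  then obtain \<delta> where \<delta>: "0 < \<delta>" "\<And>h. h \<noteq> 0 \<Longrightarrow> \<bar>h\<bar> < \<delta> \<Longrightarrow> \<bar>f h / h\<bar> < \<eta>"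
    using LIM_D[of "\<lambda>h. f h / h" 0 0 \<eta>] assms(3) by auto
  have "\<bar>f \<Delta>\<bar> \<le> \<eta> * \<Delta>" if "0 < \<Delta>" "\<Delta> < \<delta>" for \<Delta>
    using \<delta>(2)[of \<Delta>] that by (simp add: divide_less_eq)
  with \<delta>(1) show ?thesis by blast
qed

text \<open>Both moments vanish to second order at \<open>\<Delta> = 0\<close>; summed over a partition of \<open>[0, T]\<close> they are
  therefore negligible. In the second moment the contributions \<open>s\<^sup>2 \<Delta>\<close> of the squared
  Brownian increment cancel at first order.\<close>

lemma defect_moments_small:
  assumes "0 < \<eta>"
  shows "\<exists>\<delta>>0. \<forall>\<Delta>. 0 < \<Delta> \<and> \<Delta> < \<delta> \<longrightarrow> \<bar>defect_mean b \<Delta>\<bar> \<le> \<eta> * \<Delta> \<and> defect_second_moment b s \<Delta> \<le> \<eta> * \<Delta>"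
proof -
  have "(defect_mean b has_real_derivative 0) (at 0)"
    unfolding defect_mean_def by (auto intro!: derivative_eq_intros)
  moreover have "(defect_second_moment b s has_real_derivative 0) (at 0)"
    unfolding defect_second_moment_def by (auto intro!: derivative_eq_intros)
  ultimately obtain \<delta> \<delta>' where "0 < \<delta>" "\<forall>\<Delta>. 0 < \<Delta> \<and> \<Delta> < \<delta> \<longrightarrow> \<bar>defect_mean b \<Delta>\<bar> \<le> \<eta> * \<Delta>"
    "0 < \<delta>'" "\<forall>\<Delta>. 0 < \<Delta> \<and> \<Delta> < \<delta>' \<longrightarrow> \<bar>defect_second_moment b s \<Delta>\<bar> \<le> \<eta> * \<Delta>"
    using small_of_zero_derivative[OF _ _ assms, of "defect_mean b"] small_of_zero_derivative[OF _ _ assms, of "defect_second_moment b s"]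
    by (auto simp: defect_mean_def defect_second_moment_def)
  then show ?thesis by (intro exI[of _ "min \<delta> \<delta>'"]) fastforce
qed

text \<open>Independence of an increment from the past is only assumed for \<sigma>-algebras; this passes to random
  variables measurable with respect to them.\<close>

lemma (in prob_space) indep_var_past_increment:
  assumes sub: "subalgebra M G" and Z: "Z \<in> borel_measurable G" and D: "D \<in> borel_measurable M"
    and g: "g \<in> borel_measurable borel"
    and ind: "indep_set (sets G) (sets (vimage_algebra (space M) D borel))"
  shows "indep_var borel Z borel (\<lambda>\<omega>. g (D \<omega>) :: real)"
proof -
  let ?V = "vimage_algebra (space M) D borel"
  have ZM: "Z \<in> borel_measurable M" using sub Z by (rule measurable_from_subalg)
  have "sigma_sets (space G) {Z -` A \<inter> space G |A. A \<in> sets borel} \<subseteq> sets G"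
    using measurable_sets[OF Z] by (intro sets.sigma_sets_subset) auto
  then have "sigma_sets (space M) {Z -` A \<inter> space M |A. A \<in> sets borel} \<subseteq> sets G"
    using sub by (simp add: subalgebra_def)
  moreover have "D \<in> measurable ?V borel" by (rule measurable_vimage_algebra1) simp
  then have gV: "(\<lambda>\<omega>. g (D \<omega>)) \<in> borel_measurable ?V" using g by measurable
  have "sigma_sets (space ?V) {(\<lambda>\<omega>. g (D \<omega>)) -` A \<inter> space ?V |A. A \<in> sets borel} \<subseteq> sets ?V"
    using measurable_sets[OF gV] by (intro sets.sigma_sets_subset) auto
  then have "sigma_sets (space M) {(\<lambda>\<omega>. g (D \<omega>)) -` A \<inter> space M |A. A \<in> sets borel} \<subseteq> sets ?V"
    by simp
  moreover have "(\<lambda>\<omega>. g (D \<omega>)) \<in> borel_measurable M" using D g by measurable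
  ultimately show ?thesis
    using ind ZM unfolding indep_var_eq indep_sets2_eq by blast
qed

text \<open>Independence of each term from the partial sum before it is what adaptedness and independent
  increments provide directly. The cross terms then factor, so that the variances add up.\<close>

lemma (in prob_space) square_of_sum_bound:
  fixes Y :: "nat \<Rightarrow> 'a \<Rightarrow> real"
  assumes int: "\<And>i. i < n \<Longrightarrow> integrable M (Y i)" "\<And>i. i < n \<Longrightarrow> integrable M (\<lambda>\<omega>. (Y i \<omega>)\<^sup>2)"
    and ind: "\<And>i. i < n \<Longrightarrow> indep_var borel (\<lambda>\<omega>. \<Sum>j<i. Y j \<omega>) borel (Y i)"
  shows "integrable M (\<lambda>\<omega>. (\<Sum>i<n. Y i \<omega>)\<^sup>2)"
    and "expectation (\<lambda>\<omega>. (\<Sum>i<n. Y i \<omega>)\<^sup>2) \<le> (\<Sum>i<n. expectation (Y i))\<^sup>2 + (\<Sum>i<n. expectation (\<lambda>\<omega>. (Y i \<omega>)\<^sup>2))"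
proof -
  have "integrable M (\<lambda>\<omega>. (\<Sum>i<k. Y i \<omega>)\<^sup>2) \<and>
      expectation (\<lambda>\<omega>. (\<Sum>i<k. Y i \<omega>)\<^sup>2) \<le> (\<Sum>i<k. expectation (Y i))\<^sup>2 + (\<Sum>i<k. expectation (\<lambda>\<omega>. (Y i \<omega>)\<^sup>2))"
    if "k \<le> n" for k
    using that
  proof (induction k)
    case 0
    then show ?case by simp
  next
    case (Suc k)
    let ?S = "\<lambda>\<omega>. \<Sum>j<k. Y j \<omega>"
    have k: "k < n" "k \<le> n" using Suc by auto
    have iS: "integrable M ?S" using int k by (intro Bochner_Integration.integrable_sum) auto
    note SY = indep_var_lebesgue_integral[OF ind[OF k(1)] iS int(1)[OF k(1)]]
      indep_var_integrable[OF ind[OF k(1)] iS int(1)[OF k(1)]]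
    have IH: "integrable M (\<lambda>\<omega>. (?S \<omega>)\<^sup>2)" "expectation (\<lambda>\<omega>. (?S \<omega>)\<^sup>2) \<le> (\<Sum>i<k. expectation (Y i))\<^sup>2 + (\<Sum>i<k. expectation (\<lambda>\<omega>. (Y i \<omega>)\<^sup>2))"
      using Suc.IH k by auto
    have ES: "expectation ?S = (\<Sum>i<k. expectation (Y i))"
      using int k by (intro Bochner_Integration.integral_sum) auto
    have sq: "(\<Sum>i<Suc k. Y i \<omega>)\<^sup>2 = (?S \<omega>)\<^sup>2 + 2 * (?S \<omega> * Y k \<omega>) + (Y k \<omega>)\<^sup>2" for \<omega>
      by (simp add: power2_eq_square algebra_simps)
    have "expectation (\<lambda>\<omega>. (\<Sum>i<Suc k. Y i \<omega>)\<^sup>2)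
       = expectation (\<lambda>\<omega>. (?S \<omega>)\<^sup>2) + 2 * (expectation ?S * expectation (Y k)) + expectation (\<lambda>\<omega>. (Y k \<omega>)\<^sup>2)"
      unfolding sq using IH(1) SY int(2)[OF k(1)] by simp
    also have "\<dots> \<le> (\<Sum>i<Suc k. expectation (Y i))\<^sup>2 + (\<Sum>i<Suc k. expectation (\<lambda>\<omega>. (Y i \<omega>)\<^sup>2))"
      using IH(2) zero_le_power2[of "expectation (Y k)"] unfolding ES
      by (simp add: power2_sum add.assoc add.left_commute add_increasing)
    finally show ?case
      unfolding sq using IH(1) SY int(2)[OF k(1)] by simp
  qed
  from this[of n] show "integrable M (\<lambda>\<omega>. (\<Sum>i<n. Y i \<omega>)\<^sup>2)"
    and "expectation (\<lambda>\<omega>. (\<Sum>i<n. Y i \<omega>)\<^sup>2) \<le> (\<Sum>i<n. expectation (Y i))\<^sup>2 + (\<Sum>i<n. expectation (\<lambda>\<omega>. (Y i \<omega>)\<^sup>2))"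
    by auto
qed

lemma has_ito_integralE:
  assumes "has_ito_integral M T H X J" "0 < \<epsilon>"
  obtains \<delta> where "0 < \<delta>"
    and "\<And>n t. t 0 = 0 \<Longrightarrow> t n = T \<Longrightarrow> \<forall>i<n. t i < t (Suc i) \<and> t (Suc i) - t i < \<delta> \<Longrightarrow>
        measure M {\<omega> \<in> space M. \<bar>(\<Sum>i<n. H (t i) \<omega> * (X (t (Suc i)) \<omega> - X (t i) \<omega>)) - J \<omega>\<bar> > \<epsilon>} < \<epsilon>"
  using assms unfolding has_ito_integral_def by blast

text \<open>Both candidates are limits in probability of the same Riemann sums along equidistant partitions.\<close>

lemma has_ito_integral_unique:
  assumes M: "prob_space M" and T: "0 < T"
    and H: "\<And>t. 0 \<le> t \<Longrightarrow> H t \<in> borel_measurable M" and X: "\<And>t. 0 \<le> t \<Longrightarrow> X t \<in> borel_measurable M"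
    and J: "has_ito_integral M T H X J" and J': "has_ito_integral M T H X J'"
  shows "AE \<omega> in M. J \<omega> = J' \<omega>"
proof -
  interpret prob_space M by (rule M)
  have [measurable]: "J \<in> borel_measurable M" "J' \<in> borel_measurable M"
    using J J' by (auto simp: has_ito_integral_def)
  have small: "prob {\<omega> \<in> space M. \<bar>J \<omega> - J' \<omega>\<bar> > 2 * \<epsilon>} \<le> 2 * \<epsilon>'" if e: "0 < \<epsilon>'" "\<epsilon>' \<le> \<epsilon>" for \<epsilon> \<epsilon>'
  proof -
    from J e(1) obtain \<delta> where \<delta>: "0 < \<delta>" and D: "\<And>n t. t 0 = 0 \<Longrightarrow> t n = T \<Longrightarrow> \<forall>i<n. t i < t (Suc i) \<and> t (Suc i) - t i < \<delta> \<Longrightarrow>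
        measure M {\<omega> \<in> space M. \<bar>(\<Sum>i<n. H (t i) \<omega> * (X (t (Suc i)) \<omega> - X (t i) \<omega>)) - J \<omega>\<bar> > \<epsilon>'} < \<epsilon>'"
      by (rule has_ito_integralE) blast
    from J' e(1) obtain \<delta>' where \<delta>': "0 < \<delta>'" and D': "\<And>n t. t 0 = 0 \<Longrightarrow> t n = T \<Longrightarrow> \<forall>i<n. t i < t (Suc i) \<and> t (Suc i) - t i < \<delta>' \<Longrightarrow>
        measure M {\<omega> \<in> space M. \<bar>(\<Sum>i<n. H (t i) \<omega> * (X (t (Suc i)) \<omega> - X (t i) \<omega>)) - J' \<omega>\<bar> > \<epsilon>'} < \<epsilon>'"
      by (rule has_ito_integralE) blast
    obtain n :: nat where n: "T / min \<delta> \<delta>' < real n" using reals_Archimedean2 by blast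
    moreover have "0 < T / min \<delta> \<delta>'" using T \<delta> \<delta>' by simp
    ultimately have n0: "0 < real n" by linarith
    define t where "t i = T * real i / real n" for i
    have diff: "t (Suc i) - t i = T / real n" for i
      by (simp add: t_def diff_divide_distrib[symmetric] algebra_simps)
    have "T < min \<delta> \<delta>' * real n" using n \<delta> \<delta>' by (simp add: divide_less_eq mult.commute)
    then have "T / real n < min \<delta> \<delta>'" using n0 by (simp only: pos_divide_less_eq)
    then have mesh: "T / real n < \<delta>" "T / real n < \<delta>'" by (simp_all only: min_less_iff_conj)
    have mesh_pos: "0 < T / real n" using n0 T by simp
    have t0: "t 0 = 0" "t n = T" using n0 by (auto simp: t_def)
    have tnn: "0 \<le> t i" for i using T by (simp add: t_def)
    define S where "S \<omega> = (\<Sum>i<n. H (t i) \<omega> * (X (t (Suc i)) \<omega> - X (t i) \<omega>))" for \<omega>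
    have [measurable]: "S \<in> borel_measurable M"
      unfolding S_def using tnn by (intro borel_measurable_sum borel_measurable_times borel_measurable_diff H X) auto
    have step: "t i < t (Suc i) \<and> t (Suc i) - t i < \<delta>" "t i < t (Suc i) \<and> t (Suc i) - t i < \<delta>'" for i
      using diff[of i] mesh mesh_pos by linarith+
    have P: "prob {\<omega> \<in> space M. \<bar>S \<omega> - J \<omega>\<bar> > \<epsilon>'} < \<epsilon>'" "prob {\<omega> \<in> space M. \<bar>S \<omega> - J' \<omega>\<bar> > \<epsilon>'} < \<epsilon>'"
      unfolding S_def using D[OF t0] D'[OF t0] step by auto
    have "prob {\<omega> \<in> space M. \<bar>J \<omega> - J' \<omega>\<bar> > 2 * \<epsilon>}
        \<le> prob ({\<omega> \<in> space M. \<bar>S \<omega> - J \<omega>\<bar> > \<epsilon>'} \<union> {\<omega> \<in> space M. \<bar>S \<omega> - J' \<omega>\<bar> > \<epsilon>'})"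
      using e by (intro finite_measure_mono) auto
    also have "\<dots> \<le> prob {\<omega> \<in> space M. \<bar>S \<omega> - J \<omega>\<bar> > \<epsilon>'} + prob {\<omega> \<in> space M. \<bar>S \<omega> - J' \<omega>\<bar> > \<epsilon>'}"
      by (intro measure_Un_le) auto
    also have "\<dots> \<le> 2 * \<epsilon>'" using P by simp
    finally show ?thesis .
  qed
  have zero: "prob {\<omega> \<in> space M. \<bar>J \<omega> - J' \<omega>\<bar> > 2 * \<epsilon>} = 0" if "0 < \<epsilon>" for \<epsilon>
  proof (rule ccontr)
    assume "\<not> ?thesis"
    then have p: "0 < prob {\<omega> \<in> space M. \<bar>J \<omega> - J' \<omega>\<bar> > 2 * \<epsilon>}" by (simp add: zero_less_measure_iff)
    define \<epsilon>' where "\<epsilon>' = min \<epsilon> (prob {\<omega> \<in> space M. \<bar>J \<omega> - J' \<omega>\<bar> > 2 * \<epsilon>} / 4)"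
    have "0 < \<epsilon>'" "\<epsilon>' \<le> \<epsilon>" "4 * \<epsilon>' \<le> prob {\<omega> \<in> space M. \<bar>J \<omega> - J' \<omega>\<bar> > 2 * \<epsilon>}" using p that by (auto simp: \<epsilon>'_def)
    then show False using small[of \<epsilon>' \<epsilon>] by simp
  qed
  have "AE \<omega> in M. \<forall>k::nat. \<bar>J \<omega> - J' \<omega>\<bar> \<le> 2 * (1 / real (Suc k))"
  proof (subst AE_all_countable, intro allI)
    fix k :: nat
    have "AE \<omega> in M. \<not> (\<bar>J \<omega> - J' \<omega>\<bar> > 2 * (1 / real (Suc k)))"
      using zero[of "1 / real (Suc k)"] by (subst AE_iff_measurable[OF _ refl]) (auto simp: emeasure_eq_measure)
    then show "AE \<omega> in M. \<bar>J \<omega> - J' \<omega>\<bar> \<le> 2 * (1 / real (Suc k))" by (simp add: not_less)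
  qed
  then show ?thesis
  proof eventually_elim
    case (elim \<omega>)
    show ?case
    proof (rule ccontr)
      assume "J \<omega> \<noteq> J' \<omega>"
      then have "0 < \<bar>J \<omega> - J' \<omega>\<bar> / 2" by simp
      then obtain k :: nat where "1 / real (Suc k) < \<bar>J \<omega> - J' \<omega>\<bar> / 2" using nat_approx_posE by blast
      then show False using elim[rule_format, of k] by simp
    qed
  qed
qed

text \<open>By Chebyshev's inequality it suffices that the second moment of the sum is small. If all steps are
  so short that both moments of each term are at most \<open>\<eta> \<Delta>\<close>, then the second moment of the sum is at
  most \<open>(\<eta> T)\<^sup>2 + \<eta> T\<close>.\<close>

lemma exponential_riemann_sums_converge:
  fixes b s T :: real
  assumes basis: "usual_stochastic_basis M F" and W: "standard_brownian_motion M F W"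
    and T: "0 < T" and \<epsilon>: "0 < \<epsilon>"
  shows "\<exists>\<delta>>0. \<forall>n t. t 0 = 0 \<and> t n = T \<and> (\<forall>i<n. t i < t (Suc i) \<and> t (Suc i) - t i < \<delta>) \<longrightarrow>
     measure M {\<omega> \<in> space M. \<bar>\<Sum>i<n. ito_defect b s (t (Suc i) - t i) (W (t (Suc i)) \<omega> - W (t i) \<omega>)\<bar> > \<epsilon>} < \<epsilon>"
proof -
  interpret prob_space M using basis by (simp add: usual_stochastic_basis_def)
  \<comment> \<open>Makes \<open>(\<eta> T)\<^sup>2 + \<eta> T \<le> 2 \<eta> T \<le> \<epsilon>\<^sup>3 / 2\<close>, half of what Chebyshev's inequality allows.\<close>
  define \<eta> where "\<eta> = min 1 (\<epsilon>^3 / 4) / T"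
  have \<eta>: "0 < \<eta>" "\<eta> * T \<le> 1" "\<eta> * T \<le> \<epsilon>^3 / 4" using T \<epsilon> by (auto simp: \<eta>_def)
  obtain \<delta> where \<delta>: "0 < \<delta>"
    and small: "\<And>\<Delta>. 0 < \<Delta> \<Longrightarrow> \<Delta> < \<delta> \<Longrightarrow> \<bar>defect_mean b \<Delta>\<bar> \<le> \<eta> * \<Delta> \<and> defect_second_moment b s \<Delta> \<le> \<eta> * \<Delta>"
    using defect_moments_small[OF \<eta>(1)] by blast
  show ?thesis
  proof (intro exI[of _ \<delta>] conjI allI impI \<delta>)
    fix n :: nat and t :: "nat \<Rightarrow> real"
    assume "t 0 = 0 \<and> t n = T \<and> (\<forall>i<n. t i < t (Suc i) \<and> t (Suc i) - t i < \<delta>)"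
    then have t0: "t 0 = 0" "t n = T" and step: "\<And>i. i < n \<Longrightarrow> t i < t (Suc i)" "\<And>i. i < n \<Longrightarrow> t (Suc i) - t i < \<delta>" by auto
    have tmono: "t i \<le> t j" if "i \<le> j" "j \<le> n" for i j
      using that
    proof (induction j rule: dec_induct)
      case (step j)
      then show ?case using \<open>\<And>i. i < n \<Longrightarrow> t i < t (Suc i)\<close>[of j] by simp
    qed simp
    have tnn: "0 \<le> t i" if "i \<le> n" for i using tmono[of 0 i] that t0 by simp
    define D where "D i \<omega> = W (t (Suc i)) \<omega> - W (t i) \<omega>" for i \<omega>
    define \<Delta> where "\<Delta> i = t (Suc i) - t i" for i
    define Y where "Y i \<omega> = ito_defect b s (\<Delta> i) (D i \<omega>)" for i \<omega>
    have \<Delta>: "0 < \<Delta> i" "\<Delta> i < \<delta>" if "i < n" for i using step[OF that] by (auto simp: \<Delta>_def)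
    have Wm: "W r \<in> borel_measurable (F r')" if "0 \<le> r" "r \<le> r'" for r r'
    proof -
      have "subalgebra (F r') (F r)"
        using basis that unfolding usual_stochastic_basis_def subalgebra_def by (metis order_trans)
      then show ?thesis using W that measurable_from_subalg unfolding standard_brownian_motion_def by blast
    qed
    have sub: "subalgebra M (F r)" if "0 \<le> r" for r using basis that by (simp add: usual_stochastic_basis_def)
    have dist: "distributed M lborel (D i) (normal_density 0 (sqrt (\<Delta> i)))"
      and ind: "indep_set (sets (F (t i))) (sets (vimage_algebra (space M) (D i) borel))" if "i < n" for i
      using W step(1)[OF that] tnn[of i] that unfolding standard_brownian_motion_def D_def[abs_def] \<Delta>_def by auto
    have DF: "D i \<in> borel_measurable (F r)" if "i < n" "t (Suc i) \<le> r" for i r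
    proof -
      have "t i \<le> r" using step(1)[OF that(1)] that(2) by linarith
      then show ?thesis unfolding D_def[abs_def] using that tnn[of i] tnn[of "Suc i"]
        by (intro borel_measurable_diff Wm) auto
    qed
    have gm: "ito_defect b s d \<in> borel_measurable borel" for d
      unfolding ito_defect_def[abs_def] by measurable
    have YF: "Y i \<in> borel_measurable (F r)" if "i < n" "t (Suc i) \<le> r" for i r
      unfolding Y_def[abs_def] using DF[OF that] gm by measurable
    have DM: "D i \<in> borel_measurable M" if "i < n" for i
      using measurable_from_subalg[OF sub DF[OF that order_refl]] tnn[of "Suc i"] that by simp
    have nn: "0 \<le> normal_density 0 (sqrt d) x" for d x by simp
    have iY: "integrable M (Y i)" "expectation (Y i) = defect_mean b (\<Delta> i)"
      and iY2: "integrable M (\<lambda>\<omega>. (Y i \<omega>)\<^sup>2)" "expectation (\<lambda>\<omega>. (Y i \<omega>)\<^sup>2) = defect_second_moment b s (\<Delta> i)" if "i < n" for i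
    proof -
      note mom = ito_defect_moments[OF \<Delta>(1)[OF that], of b s]
      have g1: "ito_defect b s (\<Delta> i) \<in> borel_measurable lborel" "(\<lambda>x. (ito_defect b s (\<Delta> i) x)\<^sup>2) \<in> borel_measurable lborel"
        using gm[of "\<Delta> i"] by auto
      show "integrable M (Y i)" "expectation (Y i) = defect_mean b (\<Delta> i)"
        "integrable M (\<lambda>\<omega>. (Y i \<omega>)\<^sup>2)" "expectation (\<lambda>\<omega>. (Y i \<omega>)\<^sup>2) = defect_second_moment b s (\<Delta> i)"
        using distributed_integrable[OF dist[OF that] g1(1) nn] distributed_integral[OF dist[OF that] g1(1) nn]
          distributed_integrable[OF dist[OF that] g1(2) nn] distributed_integral[OF dist[OF that] g1(2) nn]
          mom[unfolded has_bochner_integral_iff] unfolding Y_def[abs_def] by auto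
    qed
    have indY: "indep_var borel (\<lambda>\<omega>. \<Sum>j<i. Y j \<omega>) borel (Y i)" if "i < n" for i
      unfolding Y_def[of i]
    proof (rule indep_var_past_increment[OF sub[OF tnn] _ DM gm ind])
      show "(\<lambda>\<omega>. \<Sum>j<i. Y j \<omega>) \<in> borel_measurable (F (t i))"
        using that tmono by (intro borel_measurable_sum YF) auto
    qed (use that in auto)
    have sumT: "(\<Sum>i<n. \<eta> * \<Delta> i) = \<eta> * T"
      unfolding sum_distrib_left[symmetric] \<Delta>_def by (simp add: sum_lessThan_telescope t0)
    have "\<bar>\<Sum>i<n. expectation (Y i)\<bar> \<le> (\<Sum>i<n. \<eta> * \<Delta> i)"
      using small \<Delta> by (intro order_trans[OF sum_abs] sum_mono) (simp add: iY)
    then have m2: "(\<Sum>i<n. expectation (Y i))\<^sup>2 \<le> (\<eta> * T)\<^sup>2"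
      unfolding sumT using \<eta> T by (simp add: abs_le_square_iff[symmetric])
    have v: "(\<Sum>i<n. expectation (\<lambda>\<omega>. (Y i \<omega>)\<^sup>2)) \<le> \<eta> * T"
      unfolding sumT[symmetric] using small \<Delta> by (intro sum_mono) (simp add: iY2)
    define R where "R \<omega> = (\<Sum>i<n. Y i \<omega>)" for \<omega>
    note sq = square_of_sum_bound[of n Y, OF iY(1) iY2(1) indY, folded R_def]
    have RM[measurable]: "R \<in> borel_measurable M"
      unfolding R_def using iY(1) by (intro borel_measurable_sum) (auto intro: borel_measurable_integrable)
    have "(\<eta> * T)\<^sup>2 \<le> \<eta> * T" using \<eta> T by (simp add: power2_eq_square mult_left_le)
    then have ER: "expectation (\<lambda>\<omega>. (R \<omega>)\<^sup>2) \<le> 2 * (\<eta> * T)" using sq(2) m2 v by simp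
    have "prob {\<omega> \<in> space M. \<bar>R \<omega>\<bar> > \<epsilon>} \<le> prob {\<omega> \<in> space M. \<bar>R \<omega>\<bar> \<ge> \<epsilon>}"
      by (intro finite_measure_mono) auto
    also have "\<dots> \<le> expectation (\<lambda>\<omega>. (R \<omega>)\<^sup>2) / \<epsilon>\<^sup>2"
      by (intro second_moment_method sq(1) \<epsilon> RM) auto
    also have "\<dots> \<le> (\<epsilon>^3 / 2) / \<epsilon>\<^sup>2" using ER \<eta> by (intro divide_right_mono) auto
    also have "\<dots> < \<epsilon>" using \<epsilon> by (simp add: power2_eq_square power3_eq_cube)
    finally show "prob {\<omega> \<in> space M. \<bar>\<Sum>i<n. ito_defect b s (t (Suc i) - t i) (W (t (Suc i)) \<omega> - W (t i) \<omega>)\<bar> > \<epsilon>} < \<epsilon>"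
      by (simp add: R_def Y_def D_def \<Delta>_def)
  qed
qed

text \<open>Each summand \<open>u(t') / u(t) - 1\<close> is the corresponding increment of \<open>s w - b t\<close> plus a defect. The
  increments telescope, and the defects vanish in probability. The initial value, being
  nonzero, cancels.\<close>

lemma fourier_mode_log_integral:
  fixes \<sigma> \<theta> T :: real and \<mu> q :: "nat \<Rightarrow> real" and w :: "nat \<Rightarrow> real \<Rightarrow> 'a \<Rightarrow> real" and u0 :: "nat \<Rightarrow> 'a \<Rightarrow> real"
  assumes basis: "usual_stochastic_basis M F" and W: "standard_brownian_motion M F (w k)"
    and u0: "u0 k \<in> borel_measurable (F 0)" "AE \<omega> in M. u0 k \<omega> \<noteq> 0" and T: "0 < T"
  defines "u \<equiv> fourier_mode \<sigma> \<mu> q w u0 \<theta> k"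
  shows "has_ito_integral M T (\<lambda>t \<omega>. 1 / u t \<omega>) u (\<lambda>\<omega>. - (\<theta> * \<mu> k * T) + \<sigma> * q k * w k T \<omega>)"
  unfolding has_ito_integral_def
proof (intro conjI allI impI)
  interpret prob_space M using basis by (simp add: usual_stochastic_basis_def)
  define s where "s = \<sigma> * q k"
  define b where "b = \<theta> * \<mu> k"
  have sub: "subalgebra M (F r)" if "0 \<le> r" for r using basis that by (simp add: usual_stochastic_basis_def)
  have wM[measurable]: "w k r \<in> borel_measurable M" if "0 \<le> r" for r
    using measurable_from_subalg[OF sub[OF that]] W that unfolding standard_brownian_motion_def by blast
  have [measurable]: "u0 k \<in> borel_measurable M"
    using measurable_from_subalg[OF sub u0(1)] by simp
  have u: "u r \<omega> = u0 k \<omega> * exp (- (b + s\<^sup>2 / 2) * r + s * w k r \<omega>)" for r \<omega>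
    by (simp add: u_def fourier_mode_def b_def s_def power_mult_distrib)
  have uM: "u r \<in> borel_measurable M" if "0 \<le> r" for r
    unfolding u[abs_def] using wM[OF that] by measurable
  show "(\<lambda>\<omega>. - (\<theta> * \<mu> k * T) + \<sigma> * q k * w k T \<omega>) \<in> borel_measurable M"
    using wM[OF less_imp_le[OF T]] by measurable
  fix \<epsilon> :: real assume \<epsilon>: "0 < \<epsilon>"
  obtain \<delta> where \<delta>: "0 < \<delta>" and D: "\<And>n t. t 0 = 0 \<Longrightarrow> t n = T \<Longrightarrow> (\<forall>i<n. t i < t (Suc i) \<and> t (Suc i) - t i < \<delta>) \<Longrightarrow>
     prob {\<omega> \<in> space M. \<bar>\<Sum>i<n. ito_defect b s (t (Suc i) - t i) (w k (t (Suc i)) \<omega> - w k (t i) \<omega>)\<bar> > \<epsilon>} < \<epsilon>"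
    using exponential_riemann_sums_converge[OF basis W T \<epsilon>, of b s] by blast
  show "\<exists>\<delta>>0. \<forall>n t. t 0 = 0 \<and> t n = T \<and> (\<forall>i<n. t i < t (Suc i) \<and> t (Suc i) - t i < \<delta>) \<longrightarrow>
        prob {\<omega> \<in> space M. \<bar>(\<Sum>i<n. 1 / u (t i) \<omega> * (u (t (Suc i)) \<omega> - u (t i) \<omega>)) - (- (\<theta> * \<mu> k * T) + \<sigma> * q k * w k T \<omega>)\<bar> > \<epsilon>} < \<epsilon>"
  proof (intro exI[of _ \<delta>] conjI allI impI \<delta>)
    fix n :: nat and t :: "nat \<Rightarrow> real"
    assume "t 0 = 0 \<and> t n = T \<and> (\<forall>i<n. t i < t (Suc i) \<and> t (Suc i) - t i < \<delta>)"
    then have t0: "t 0 = 0" "t n = T" and step: "\<forall>i<n. t i < t (Suc i) \<and> t (Suc i) - t i < \<delta>" by auto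
    have tnn: "0 \<le> t i" if "i \<le> n" for i
      using that
    proof (induction i)
      case (Suc i)
      then show ?case using step[rule_format, of i] by simp
    qed (simp add: t0)
    have [measurable]: "w k (t i) \<in> borel_measurable M" "u (t i) \<in> borel_measurable M" if "i \<le> n" for i
      using wM uM tnn that by auto
    have w0: "AE \<omega> in M. w k 0 \<omega> = 0" using W by (simp add: standard_brownian_motion_def)
    let ?L = "\<lambda>\<omega>. (\<Sum>i<n. 1 / u (t i) \<omega> * (u (t (Suc i)) \<omega> - u (t i) \<omega>)) - (- (\<theta> * \<mu> k * T) + \<sigma> * q k * w k T \<omega>)"
    let ?R = "\<lambda>\<omega>. \<Sum>i<n. ito_defect b s (t (Suc i) - t i) (w k (t (Suc i)) \<omega> - w k (t i) \<omega>)"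
    have LR: "AE \<omega> in M. ?L \<omega> = ?R \<omega>"
      using w0 u0(2)
    proof eventually_elim
      case (elim \<omega>)
      have incr: "1 / u (t i) \<omega> * (u (t (Suc i)) \<omega> - u (t i) \<omega>)
          = ito_defect b s (t (Suc i) - t i) (w k (t (Suc i)) \<omega> - w k (t i) \<omega>)
            + ((s * w k (t (Suc i)) \<omega> - b * t (Suc i)) - (s * w k (t i) \<omega> - b * t i))" for i
      proof -
        have "u (t (Suc i)) \<omega> = u (t i) \<omega> * exp (- (b + s\<^sup>2 / 2) * (t (Suc i) - t i) + s * (w k (t (Suc i)) \<omega> - w k (t i) \<omega>))"
        proof -
          define a where "a = b + s\<^sup>2 / 2"
          have "- a * t (Suc i) + s * w k (t (Suc i)) \<omega> = (- a * t i + s * w k (t i) \<omega>)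
              + (- a * (t (Suc i) - t i) + s * (w k (t (Suc i)) \<omega> - w k (t i) \<omega>))"
            by (simp add: algebra_simps)
          then show ?thesis unfolding u a_def[symmetric] by (simp only: exp_add mult.assoc)
        qed
        moreover have "u (t i) \<omega> \<noteq> 0" using elim by (simp add: u)
        ultimately show ?thesis unfolding ito_defect_def
          by (simp add: right_diff_distrib)
      qed
      have "(\<Sum>i<n. 1 / u (t i) \<omega> * (u (t (Suc i)) \<omega> - u (t i) \<omega>))
         = ?R \<omega> + (\<Sum>i<n. (s * w k (t (Suc i)) \<omega> - b * t (Suc i)) - (s * w k (t i) \<omega> - b * t i))"
        unfolding incr by (rule sum.distrib)
      also have "(\<Sum>i<n. (s * w k (t (Suc i)) \<omega> - b * t (Suc i)) - (s * w k (t i) \<omega> - b * t i)) = s * w k T \<omega> - b * T"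
        using sum_lessThan_telescope[of "\<lambda>i. s * w k (t i) \<omega> - b * t i" n] elim by (simp add: t0)
      finally show ?case by (simp add: s_def b_def)
    qed
    have [measurable]: "w k T \<in> borel_measurable M" using wM T by simp
    have "prob {\<omega> \<in> space M. \<bar>?L \<omega>\<bar> > \<epsilon>} = prob {\<omega> \<in> space M. \<bar>?R \<omega>\<bar> > \<epsilon>}"
    proof (rule measure_eq_AE)
      have "?L \<in> borel_measurable M"
        by (intro borel_measurable_diff borel_measurable_sum borel_measurable_times) auto
      then show "{\<omega> \<in> space M. \<bar>?L \<omega>\<bar> > \<epsilon>} \<in> sets M" by measurable
      have "(\<lambda>\<omega>. ito_defect b s (t (Suc i) - t i) (w k (t (Suc i)) \<omega> - w k (t i) \<omega>)) \<in> borel_measurable M" if "i < n" for i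
      proof -
        have [measurable]: "w k (t i) \<in> borel_measurable M" "w k (t (Suc i)) \<in> borel_measurable M"
          using wM tnn that by auto
        show ?thesis unfolding ito_defect_def by measurable
      qed
      then have "?R \<in> borel_measurable M" by (intro borel_measurable_sum) auto
      then show "{\<omega> \<in> space M. \<bar>?R \<omega>\<bar> > \<epsilon>} \<in> sets M" by measurable
    qed (use LR in auto)
    then show "prob {\<omega> \<in> space M. \<bar>?L \<omega>\<bar> > \<epsilon>} < \<epsilon>" using D[OF t0 step] by simp
  qed
qed

section \<open>The observed statistic and the Fisher information\<close>

lemma has_ito_integral_ito_integral:
  "has_ito_integral M T H X J \<Longrightarrow> has_ito_integral M T H X (ito_integral M T H X)"
  unfolding ito_integral_def by (rule someI[where P = "has_ito_integral M T H X"])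

lemma fisher_info_pos:
  assumes "0 < T" "0 < \<sigma>" "1 \<le> N" and \<mu>: "\<And>k. 1 \<le> k \<Longrightarrow> 0 < \<mu> k" and q: "\<And>k. 1 \<le> k \<Longrightarrow> 0 < q k"
  shows "0 < fisher_info T \<sigma> \<mu> q N"
proof -
  have "0 < (\<mu> k)\<^sup>2 / (q k)\<^sup>2" if "1 \<le> k" for k using \<mu>[OF that] q[OF that] by simp
  then have "0 < (\<Sum>k=1..N. (\<mu> k)\<^sup>2 / (q k)\<^sup>2)" using \<open>1 \<le> N\<close> by (intro sum_pos) (simp_all only: atLeastAtMost_iff finite_atLeastAtMost, simp)
  then show ?thesis using assms(1,2) by (simp add: fisher_info_def)
qed

text \<open>Well-posedness gives \<open>\<sigma>\<^sup>2 q\<^sub>k\<^sup>2 < 2 \<theta>b \<mu>\<^sub>k\<close>, so each summand of the Fisher information is at least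
  a multiple of \<open>\<mu>\<^sub>k\<close> and thus eventually at least \<open>2\<close>. Linear growth is enough for the series in
  the Borel-Cantelli argument to converge.\<close>

lemma fisher_info_growth:
  assumes T: "0 < T" and \<sigma>: "0 < \<sigma>" and \<mu>: "\<And>k. 1 \<le> k \<Longrightarrow> 0 < \<mu> k" and q: "\<And>k. 1 \<le> k \<Longrightarrow> 0 < q k"
    and lim: "filterlim \<mu> at_top sequentially"
    and wp: "\<exists>\<theta>b>0. \<exists>N0. \<exists>c>0. \<forall>k\<ge>1. k \<ge> N0 \<longrightarrow> 2 * \<theta>b - \<sigma>\<^sup>2 * (q k)\<^sup>2 / \<mu> k \<ge> c"
  shows "eventually (\<lambda>N. real N \<le> fisher_info T \<sigma> \<mu> q N) sequentially"
proof -
  obtain \<theta>b N0 c where wp': "0 < \<theta>b" "0 < c" "\<And>k. 1 \<le> k \<Longrightarrow> N0 \<le> k \<Longrightarrow> c \<le> 2 * \<theta>b - \<sigma>\<^sup>2 * (q k)\<^sup>2 / \<mu> k"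
    using wp by blast
  have "eventually (\<lambda>k. 4 * \<theta>b / T \<le> \<mu> k) sequentially"
    using lim by (simp add: filterlim_at_top)
  then obtain k0 where k0: "\<And>k. k0 \<le> k \<Longrightarrow> 4 * \<theta>b / T \<le> \<mu> k" by (auto simp: eventually_sequentially)
  define K where "K = max 1 (max k0 N0)"
  have big: "2 \<le> T / \<sigma>\<^sup>2 * ((\<mu> k)\<^sup>2 / (q k)\<^sup>2)" if "K \<le> k" for k
  proof -
    have k: "1 \<le> k" "k0 \<le> k" "N0 \<le> k" using that by (auto simp: K_def)
    note pos = \<mu>[OF k(1)] q[OF k(1)]
    have "\<sigma>\<^sup>2 * (q k)\<^sup>2 / \<mu> k < 2 * \<theta>b" using wp'(3)[OF k(1,3)] wp'(2) by linarith
    then have "\<sigma>\<^sup>2 * (q k)\<^sup>2 < 2 * \<theta>b * \<mu> k" using pos by (simp add: divide_less_eq)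
    moreover have "4 * \<theta>b \<le> T * \<mu> k" using k0[OF k(2)] T by (simp add: divide_le_eq mult.commute)
    ultimately have "2 * (\<sigma>\<^sup>2 * (q k)\<^sup>2) \<le> T * \<mu> k * \<mu> k"
      using pos mult_right_mono[of "4 * \<theta>b" "T * \<mu> k" "\<mu> k"] by linarith
    then show ?thesis using pos \<sigma> by (simp add: field_simps power2_eq_square)
  qed
  have "real N \<le> fisher_info T \<sigma> \<mu> q N" if N: "2 * K \<le> N" for N
  proof -
    have "real N \<le> real (N + 1 - K) * 2" using N by simp
    also have "\<dots> = (\<Sum>k=K..N. 2)" by simp
    also have "\<dots> \<le> (\<Sum>k=K..N. T / \<sigma>\<^sup>2 * ((\<mu> k)\<^sup>2 / (q k)\<^sup>2))" by (intro sum_mono big) auto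
    also have "\<dots> \<le> (\<Sum>k=1..N. T / \<sigma>\<^sup>2 * ((\<mu> k)\<^sup>2 / (q k)\<^sup>2))"
      using T by (intro sum_mono2) (auto simp: K_def)
    also have "\<dots> = fisher_info T \<sigma> \<mu> q N" by (simp add: fisher_info_def sum_distrib_left)
    finally show ?thesis .
  qed
  then show ?thesis by (auto simp: eventually_sequentially)
qed

lemma theta_hat_decomposition:
  fixes \<sigma> \<theta> T :: real and \<mu> q :: "nat \<Rightarrow> real" and w :: "nat \<Rightarrow> real \<Rightarrow> 'a \<Rightarrow> real" and u0 :: "nat \<Rightarrow> 'a \<Rightarrow> real"
  assumes basis: "usual_stochastic_basis M F" and bm: "independent_brownian_motions M F w"
    and u0: "\<And>k. 1 \<le> k \<Longrightarrow> u0 k \<in> borel_measurable (F 0)" "\<And>k. 1 \<le> k \<Longrightarrow> AE \<omega> in M. u0 k \<omega> \<noteq> 0"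
    and T: "0 < T" and \<sigma>: "0 < \<sigma>" and \<mu>: "\<And>k. 1 \<le> k \<Longrightarrow> 0 < \<mu> k" and q: "\<And>k. 1 \<le> k \<Longrightarrow> 0 < q k"
  shows "theta_hat M T \<mu> q (fourier_mode \<sigma> \<mu> q w u0 \<theta>) N \<in> borel_measurable M"
    and "1 \<le> N \<Longrightarrow> AE \<omega> in M. theta_hat M T \<mu> q (fourier_mode \<sigma> \<mu> q w u0 \<theta>) N \<omega>
       = \<theta> + xi_stat T \<sigma> \<mu> q w N \<omega> / sqrt (fisher_info T \<sigma> \<mu> q N)"
proof -
  interpret prob_space M using basis by (simp add: usual_stochastic_basis_def)
  let ?u = "fourier_mode \<sigma> \<mu> q w u0 \<theta>"
  let ?J = "\<lambda>k. ito_integral M T (\<lambda>t \<omega>. 1 / ?u k t \<omega>) (?u k)"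
  have W: "standard_brownian_motion M F (w k)" if "1 \<le> k" for k
    using bm that by (simp add: independent_brownian_motions_def)
  have log: "has_ito_integral M T (\<lambda>t \<omega>. 1 / ?u k t \<omega>) (?u k) (\<lambda>\<omega>. - (\<theta> * \<mu> k * T) + \<sigma> * q k * w k T \<omega>)" if "1 \<le> k" for k
    by (rule fourier_mode_log_integral[where F = F]) (use that basis W u0 T in auto)
  note ito = has_ito_integral_ito_integral[OF log]
  have JM: "?J k \<in> borel_measurable M" if "1 \<le> k" for k
    using ito[OF that] by (simp add: has_ito_integral_def)
  then show "theta_hat M T \<mu> q ?u N \<in> borel_measurable M"
    unfolding theta_hat_def[abs_def]
    by (intro borel_measurable_divide borel_measurable_uminus borel_measurable_sum borel_measurable_times) auto
  have uM: "?u k t \<in> borel_measurable M" if "1 \<le> k" "0 \<le> t" for k t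
  proof -
    have sub: "subalgebra M (F r)" if "0 \<le> r" for r using basis that by (simp add: usual_stochastic_basis_def)
    have [measurable]: "w k t \<in> borel_measurable M"
      using measurable_from_subalg[OF sub[OF that(2)]] W[OF that(1)] that unfolding standard_brownian_motion_def by blast
    have [measurable]: "u0 k \<in> borel_measurable M"
      using measurable_from_subalg[OF sub u0(1)[OF that(1)]] by simp
    show ?thesis unfolding fourier_mode_def[abs_def] by measurable
  qed
  have Jeq: "AE \<omega> in M. \<forall>k\<ge>1. ?J k \<omega> = - (\<theta> * \<mu> k * T) + \<sigma> * q k * w k T \<omega>"
  proof -
    have "AE \<omega> in M. 1 \<le> k \<longrightarrow> ?J k \<omega> = - (\<theta> * \<mu> k * T) + \<sigma> * q k * w k T \<omega>" for k
    proof (cases "1 \<le> k")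
      case True
      have "AE \<omega> in M. ?J k \<omega> = - (\<theta> * \<mu> k * T) + \<sigma> * q k * w k T \<omega>"
        by (rule has_ito_integral_unique[OF prob_space_axioms T _ _ ito log]) (use True uM in auto)
      then show ?thesis by simp
    qed simp
    then show ?thesis by (simp add: AE_all_countable)
  qed
  show "AE \<omega> in M. theta_hat M T \<mu> q ?u N \<omega> = \<theta> + xi_stat T \<sigma> \<mu> q w N \<omega> / sqrt (fisher_info T \<sigma> \<mu> q N)" if N: "1 \<le> N"
    using Jeq
  proof eventually_elim
    case (elim \<omega>)
    define S where "S = (\<Sum>k=1..N. (\<mu> k)\<^sup>2 / (q k)\<^sup>2)"
    define R where "R = (\<Sum>k=1..N. \<mu> k / q k * w k T \<omega>)"
    have fi: "fisher_info T \<sigma> \<mu> q N = T / \<sigma>\<^sup>2 * S" by (simp add: fisher_info_def S_def)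
    have fi0: "0 < fisher_info T \<sigma> \<mu> q N" by (rule fisher_info_pos[OF T \<sigma> N \<mu> q])
    then have S: "0 < S" using T \<sigma> by (simp add: fi zero_less_mult_iff zero_less_divide_iff)
    have "(\<Sum>k=1..N. \<mu> k / (q k)\<^sup>2 * ?J k \<omega>) = (\<Sum>k=1..N. - (\<theta> * T) * ((\<mu> k)\<^sup>2 / (q k)\<^sup>2) + \<sigma> * (\<mu> k / q k * w k T \<omega>))"
    proof (rule sum.cong[OF refl])
      fix k assume "k \<in> {1..N}"
      then have "1 \<le> k" by simp
      then have J: "?J k \<omega> = - (\<theta> * \<mu> k * T) + \<sigma> * q k * w k T \<omega>" and "0 < q k" using elim q by auto
      then show "\<mu> k / (q k)\<^sup>2 * ?J k \<omega> = - (\<theta> * T) * ((\<mu> k)\<^sup>2 / (q k)\<^sup>2) + \<sigma> * (\<mu> k / q k * w k T \<omega>)"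
        unfolding J by (simp add: field_simps power2_eq_square)
    qed
    also have "\<dots> = - (\<theta> * T) * S + \<sigma> * R"
      unfolding S_def R_def by (simp only: sum.distrib sum_distrib_left)
    finally have "theta_hat M T \<mu> q ?u N \<omega> = - (- (\<theta> * T) * S + \<sigma> * R) / (T * S)"
      by (simp add: theta_hat_def S_def)
    also have "\<dots> = \<theta> - \<sigma> * R / (T * S)" using T S by (simp add: field_simps)
    also have "\<sigma> * R / (T * S) = R / (\<sigma> * fisher_info T \<sigma> \<mu> q N)"
      using \<sigma> T S by (simp add: fi field_simps power2_eq_square)
    also have "\<theta> - R / (\<sigma> * fisher_info T \<sigma> \<mu> q N) = \<theta> + xi_stat T \<sigma> \<mu> q w N \<omega> / sqrt (fisher_info T \<sigma> \<mu> q N)"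
    proof -
      have "xi_stat T \<sigma> \<mu> q w N \<omega> = - (1 / (\<sigma> * sqrt (fisher_info T \<sigma> \<mu> q N))) * R"
        by (simp only: xi_stat_def R_def)
      then show ?thesis using fi0 by simp
    qed
    finally show ?case .
  qed
qed

lemma xi_stat_standard_normal:
  assumes basis: "usual_stochastic_basis M F" and bm: "independent_brownian_motions M F w"
    and T: "0 < T" and \<sigma>: "0 < \<sigma>" and \<mu>: "\<And>k. 1 \<le> k \<Longrightarrow> 0 < \<mu> k" and q: "\<And>k. 1 \<le> k \<Longrightarrow> 0 < q k"
    and N: "1 \<le> N"
  shows "distributed M lborel (xi_stat T \<sigma> \<mu> q w N) std_normal_density"
proof -
  interpret prob_space M using basis by (simp add: usual_stochastic_basis_def)
  define I where "I = fisher_info T \<sigma> \<mu> q N"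
  have I: "0 < I" unfolding I_def by (rule fisher_info_pos[OF T \<sigma> N \<mu> q])
  define a where "a k = - (1 / (\<sigma> * sqrt I)) * (\<mu> k / q k)" for k
  have a0: "a k \<noteq> 0" if "1 \<le> k" for k using \<mu>[OF that] q[OF that] \<sigma> I by (simp add: a_def)
  have dist: "distributed M lborel (w k T) (normal_density 0 (sqrt T))" if "1 \<le> k" for k
  proof -
    have W: "standard_brownian_motion M F (w k)" using bm that by (simp add: independent_brownian_motions_def)
    then have d: "distributed M lborel (\<lambda>\<omega>. w k T \<omega> - w k 0 \<omega>) (normal_density 0 (sqrt T))"
      and w0: "AE \<omega> in M. w k 0 \<omega> = 0" using T unfolding standard_brownian_motion_def by force+
    have sub: "subalgebra M (F T)" using basis T by (simp add: usual_stochastic_basis_def)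
    have wM: "w k T \<in> borel_measurable M"
      using measurable_from_subalg[OF sub] W T unfolding standard_brownian_motion_def by (meson less_imp_le)
    have "distr M lborel (w k T) = distr M lborel (\<lambda>\<omega>. w k T \<omega> - w k 0 \<omega>)"
      using w0 wM d by (intro distr_cong_AE) (auto simp: distributed_def)
    then show ?thesis using d wM by (simp add: distributed_def)
  qed
  have "indep_vars (\<lambda>_. borel) (\<lambda>k \<omega>. a k * (\<lambda>t\<in>{0..}. w k t \<omega>) T) {1..}"
  proof (rule indep_vars_compose2[where X = "\<lambda>k \<omega>. \<lambda>t\<in>{0..}. w k t \<omega>" and Y = "\<lambda>k f. a k * f T"])
    show "indep_vars (\<lambda>_. Pi\<^sub>M {0..} (\<lambda>_. borel)) (\<lambda>k \<omega>. \<lambda>t\<in>{0..}. w k t \<omega>) {1..}"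
      using bm by (simp add: independent_brownian_motions_def)
    have [measurable]: "(\<lambda>f. f T) \<in> Pi\<^sub>M {0..} (\<lambda>_. borel) \<rightarrow>\<^sub>M (borel :: real measure)"
      using T by (intro measurable_component_singleton) auto
    show "(\<lambda>f. a k * f T) \<in> Pi\<^sub>M {0..} (\<lambda>_. borel) \<rightarrow>\<^sub>M (borel :: real measure)" for k
      by measurable
  qed
  then have "indep_vars (\<lambda>_. borel) (\<lambda>k \<omega>. a k * (\<lambda>t\<in>{0..}. w k t \<omega>) T) {1..N}"
    by (rule indep_vars_subset) auto
  then have ind: "indep_vars (\<lambda>_. borel) (\<lambda>k \<omega>. a k * w k T \<omega>) {1..N}" using T by simp
  have "distributed M lborel (\<lambda>\<omega>. \<Sum>k\<in>{1..N}. a k * w k T \<omega>)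
     (normal_density (\<Sum>k\<in>{1..N}. 0) (sqrt (\<Sum>k\<in>{1..N}. (\<bar>a k\<bar> * sqrt T)\<^sup>2)))"
  proof (rule sum_indep_normal[OF _ _ ind])
    fix k assume "k \<in> {1..N}"
    then have k: "1 \<le> k" by simp
    show "0 < \<bar>a k\<bar> * sqrt T" using a0[OF k] T by simp
    show "distributed M lborel (\<lambda>\<omega>. a k * w k T \<omega>) (normal_density 0 (\<bar>a k\<bar> * sqrt T))"
      using normal_density_affine[OF dist[OF k], of "a k" 0] a0[OF k] T by simp
  qed (use N in auto)
  moreover have "(\<Sum>k\<in>{1..N}. (\<bar>a k\<bar> * sqrt T)\<^sup>2) = 1"
  proof -
    have "(\<Sum>k\<in>{1..N}. (\<bar>a k\<bar> * sqrt T)\<^sup>2) = (\<Sum>k\<in>{1..N}. 1 / I * (T / \<sigma>\<^sup>2 * ((\<mu> k)\<^sup>2 / (q k)\<^sup>2)))"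
      using I T by (intro sum.cong) (simp_all add: a_def power_mult_distrib power_divide mult_ac)
    also have "\<dots> = 1 / I * I" by (simp only: sum_distrib_left[symmetric] I_def fisher_info_def)
    finally show ?thesis using I by simp
  qed
  moreover have "(\<lambda>\<omega>. \<Sum>k\<in>{1..N}. a k * w k T \<omega>) = xi_stat T \<sigma> \<mu> q w N"
    by (simp add: xi_stat_def[abs_def] a_def I_def sum_distrib_left mult.assoc)
  ultimately show ?thesis by simp
qed

section \<open>Bayes estimates in a normal location experiment\<close>

lemma SUP_tendsto_zeroI:
  fixes f :: "nat \<Rightarrow> 'b \<Rightarrow> ennreal"
  assumes "\<And>\<kappa>. 0 < \<kappa> \<Longrightarrow> eventually (\<lambda>N. \<forall>\<theta>\<in>B. f N \<theta> \<le> ennreal \<kappa>) sequentially"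
  shows "(\<lambda>N. SUP \<theta>\<in>B. f N \<theta>) \<longlonglongrightarrow> 0"
proof (rule order_tendstoI)
  fix a :: ennreal assume "0 < a"
  then obtain y where y: "0 < y" "y < a" using dense by blast
  then obtain \<kappa> where \<kappa>: "0 < \<kappa>" "y = ennreal \<kappa>"
    by (cases y) (auto simp: ennreal_less_iff)
  show "eventually (\<lambda>N. (SUP \<theta>\<in>B. f N \<theta>) < a) sequentially"
    using assms[OF \<kappa>(1)] by eventually_elim (use y \<kappa> in \<open>auto intro: le_less_trans SUP_least\<close>)
qed simp

text \<open>The fourth moment is the smallest even one whose tail bound is summable when the threshold grows
  like the square root of \<open>N\<close>.\<close>

lemma std_normal_tail:
  assumes "prob_space M" and X: "distributed M lborel X std_normal_density" and a: "0 < a"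
  shows "emeasure M {\<omega> \<in> space M. a < \<bar>X \<omega>\<bar>} \<le> ennreal (3 / a^4)"
proof -
  interpret prob_space M by fact
  have [measurable]: "X \<in> borel_measurable M" using X by (simp add: distributed_def)
  have m: "has_bochner_integral lborel (\<lambda>x. std_normal_density x * x ^ 4) 3"
    using std_normal_moment_even[of 2] by (simp add: fact_numeral)
  have int: "integrable M (\<lambda>\<omega>. X \<omega> ^ 4)" "expectation (\<lambda>\<omega>. X \<omega> ^ 4) = 3"
    using distributed_integrable[OF X, of "\<lambda>x. x ^ 4"] distributed_integral[OF X, of "\<lambda>x. x ^ 4"] m
    by (auto simp: has_bochner_integral_iff)
  have "{\<omega> \<in> space M. a < \<bar>X \<omega>\<bar>} \<subseteq> {\<omega> \<in> space M. a ^ 4 \<le> X \<omega> ^ 4}"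
  proof safe
    fix \<omega> assume "a < \<bar>X \<omega>\<bar>"
    then have "a ^ 4 \<le> \<bar>X \<omega>\<bar> ^ 4" using a by (intro power_mono) auto
    then show "a ^ 4 \<le> X \<omega> ^ 4" by simp
  qed
  then have "prob {\<omega> \<in> space M. a < \<bar>X \<omega>\<bar>} \<le> prob {\<omega> \<in> space M. a ^ 4 \<le> X \<omega> ^ 4}"
    by (intro finite_measure_mono) auto
  also have "\<dots> \<le> expectation (\<lambda>\<omega>. X \<omega> ^ 4) / a ^ 4"
    using a int(1) by (intro integral_Markov_inequality_measure[of _ _ "space M"]) auto
  finally show ?thesis by (simp add: int(2) emeasure_eq_measure ennreal_leI)
qed

text \<open>What remains of the stochastic equation: an estimator that is normal around the parameter with
  variance \<open>1 / I N\<close>, and a Bayes estimate computed from its value.\<close>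

locale normal_location_experiment = prob_space M for M :: "'a measure" +
  fixes I :: "nat \<Rightarrow> real" and \<xi> :: "nat \<Rightarrow> 'a \<Rightarrow> real" and \<theta>h :: "real \<Rightarrow> nat \<Rightarrow> 'a \<Rightarrow> real"
    and \<rho> l :: "real \<Rightarrow> real"
  assumes complete_M: "complete_measure M"
    and I_pos: "\<And>N. 1 \<le> N \<Longrightarrow> 0 < I N"
    and I_growth: "eventually (\<lambda>N. real N \<le> I N) sequentially"
    and \<xi>_normal: "\<And>N. 1 \<le> N \<Longrightarrow> distributed M lborel (\<xi> N) std_normal_density"
    and \<theta>h_measurable: "\<And>\<theta> N. \<theta>h \<theta> N \<in> borel_measurable M"
    and \<theta>h_eq: "\<And>\<theta> N. 1 \<le> N \<Longrightarrow> AE \<omega> in M. \<theta>h \<theta> N \<omega> = \<theta> + \<xi> N \<omega> / sqrt (I N)"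
    and prior: "\<rho> \<in> Q_e2" and loss: "l \<in> W_e2"
    and strict_min: "\<And>r. r \<noteq> 0 \<Longrightarrow>
      (LBINT y. l y * exp (- (y\<^sup>2 / 2))) < (LBINT y. l (y + r) * exp (- (y\<^sup>2 / 2)))"
    and well_defined: "\<And>\<theta> N. 0 < \<theta> \<Longrightarrow> 1 \<le> N \<Longrightarrow> AE \<omega> in M. bayes_well_defined \<rho> l (I N) (\<theta>h \<theta> N \<omega>)"
begin

definition estimator :: "real \<Rightarrow> nat \<Rightarrow> 'a \<Rightarrow> real" where
  "estimator \<theta> N \<omega> = bayes_estimate \<rho> l (I N) (\<theta>h \<theta> N \<omega>)"

lemma loss_W: "l \<in> W_loss"
  using loss by (simp add: W_e2_def)

lemma I_at_top: "filterlim I at_top sequentially"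
  using filterlim_real_sequentially I_growth by (rule filterlim_at_top_mono)

lemma sqrt_I_at_top: "filterlim (\<lambda>N. sqrt (I N)) at_top sequentially"
  using sqrt_at_top I_at_top by (rule filterlim_compose)

lemma \<xi>_measurable: "1 \<le> N \<Longrightarrow> \<xi> N \<in> borel_measurable M"
  using \<xi>_normal[of N] by (simp add: distributed_def)

lemma estimator_measurable:
  assumes "0 < \<theta>" "1 \<le> N"
  shows "estimator \<theta> N \<in> borel_measurable M"
  unfolding estimator_def[abs_def]
  using assms I_pos[of N] well_defined
  by (intro bayes_estimate_measurable[OF prior loss_W complete_M _ \<theta>h_measurable]) auto

text \<open>The remainder of the expansion is a deterministic function of the observed value, and is small when
  that value stays in a compact subset of \<open>{0<..}\<close>. For parameters in \<open>[c, d]\<close> this fails only if the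
  noise \<open>\<xi> N\<close> exceeds \<open>\<delta> sqrt (I N)\<close>.\<close>

lemma estimator_close:
  assumes cd: "0 < c" "c \<le> d" and \<epsilon>: "0 < \<epsilon>"
  shows "\<exists>\<delta>>0. eventually (\<lambda>N. 1 \<le> N \<and> (\<forall>\<theta>\<in>{c..d}. AE \<omega> in M. \<bar>\<xi> N \<omega>\<bar> \<le> \<delta> * sqrt (I N) \<longrightarrow>
      \<bar>sqrt (I N) * (estimator \<theta> N \<omega> - \<theta>) - \<xi> N \<omega>\<bar> < \<epsilon>)) sequentially"
proof -
  note ext = Q_e2_extended_prior[OF prior]
  obtain \<omega>0 where "bayes_well_defined \<rho> l (I 1) (\<theta>h 1 1 \<omega>0)"
    using eventually_happens[OF well_defined[of 1 1]] by (auto simp: prob_space.ae_filter_bot AE_False eventually_False ae_filter_eq_bot_iff emeasure_space_1)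
  then have fin: "(\<integral>\<^sup>+\<eta>. ennreal (exp (- \<eta>\<^sup>2) * extended_prior \<rho> \<eta>) \<partial>lborel) < \<infinity>"
    using I_pos[of 1] by (intro extended_prior_gaussian_mass_finite[OF prior]) auto
  obtain \<Lambda> where \<Lambda>: "0 < \<Lambda>" "gaussian_risk l 0 < truncated_risk l \<Lambda> \<epsilon>"
    using gaussian_risk_strict_gap[OF loss _ strict_min, of \<epsilon>] \<epsilon> by auto
  obtain S where S: "0 < S" "\<And>s x r. S \<le> s \<Longrightarrow> x \<in> {c/2..d+1} \<Longrightarrow> \<epsilon> \<le> \<bar>r\<bar> \<Longrightarrow>
      scaled_risk (extended_prior \<rho>) l s x 0 < scaled_risk (extended_prior \<rho>) l s x r"
    using risk_localization[OF loss ext(1) ext(2) ext(3) ext(4) fin _ _ \<epsilon> \<Lambda>(2,1), of "c/2" "d+1"] cd by force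
  define \<delta> where "\<delta> = min (c/2) 1"
  have \<delta>: "0 < \<delta>" "\<delta> \<le> c/2" "\<delta> \<le> 1" using cd by (auto simp: \<delta>_def)
  have "eventually (\<lambda>N. S \<le> sqrt (I N)) sequentially"
    using sqrt_I_at_top by (simp add: filterlim_at_top)
  then have "eventually (\<lambda>N. 1 \<le> N \<and> (\<forall>\<theta>\<in>{c..d}. AE \<omega> in M. \<bar>\<xi> N \<omega>\<bar> \<le> \<delta> * sqrt (I N) \<longrightarrow>
      \<bar>sqrt (I N) * (estimator \<theta> N \<omega> - \<theta>) - \<xi> N \<omega>\<bar> < \<epsilon>)) sequentially"
    using eventually_ge_at_top[of 1]
  proof eventually_elim
    case (elim N)
    have I: "0 < I N" using I_pos elim by simp
    show ?case
    proof (intro conjI ballI)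
      fix \<theta> assume \<theta>: "\<theta> \<in> {c..d}"
      then have "0 < \<theta>" using cd by simp
      from \<theta>h_eq[OF elim(2)] well_defined[OF this elim(2)]
      show "AE \<omega> in M. \<bar>\<xi> N \<omega>\<bar> \<le> \<delta> * sqrt (I N) \<longrightarrow> \<bar>sqrt (I N) * (estimator \<theta> N \<omega> - \<theta>) - \<xi> N \<omega>\<bar> < \<epsilon>"
      proof eventually_elim
        fix \<omega> assume x: "\<theta>h \<theta> N \<omega> = \<theta> + \<xi> N \<omega> / sqrt (I N)" and wd: "bayes_well_defined \<rho> l (I N) (\<theta>h \<theta> N \<omega>)"
        show "\<bar>\<xi> N \<omega>\<bar> \<le> \<delta> * sqrt (I N) \<longrightarrow> \<bar>sqrt (I N) * (estimator \<theta> N \<omega> - \<theta>) - \<xi> N \<omega>\<bar> < \<epsilon>"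
        proof
          assume "\<bar>\<xi> N \<omega>\<bar> \<le> \<delta> * sqrt (I N)"
          then have "\<bar>\<xi> N \<omega> / sqrt (I N)\<bar> \<le> \<delta>" using I by (simp add: divide_le_eq)
          moreover have "c \<le> \<theta>" "\<theta> \<le> d" using \<theta> by auto
          ultimately have "c / 2 \<le> \<theta>h \<theta> N \<omega>" "\<theta>h \<theta> N \<omega> \<le> d + 1" using x \<delta> by linarith+
          then have xi: "\<theta>h \<theta> N \<omega> \<in> {c/2..d+1}" by simp
          then have x0: "0 < \<theta>h \<theta> N \<omega>" using cd by auto
          have "\<bar>sqrt (I N) * (bayes_estimate \<rho> l (I N) (\<theta>h \<theta> N \<omega>) - \<theta>h \<theta> N \<omega>)\<bar> < \<epsilon>"
            by (rule bayes_estimate_localized[OF prior loss_W wd I x0 \<epsilon>]) (rule S(2)[OF elim(1) xi])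
          moreover have "sqrt (I N) * (bayes_estimate \<rho> l (I N) (\<theta>h \<theta> N \<omega>) - \<theta>h \<theta> N \<omega>)
              = sqrt (I N) * (estimator \<theta> N \<omega> - \<theta>) - \<xi> N \<omega>"
            using I unfolding estimator_def by (simp add: x algebra_simps)
          ultimately show "\<bar>sqrt (I N) * (estimator \<theta> N \<omega> - \<theta>) - \<xi> N \<omega>\<bar> < \<epsilon>" by simp
        qed
      qed
    qed (use elim in simp)
  qed
  then show ?thesis using \<delta>(1) by blast
qed

lemma \<xi>_tail_small:
  assumes "0 < \<delta>" "0 < \<kappa>"
  shows "eventually (\<lambda>N. 1 \<le> N \<and> emeasure M {\<omega> \<in> space M. \<delta> * sqrt (I N) < \<bar>\<xi> N \<omega>\<bar>} \<le> ennreal \<kappa>) sequentially"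
proof -
  have "((\<lambda>s. 3 / (\<delta> * s) ^ 4) \<longlongrightarrow> 0) at_top" using assms(1) by real_asymp
  then have "((\<lambda>N. 3 / (\<delta> * sqrt (I N)) ^ 4) \<longlongrightarrow> 0) sequentially"
    using sqrt_I_at_top by (rule filterlim_compose)
  then have "eventually (\<lambda>N. 3 / (\<delta> * sqrt (I N)) ^ 4 < \<kappa>) sequentially"
    using assms(2) by (rule order_tendstoD)
  then show ?thesis using eventually_ge_at_top[of 1]
  proof eventually_elim
    case (elim N)
    have "emeasure M {\<omega> \<in> space M. \<delta> * sqrt (I N) < \<bar>\<xi> N \<omega>\<bar>} \<le> ennreal (3 / (\<delta> * sqrt (I N)) ^ 4)"
      using assms(1) I_pos elim by (intro std_normal_tail[OF prob_space_axioms \<xi>_normal]) auto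
    also have "\<dots> \<le> ennreal \<kappa>" using elim by (intro ennreal_leI) simp
    finally show ?case using elim by simp
  qed
qed

lemma compact_pos_bounds:
  assumes "compact B" "B \<subseteq> {0<..}"
  shows "\<exists>c d :: real. 0 < c \<and> c \<le> d \<and> B \<subseteq> {c..d}"
proof (cases "B = {}")
  case True
  then show ?thesis by (intro exI[of _ 1]) auto
next
  case False
  obtain c where c: "c \<in> B" "\<And>x. x \<in> B \<Longrightarrow> c \<le> x" using compact_attains_inf[OF assms(1) False] by blast
  obtain d where d: "d \<in> B" "\<And>x. x \<in> B \<Longrightarrow> x \<le> d" using compact_attains_sup[OF assms(1) False] by blast
  show ?thesis using c d assms(2) by (intro exI[of _ c] exI[of _ d]) auto
qed

theorem estimator_expansion:
  assumes B: "compact B" "B \<subseteq> {0<..}" and \<epsilon>: "0 < \<epsilon>"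
  shows "(\<lambda>N. SUP \<theta>\<in>B. emeasure M {\<omega> \<in> space M. \<bar>sqrt (I N) * (estimator \<theta> N \<omega> - \<theta>) - \<xi> N \<omega>\<bar> > \<epsilon>}) \<longlonglongrightarrow> 0"
proof (rule SUP_tendsto_zeroI)
  fix \<kappa> :: real assume \<kappa>: "0 < \<kappa>"
  obtain c d where cd: "0 < c" "c \<le> d" "B \<subseteq> {c..d}" using compact_pos_bounds[OF B] by blast
  obtain \<delta> where \<delta>: "0 < \<delta>" "eventually (\<lambda>N. 1 \<le> N \<and> (\<forall>\<theta>\<in>{c..d}. AE \<omega> in M. \<bar>\<xi> N \<omega>\<bar> \<le> \<delta> * sqrt (I N) \<longrightarrow>
      \<bar>sqrt (I N) * (estimator \<theta> N \<omega> - \<theta>) - \<xi> N \<omega>\<bar> < \<epsilon>)) sequentially"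
    using estimator_close[OF cd(1,2) \<epsilon>] by blast
  show "eventually (\<lambda>N. \<forall>\<theta>\<in>B. emeasure M {\<omega> \<in> space M. \<bar>sqrt (I N) * (estimator \<theta> N \<omega> - \<theta>) - \<xi> N \<omega>\<bar> > \<epsilon>} \<le> ennreal \<kappa>) sequentially"
    using \<delta>(2) \<xi>_tail_small[OF \<delta>(1) \<kappa>]
  proof eventually_elim
    case (elim N)
    note [measurable] = \<xi>_measurable[of N]
    show ?case
    proof
      fix \<theta> assume "\<theta> \<in> B"
      then have "AE \<omega> in M. \<bar>\<xi> N \<omega>\<bar> \<le> \<delta> * sqrt (I N) \<longrightarrow> \<bar>sqrt (I N) * (estimator \<theta> N \<omega> - \<theta>) - \<xi> N \<omega>\<bar> < \<epsilon>"
        using elim cd by auto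
      then have "emeasure M {\<omega> \<in> space M. \<bar>sqrt (I N) * (estimator \<theta> N \<omega> - \<theta>) - \<xi> N \<omega>\<bar> > \<epsilon>}
          \<le> emeasure M {\<omega> \<in> space M. \<delta> * sqrt (I N) < \<bar>\<xi> N \<omega>\<bar>}"
        using elim by (intro emeasure_mono_AE) (auto elim!: eventually_mono)
      then show "emeasure M {\<omega> \<in> space M. \<bar>sqrt (I N) * (estimator \<theta> N \<omega> - \<theta>) - \<xi> N \<omega>\<bar> > \<epsilon>} \<le> ennreal \<kappa>"
        using elim by auto
    qed
  qed
qed

theorem estimator_consistent:
  assumes B: "compact B" "B \<subseteq> {0<..}" and \<epsilon>: "0 < \<epsilon>"
  shows "(\<lambda>N. SUP \<theta>\<in>B. emeasure M {\<omega> \<in> space M. \<bar>estimator \<theta> N \<omega> - \<theta>\<bar> > \<epsilon>}) \<longlonglongrightarrow> 0"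
proof (rule SUP_tendsto_zeroI)
  fix \<kappa> :: real assume \<kappa>: "0 < \<kappa>"
  obtain c d where cd: "0 < c" "c \<le> d" "B \<subseteq> {c..d}" using compact_pos_bounds[OF B] by blast
  obtain \<delta> where \<delta>: "0 < \<delta>" "eventually (\<lambda>N. 1 \<le> N \<and> (\<forall>\<theta>\<in>{c..d}. AE \<omega> in M. \<bar>\<xi> N \<omega>\<bar> \<le> \<delta> * sqrt (I N) \<longrightarrow>
      \<bar>sqrt (I N) * (estimator \<theta> N \<omega> - \<theta>) - \<xi> N \<omega>\<bar> < 1)) sequentially"
    using estimator_close[OF cd(1,2), of 1] by auto
  define \<delta>' where "\<delta>' = min \<delta> (\<epsilon> / 2)"
  have \<delta>': "0 < \<delta>'" "\<delta>' \<le> \<delta>" "\<delta>' \<le> \<epsilon> / 2" using \<delta>(1) \<epsilon> by (auto simp: \<delta>'_def)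
  have "eventually (\<lambda>N. 2 / \<epsilon> \<le> sqrt (I N)) sequentially"
    using sqrt_I_at_top by (simp add: filterlim_at_top)
  then show "eventually (\<lambda>N. \<forall>\<theta>\<in>B. emeasure M {\<omega> \<in> space M. \<bar>estimator \<theta> N \<omega> - \<theta>\<bar> > \<epsilon>} \<le> ennreal \<kappa>) sequentially"
    using \<delta>(2) \<xi>_tail_small[OF \<delta>'(1) \<kappa>]
  proof eventually_elim
    case (elim N)
    note [measurable] = \<xi>_measurable[of N]
    have s: "0 < sqrt (I N)" using I_pos elim by simp
    show ?case
    proof
      fix \<theta> assume "\<theta> \<in> B"
      then have "AE \<omega> in M. \<bar>\<xi> N \<omega>\<bar> \<le> \<delta> * sqrt (I N) \<longrightarrow> \<bar>sqrt (I N) * (estimator \<theta> N \<omega> - \<theta>) - \<xi> N \<omega>\<bar> < 1"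
        using elim cd by auto
      then have "AE \<omega> in M. \<bar>\<xi> N \<omega>\<bar> \<le> \<delta>' * sqrt (I N) \<longrightarrow> \<bar>estimator \<theta> N \<omega> - \<theta>\<bar> \<le> \<epsilon>"
      proof (rule eventually_mono, intro impI)
        fix \<omega> assume imp: "\<bar>\<xi> N \<omega>\<bar> \<le> \<delta> * sqrt (I N) \<longrightarrow> \<bar>sqrt (I N) * (estimator \<theta> N \<omega> - \<theta>) - \<xi> N \<omega>\<bar> < 1"
          and le: "\<bar>\<xi> N \<omega>\<bar> \<le> \<delta>' * sqrt (I N)"
        have "\<delta>' * sqrt (I N) \<le> \<delta> * sqrt (I N)" "\<delta>' * sqrt (I N) \<le> \<epsilon> / 2 * sqrt (I N)"
          using \<delta>' s by (intro mult_right_mono; simp)+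
        moreover have "1 \<le> \<epsilon> / 2 * sqrt (I N)" using elim(1) \<epsilon> by (simp add: field_simps)
        ultimately have "\<bar>sqrt (I N) * (estimator \<theta> N \<omega> - \<theta>)\<bar> \<le> \<epsilon> * sqrt (I N)" using imp le by linarith
        then show "\<bar>estimator \<theta> N \<omega> - \<theta>\<bar> \<le> \<epsilon>" using s by (simp add: abs_mult mult.commute)
      qed
      then have "emeasure M {\<omega> \<in> space M. \<bar>estimator \<theta> N \<omega> - \<theta>\<bar> > \<epsilon>}
          \<le> emeasure M {\<omega> \<in> space M. \<delta>' * sqrt (I N) < \<bar>\<xi> N \<omega>\<bar>}"
        using elim by (intro emeasure_mono_AE) (auto elim!: eventually_mono)
      then show "emeasure M {\<omega> \<in> space M. \<bar>estimator \<theta> N \<omega> - \<theta>\<bar> > \<epsilon>} \<le> ennreal \<kappa>"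
        using elim by auto
    qed
  qed
qed

theorem estimator_strongly_consistent:
  assumes \<theta>: "0 < \<theta>"
  shows "AE \<omega> in M. (\<lambda>N. estimator \<theta> N \<omega>) \<longlonglongrightarrow> \<theta>"
proof -
  have I_small: "AE \<omega> in M. eventually (\<lambda>N. \<bar>\<xi> N \<omega>\<bar> \<le> \<delta> * sqrt (I N)) sequentially" if \<delta>: "0 < \<delta>" for \<delta>
  proof -
    define A where "A N = (if 1 \<le> N then {\<omega> \<in> space M. \<delta> * sqrt (I N) < \<bar>\<xi> N \<omega>\<bar>} else {})" for N
    have A: "A N \<in> sets M" for N using \<xi>_measurable[of N] by (auto simp: A_def)
    have "eventually (\<lambda>N. norm (prob (A N)) \<le> 3 / \<delta> ^ 4 * (1 / real N ^ 2)) sequentially"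
      using I_growth eventually_ge_at_top[of 1]
    proof eventually_elim
      case (elim N)
      have I: "0 < I N" using I_pos elim by simp
      have "emeasure M (A N) \<le> ennreal (3 / (\<delta> * sqrt (I N)) ^ 4)"
        using elim \<delta> I by (auto simp: A_def intro!: std_normal_tail[OF prob_space_axioms \<xi>_normal])
      then have "prob (A N) \<le> 3 / (\<delta> * sqrt (I N)) ^ 4"
        by (simp add: emeasure_eq_measure)
      also have "(\<delta> * sqrt (I N)) ^ 4 = \<delta> ^ 4 * (I N)\<^sup>2"
      proof -
        have "sqrt (I N) ^ 4 = ((sqrt (I N))\<^sup>2)\<^sup>2" by simp
        then show ?thesis using I by (simp add: power_mult_distrib)
      qed
      also have "3 / (\<delta> ^ 4 * (I N)\<^sup>2) \<le> 3 / (\<delta> ^ 4 * (real N)\<^sup>2)"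
        using elim \<delta> I by (intro divide_left_mono mult_left_mono power_mono mult_pos_pos) auto
      finally show ?case by simp
    qed
    moreover have "summable (\<lambda>N. 3 / \<delta> ^ 4 * (1 / real N ^ 2))"
      using inverse_power_summable[of 2] by (intro summable_mult) (simp add: inverse_eq_divide)
    ultimately have "summable (\<lambda>N. prob (A N))" by (rule summable_comparison_test_ev)
    then have "AE \<omega> in M. eventually (\<lambda>N. \<omega> \<in> space M - A N) sequentially"
      using A by (intro borel_cantelli_AE1) (auto simp: emeasure_eq_measure)
    then show ?thesis
    proof (rule eventually_mono)
      fix \<omega> assume "eventually (\<lambda>N. \<omega> \<in> space M - A N) sequentially"
      then show "eventually (\<lambda>N. \<bar>\<xi> N \<omega>\<bar> \<le> \<delta> * sqrt (I N)) sequentially"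
        using eventually_ge_at_top[of 1] by eventually_elim (auto simp: A_def)
    qed
  qed
  obtain \<delta> N0 where \<delta>: "0 < \<delta>" and N0: "\<And>N. N0 \<le> N \<Longrightarrow> 1 \<le> N \<and> (AE \<omega> in M. \<bar>\<xi> N \<omega>\<bar> \<le> \<delta> * sqrt (I N) \<longrightarrow>
      \<bar>sqrt (I N) * (estimator \<theta> N \<omega> - \<theta>) - \<xi> N \<omega>\<bar> < 1)"
    using estimator_close[OF \<theta> order_refl, of 1] unfolding eventually_sequentially by auto
  have "AE \<omega> in M. \<forall>N. N0 \<le> N \<longrightarrow> \<bar>\<xi> N \<omega>\<bar> \<le> \<delta> * sqrt (I N) \<longrightarrow> \<bar>sqrt (I N) * (estimator \<theta> N \<omega> - \<theta>) - \<xi> N \<omega>\<bar> < 1"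
    using N0 by (subst AE_all_countable) auto
  moreover have "AE \<omega> in M. \<forall>m. eventually (\<lambda>N. \<bar>\<xi> N \<omega>\<bar> \<le> (1 / real (Suc m)) * sqrt (I N)) sequentially"
    by (subst AE_all_countable, intro allI I_small) simp
  moreover note I_small[OF \<delta>]
  ultimately show ?thesis
  proof eventually_elim
    case (elim \<omega>)
    show ?case
    proof (rule tendstoI)
      fix e :: real assume e: "0 < e"
      obtain m where m: "1 / real (Suc m) < e / 2" using e nat_approx_posE[of "e / 2"] by auto
      have "eventually (\<lambda>N. 2 / e \<le> sqrt (I N)) sequentially"
        using sqrt_I_at_top by (simp add: filterlim_at_top)
      then show "eventually (\<lambda>N. dist (estimator \<theta> N \<omega>) \<theta> < e) sequentially"
        using elim(2)[rule_format, of m] elim(3) eventually_ge_at_top[of "max 1 N0"]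
      proof eventually_elim
        fix N assume N: "2 / e \<le> sqrt (I N)" "\<bar>\<xi> N \<omega>\<bar> \<le> 1 / real (Suc m) * sqrt (I N)" "\<bar>\<xi> N \<omega>\<bar> \<le> \<delta> * sqrt (I N)" "max 1 N0 \<le> N"
        have s: "0 < sqrt (I N)" using I_pos N by simp
        have "\<bar>sqrt (I N) * (estimator \<theta> N \<omega> - \<theta>) - \<xi> N \<omega>\<bar> < 1" using elim(1) N by simp
        moreover have "1 / real (Suc m) * sqrt (I N) \<le> e / 2 * sqrt (I N)" using m s by (intro mult_right_mono) auto
        moreover have "1 \<le> e / 2 * sqrt (I N)" using N(1) e by (simp add: field_simps)
        ultimately have "\<bar>sqrt (I N) * (estimator \<theta> N \<omega> - \<theta>)\<bar> < e * sqrt (I N)" using N(2) by linarith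
        then show "dist (estimator \<theta> N \<omega>) \<theta> < e" using s by (simp add: abs_mult dist_real_def mult.commute)
      qed
    qed
  qed
qed

lemma \<xi>_integral:
  assumes N: "1 \<le> N" and g: "g \<in> borel_measurable borel"
  shows "(\<integral>\<omega>. g (\<xi> N \<omega>) \<partial>M) = (\<integral>x. (g x :: real) \<partial>std_normal_distribution)"
proof -
  have "\<xi> N \<in> M \<rightarrow>\<^sub>M lborel" "distr M lborel (\<xi> N) = std_normal_distribution"
    using \<xi>_normal[OF N] by (auto simp: distributed_def)
  then show ?thesis using integral_distr[of "\<xi> N" M lborel g] g by simp
qed

lemma \<xi>_nn_integral:
  assumes N: "1 \<le> N" and g: "g \<in> borel_measurable borel"
  shows "(\<integral>\<^sup>+\<omega>. g (\<xi> N \<omega>) \<partial>M) = (\<integral>\<^sup>+x. g x \<partial>std_normal_distribution)"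
proof -
  have "\<xi> N \<in> M \<rightarrow>\<^sub>M lborel" "distr M lborel (\<xi> N) = std_normal_distribution"
    using \<xi>_normal[OF N] by (auto simp: distributed_def)
  then show ?thesis using nn_integral_distr[of "\<xi> N" M lborel g] g by simp
qed

text \<open>As \<open>\<xi> N\<close> has exactly the limit law, only the difference between \<open>g\<close> at the normalized error and \<open>g\<close>
  at \<open>\<xi> N\<close> has to be controlled. It is small by uniform continuity of \<open>g\<close> on a compact interval and
  bounded on the exceptional events where \<open>\<xi> N\<close> or the remainder is large.\<close>

theorem estimator_asymptotically_normal:
  assumes B: "compact B" "B \<subseteq> {0<..}" and g: "continuous_on UNIV (g :: real \<Rightarrow> real)" "bounded (range g)"
  shows "(\<lambda>N. SUP \<theta>\<in>B. ennreal \<bar>(\<integral>\<omega>. g (sqrt (I N) * (estimator \<theta> N \<omega> - \<theta>)) \<partial>M)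
      - (\<integral>x. g x \<partial>std_normal_distribution)\<bar>) \<longlonglongrightarrow> 0"
proof (rule SUP_tendsto_zeroI)
  fix \<kappa> :: real assume \<kappa>: "0 < \<kappa>"
  have gm[measurable]: "g \<in> borel_measurable borel" using g(1) by (rule borel_measurable_continuous_onI)
  obtain G where G: "0 < G" "\<And>x. \<bar>g x\<bar> \<le> G" using g(2) by (auto simp: bounded_pos)
  obtain c d where cd: "0 < c" "c \<le> d" "B \<subseteq> {c..d}" using compact_pos_bounds[OF B] by blast
  \<comment> \<open>Two exceptional events, on each of which the integrand is at most \<open>2 G\<close>, use up \<open>\<kappa> / 2\<close>.\<close>
  define \<kappa>' where "\<kappa>' = \<kappa> / (8 * G)"
  have \<kappa>': "0 < \<kappa>'" using \<kappa> G by (simp add: \<kappa>'_def)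
  have "((\<lambda>a. 3 / a ^ 4) \<longlongrightarrow> (0::real)) at_top" by real_asymp
  then have "eventually (\<lambda>a. 3 / a ^ 4 < \<kappa>') at_top" using \<kappa>' by (rule order_tendstoD)
  then obtain A0 where A0: "\<And>a. A0 \<le> a \<Longrightarrow> 3 / a ^ 4 < \<kappa>'" by (auto simp: eventually_at_top_linorder)
  define A where "A = max 1 A0"
  have A: "1 \<le> A" "3 / A ^ 4 < \<kappa>'" using A0[of A] by (auto simp: A_def)
  have "uniformly_continuous_on {-A-1..A+1} g"
    by (intro compact_uniformly_continuous continuous_on_subset[OF g(1)]) auto
  then obtain \<eta>0 where \<eta>0: "0 < \<eta>0" "\<And>x y. x \<in> {-A-1..A+1} \<Longrightarrow> y \<in> {-A-1..A+1} \<Longrightarrow> \<bar>y - x\<bar> < \<eta>0 \<Longrightarrow> \<bar>g y - g x\<bar> < \<kappa> / 2"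
    using \<kappa> unfolding uniformly_continuous_on_def dist_real_def by (metis half_gt_zero)
  define \<eta> where "\<eta> = min \<eta>0 1"
  have \<eta>: "0 < \<eta>" "\<eta> \<le> \<eta>0" "\<eta> \<le> 1" using \<eta>0 by (auto simp: \<eta>_def)
  obtain \<delta> where \<delta>: "0 < \<delta>" "eventually (\<lambda>N. 1 \<le> N \<and> (\<forall>\<theta>\<in>{c..d}. AE \<omega> in M. \<bar>\<xi> N \<omega>\<bar> \<le> \<delta> * sqrt (I N) \<longrightarrow>
      \<bar>sqrt (I N) * (estimator \<theta> N \<omega> - \<theta>) - \<xi> N \<omega>\<bar> < \<eta>)) sequentially"
    using estimator_close[OF cd(1,2) \<eta>(1)] by blast
  show "eventually (\<lambda>N. \<forall>\<theta>\<in>B. ennreal \<bar>(\<integral>\<omega>. g (sqrt (I N) * (estimator \<theta> N \<omega> - \<theta>)) \<partial>M)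
      - (\<integral>x. g x \<partial>std_normal_distribution)\<bar> \<le> ennreal \<kappa>) sequentially"
    using \<delta>(2) \<xi>_tail_small[OF \<delta>(1) \<kappa>']
  proof eventually_elim
    case (elim N)
    then have N: "1 \<le> N" by simp
    note [measurable] = \<xi>_measurable[OF N]
    define E1 where "E1 = {\<omega> \<in> space M. A < \<bar>\<xi> N \<omega>\<bar>}"
    define E2 where "E2 = {\<omega> \<in> space M. \<delta> * sqrt (I N) < \<bar>\<xi> N \<omega>\<bar>}"
    have [measurable]: "E1 \<in> sets M" "E2 \<in> sets M" by (auto simp: E1_def E2_def)
    have "ennreal (prob E1) \<le> ennreal (3 / A ^ 4)"
      using std_normal_tail[OF prob_space_axioms \<xi>_normal[OF N], of A] A by (simp add: E1_def emeasure_eq_measure)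
    then have P1: "prob E1 \<le> \<kappa>'" using A by simp
    have P2: "prob E2 \<le> \<kappa>'" using elim \<kappa>' by (simp add: E2_def emeasure_eq_measure)
    show ?case
    proof
      fix \<theta> assume \<theta>: "\<theta> \<in> B"
      then have "0 < \<theta>" using B by auto
      note [measurable] = estimator_measurable[OF this N]
      define Z where "Z \<omega> = sqrt (I N) * (estimator \<theta> N \<omega> - \<theta>)" for \<omega>
      have [measurable]: "Z \<in> borel_measurable M" unfolding Z_def by measurable
      have int: "integrable M (\<lambda>\<omega>. g (X \<omega>))" if [measurable]: "X \<in> borel_measurable M" for X
        using G by (intro integrable_const_bound[of _ G]) auto
      have close: "AE \<omega> in M. \<bar>\<xi> N \<omega>\<bar> \<le> \<delta> * sqrt (I N) \<longrightarrow> \<bar>Z \<omega> - \<xi> N \<omega>\<bar> < \<eta>"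
        using elim cd \<theta> by (auto simp: Z_def)
      have bound: "AE \<omega> in M. \<bar>g (Z \<omega>) - g (\<xi> N \<omega>)\<bar> \<le> \<kappa> / 2 + 2 * G * (indicator E1 \<omega> + indicator E2 \<omega>)"
        using close AE_space
      proof eventually_elim
        case (elim \<omega>)
        show ?case
        proof (cases "\<omega> \<in> E1 \<or> \<omega> \<in> E2")
          case True
          then have "1 \<le> (indicator E1 \<omega> + indicator E2 \<omega> :: real)" by (auto simp: indicator_def)
          then have "2 * G * 1 \<le> 2 * G * (indicator E1 \<omega> + indicator E2 \<omega>)" using G by (intro mult_left_mono) auto
          moreover have "\<bar>g (Z \<omega>) - g (\<xi> N \<omega>)\<bar> \<le> 2 * G" using G(2)[of "Z \<omega>"] G(2)[of "\<xi> N \<omega>"] by linarith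
          ultimately show ?thesis using \<kappa> by linarith
        next
          case False
          then have "\<bar>\<xi> N \<omega>\<bar> \<le> A" "\<bar>Z \<omega> - \<xi> N \<omega>\<bar> < \<eta>" using elim by (auto simp: E1_def E2_def)
          then have "\<bar>g (Z \<omega>) - g (\<xi> N \<omega>)\<bar> < \<kappa> / 2" using \<eta> by (intro \<eta>0(2)) auto
          then show ?thesis using False by simp
        qed
      qed
      have "\<bar>(\<integral>\<omega>. g (Z \<omega>) \<partial>M) - (\<integral>x. g x \<partial>std_normal_distribution)\<bar> = \<bar>\<integral>\<omega>. g (Z \<omega>) - g (\<xi> N \<omega>) \<partial>M\<bar>"
        by (subst \<xi>_integral[OF N gm, symmetric], subst Bochner_Integration.integral_diff) (auto intro!: int)
      also have "\<dots> \<le> (\<integral>\<omega>. \<bar>g (Z \<omega>) - g (\<xi> N \<omega>)\<bar> \<partial>M)" by (rule integral_abs_bound)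
      also have "\<dots> \<le> (\<integral>\<omega>. \<kappa> / 2 + 2 * G * (indicator E1 \<omega> + indicator E2 \<omega>) \<partial>M)"
        using bound by (intro integral_mono_AE) (auto intro!: int Bochner_Integration.integrable_diff Bochner_Integration.integrable_abs simp: emeasure_eq_measure)
      also have "\<dots> = \<kappa> / 2 + 2 * G * (prob E1 + prob E2)"
        by (simp add: emeasure_eq_measure prob_space)
      also have "\<dots> \<le> \<kappa> / 2 + 2 * G * (\<kappa>' + \<kappa>')"
        using P1 P2 G by (intro add_left_mono mult_left_mono add_mono) auto
      also have "\<dots> = \<kappa>" using G by (simp add: \<kappa>'_def)
      finally show "ennreal \<bar>(\<integral>\<omega>. g (sqrt (I N) * (estimator \<theta> N \<omega> - \<theta>)) \<partial>M) - (\<integral>x. g x \<partial>std_normal_distribution)\<bar> \<le> ennreal \<kappa>"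
        by (simp add: Z_def ennreal_leI)
    qed
  qed
qed

end

section \<open>Risks under the uniform prior\<close>

text \<open>Polynomials are dominated by \<open>exp \<bar>x\<bar>\<close> through its power series, and \<open>\<bar>x\<bar> \<le> \<kappa> x\<^sup>2 + 1 / (4 \<kappa>)\<close>.\<close>

lemma W_p_subgaussian:
  assumes v: "v \<in> W_p" and \<kappa>: "0 < \<kappa>"
  shows "\<exists>C>0. \<forall>x. v x \<le> C * exp (\<kappa> * x\<^sup>2)"
proof -
  have W: "v \<in> W_loss" using v by (simp add: W_p_def)
  obtain p :: "real poly" where "eventually (\<lambda>x. v x \<le> poly p x) at_infinity"
    using v by (auto simp: W_p_def)
  then obtain A0 where A0: "\<And>x. A0 \<le> \<bar>x\<bar> \<Longrightarrow> v x \<le> poly p x" by (auto simp: eventually_at_infinity)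
  define P where "P = (\<Sum>i\<le>degree p. \<bar>coeff p i\<bar> * fact i)"
  have poly: "poly p x \<le> P * exp \<bar>x\<bar>" for x
  proof -
    have "poly p x = (\<Sum>i\<le>degree p. coeff p i * x ^ i)" by (rule poly_altdef)
    also have "\<dots> \<le> (\<Sum>i\<le>degree p. \<bar>coeff p i\<bar> * fact i * exp \<bar>x\<bar>)"
    proof (rule sum_mono)
      fix i
      have "\<bar>x\<bar> ^ i / fact i \<le> exp \<bar>x\<bar>"
      proof -
        have "(\<Sum>n\<in>{i}. \<bar>x\<bar> ^ n /\<^sub>R fact n) \<le> (\<Sum>n. \<bar>x\<bar> ^ n /\<^sub>R fact n)"
          by (intro sum_le_suminf summable_exp_generic) auto
        then show ?thesis by (simp add: exp_def divide_inverse mult.commute)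
      qed
      then have "\<bar>x ^ i\<bar> \<le> fact i * exp \<bar>x\<bar>" by (simp add: divide_le_eq mult.commute power_abs)
      then have "\<bar>coeff p i\<bar> * \<bar>x ^ i\<bar> \<le> \<bar>coeff p i\<bar> * (fact i * exp \<bar>x\<bar>)" by (intro mult_left_mono) auto
      then show "coeff p i * x ^ i \<le> \<bar>coeff p i\<bar> * fact i * exp \<bar>x\<bar>"
        using abs_ge_self[of "coeff p i * x ^ i"] by (simp add: abs_mult mult.assoc)
    qed
    finally show ?thesis by (simp add: P_def sum_distrib_right)
  qed
  have P0: "0 \<le> P" unfolding P_def by (intro sum_nonneg) auto
  define E where "E = exp (1 / (4 * \<kappa>))"
  have ex: "exp \<bar>x\<bar> \<le> E * exp (\<kappa> * x\<^sup>2)" for x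
  proof -
    have "0 \<le> \<kappa> * (\<bar>x\<bar> - 1 / (2 * \<kappa>))\<^sup>2" using \<kappa> by simp
    also have "\<dots> = \<kappa> * x\<^sup>2 - \<bar>x\<bar> + 1 / (4 * \<kappa>)" using \<kappa> by (simp add: power2_diff field_simps power2_eq_square)
    finally show ?thesis by (simp add: E_def exp_add[symmetric])
  qed
  have "v x \<le> (P * E + v A0 + 1) * exp (\<kappa> * x\<^sup>2)" for x
  proof (cases "A0 \<le> \<bar>x\<bar>")
    case True
    have "v x \<le> P * exp \<bar>x\<bar>" using A0[OF True] poly[of x] by simp
    also have "\<dots> \<le> P * (E * exp (\<kappa> * x\<^sup>2))" by (intro mult_left_mono ex P0)
    also have "\<dots> = (P * E) * exp (\<kappa> * x\<^sup>2)" by simp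
    also have "\<dots> \<le> (P * E + v A0 + 1) * exp (\<kappa> * x\<^sup>2)"
      using W_loss_nonneg[OF W, of A0] by (intro mult_right_mono) auto
    finally show ?thesis .
  next
    case False
    then have "v x \<le> v A0" using W_loss_mono[OF W, of x A0] by simp
    also have "\<dots> \<le> (P * E + v A0 + 1) * 1" using P0 by (simp add: E_def)
    also have "\<dots> \<le> (P * E + v A0 + 1) * exp (\<kappa> * x\<^sup>2)"
      using W_loss_nonneg[OF W, of A0] P0 \<kappa> by (intro mult_left_mono) (auto simp: E_def intro!: add_nonneg_nonneg)
    finally show ?thesis .
  qed
  moreover have "0 < P * E + v A0 + 1"
    using P0 W_loss_nonneg[OF W, of A0] by (simp add: E_def add_nonneg_pos)
  ultimately show ?thesis by blast
qed

lemma nn_integral_std_normal_shifted_finite: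
  assumes v: "v \<in> W_p"
  shows "(\<integral>\<^sup>+x. ennreal (v (c + \<bar>x\<bar>)) \<partial>std_normal_distribution) < \<infinity>"
proof -
  have W: "v \<in> W_loss" using v by (simp add: W_p_def)
  note [measurable] = W_loss_measurable[OF W]
  obtain C where C: "0 < C" "\<And>x. v x \<le> C * exp (1/8 * x\<^sup>2)" using W_p_subgaussian[OF v, of "1/8"] by auto
  define D where "D = C * exp (c\<^sup>2 / 4) * (1 / sqrt (2 * pi))"
  have D: "0 \<le> D" using C by (simp add: D_def)
  have pt: "std_normal_density x * v (c + \<bar>x\<bar>) \<le> D * exp (- (x\<^sup>2 / 4))" for x
  proof -
    have "(c + \<bar>x\<bar>)\<^sup>2 \<le> 2 * c\<^sup>2 + 2 * x\<^sup>2"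
      using zero_le_power2[of "c - \<bar>x\<bar>"] by (simp add: power2_sum power2_diff)
    then have ex: "1/8 * (c + \<bar>x\<bar>)\<^sup>2 + - x\<^sup>2 / 2 \<le> c\<^sup>2 / 4 + - (x\<^sup>2 / 4)" by simp
    have "std_normal_density x * v (c + \<bar>x\<bar>) \<le> std_normal_density x * (C * exp (1/8 * (c + \<bar>x\<bar>)\<^sup>2))"
      by (intro mult_left_mono C) auto
    also have "\<dots> = C * (1 / sqrt (2 * pi)) * exp (1/8 * (c + \<bar>x\<bar>)\<^sup>2 + - x\<^sup>2 / 2)"
      unfolding std_normal_density_def exp_add by (simp add: mult_ac)
    also have "\<dots> \<le> C * (1 / sqrt (2 * pi)) * exp (c\<^sup>2 / 4 + - (x\<^sup>2 / 4))"
      using ex C by (intro mult_left_mono) auto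
    also have "\<dots> = D * exp (- (x\<^sup>2 / 4))" by (simp only: D_def exp_add mult_ac)
    finally show ?thesis .
  qed
  have "(\<integral>\<^sup>+x. ennreal (v (c + \<bar>x\<bar>)) \<partial>std_normal_distribution)
      = (\<integral>\<^sup>+x. ennreal (std_normal_density x * v (c + \<bar>x\<bar>)) \<partial>lborel)"
    by (subst nn_integral_density) (auto simp: ennreal_mult')
  also have "\<dots> \<le> (\<integral>\<^sup>+x. ennreal (D * exp (- (x\<^sup>2 / 4))) \<partial>lborel)"
    by (intro nn_integral_mono ennreal_leI pt)
  also have "\<dots> = ennreal (sqrt 2) * (\<integral>\<^sup>+t. ennreal (D * exp (- (t\<^sup>2 / 2))) \<partial>lborel)"
    by (subst nn_integral_real_affine[where c = "sqrt 2" and t = 0]) (auto simp: power_mult_distrib)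
  also have "\<dots> = ennreal (sqrt 2) * (ennreal D * ennreal (sqrt (2 * pi)))"
    using D by (simp add: ennreal_mult' nn_integral_cmult nn_integral_gaussian)
  also have "\<dots> < \<infinity>" by (simp add: ennreal_mult_less_top)
  finally show ?thesis .
qed

lemma W_loss_AE_isCont:
  assumes v: "v \<in> W_loss"
  shows "AE x in std_normal_distribution. isCont v \<bar>x\<bar>"
proof -
  define f where "f x = v (max 0 x)" for x
  have "mono f"
    unfolding f_def by (intro monoI W_loss_mono[OF v]) auto
  then have "countable {a. \<not> isCont f a}" by (rule mono_ctble_discont)
  moreover have "{x. \<not> isCont v \<bar>x\<bar>} \<subseteq> {a. \<not> isCont f a} \<union> uminus ` {a. \<not> isCont f a}"
  proof
    fix x assume x: "x \<in> {x. \<not> isCont v \<bar>x\<bar>}"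
    have "v = (\<lambda>y. f \<bar>y\<bar>)" by (simp add: fun_eq_iff f_def W_loss_abs[OF v])
    moreover have "isCont (\<lambda>y. f \<bar>y\<bar>) \<bar>x\<bar>" if "isCont f \<bar>x\<bar>"
    proof (rule isCont_o2[where f = abs])
      show "isCont abs \<bar>x\<bar>" by (intro continuous_intros)
    qed (use that in simp)
    ultimately have "\<not> isCont f \<bar>x\<bar>" using x by (metis mem_Collect_eq)
    then show "x \<in> {a. \<not> isCont f a} \<union> uminus ` {a. \<not> isCont f a}"
    proof (cases "0 \<le> x")
      case False
      then have "- x \<in> {a. \<not> isCont f a}" using \<open>\<not> isCont f \<bar>x\<bar>\<close> by simp
      then have "- (- x) \<in> uminus ` {a. \<not> isCont f a}" by (rule imageI)
      then show ?thesis by simp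
    qed simp
  qed
  ultimately have "countable {x. \<not> isCont v \<bar>x\<bar>}"
    by (meson countable_Un countable_image countable_subset)
  then have "AE x in lborel. x \<notin> {x. \<not> isCont v \<bar>x\<bar>}"
    by (intro AE_not_in countable_imp_null_set_lborel)
  then have "AE x in lborel. isCont v \<bar>x\<bar>" by simp
  then show ?thesis by (subst AE_density) auto
qed

text \<open>A loss may jump, but being monotone it does so only at countably many points, which the normal law
  does not charge.\<close>

lemma std_normal_risk_continuous:
  assumes v: "v \<in> W_p" and h: "h \<longlonglongrightarrow> 0" "\<And>n::nat. \<bar>h n\<bar> \<le> 1"
  shows "(\<lambda>n. \<integral>\<^sup>+x. ennreal (v (max 0 (\<bar>x\<bar> + h n))) \<partial>std_normal_distribution)
    \<longlonglongrightarrow> (\<integral>\<^sup>+x. ennreal (v x) \<partial>std_normal_distribution)"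
proof (rule nn_integral_dominated_convergence)
  have W: "v \<in> W_loss" using v by (simp add: W_p_def)
  note [measurable] = W_loss_measurable[OF W]
  show "(\<lambda>x. ennreal (v (max 0 (\<bar>x\<bar> + h n)))) \<in> borel_measurable std_normal_distribution" for n by measurable
  show "(\<lambda>x. ennreal (v x)) \<in> borel_measurable std_normal_distribution" by measurable
  show "(\<lambda>x. ennreal (v (1 + \<bar>x\<bar>))) \<in> borel_measurable std_normal_distribution" by measurable
  have "v (max 0 (\<bar>x\<bar> + h n)) \<le> v (1 + \<bar>x\<bar>)" for n x
    using h(2)[of n] by (intro W_loss_mono[OF W]) (auto simp: max_def)
  then show "AE x in std_normal_distribution. ennreal (v (max 0 (\<bar>x\<bar> + h n))) \<le> ennreal (v (1 + \<bar>x\<bar>))" for n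
    by (intro AE_I2 ennreal_leI)
  show "(\<integral>\<^sup>+x. ennreal (v (1 + \<bar>x\<bar>)) \<partial>std_normal_distribution) < \<infinity>"
    by (rule nn_integral_std_normal_shifted_finite[OF v])
  show "AE x in std_normal_distribution. (\<lambda>n. ennreal (v (max 0 (\<bar>x\<bar> + h n)))) \<longlonglongrightarrow> ennreal (v x)"
    using W_loss_AE_isCont[OF W]
  proof (rule eventually_mono)
    fix x :: real assume c: "isCont v \<bar>x\<bar>"
    have "(\<lambda>n. max 0 (\<bar>x\<bar> + h n)) \<longlonglongrightarrow> max 0 (\<bar>x\<bar> + 0)" by (intro tendsto_intros h)
    then have "(\<lambda>n. max 0 (\<bar>x\<bar> + h n)) \<longlonglongrightarrow> \<bar>x\<bar>" by simp
    from isCont_tendsto_compose[OF c this] have "(\<lambda>n. v (max 0 (\<bar>x\<bar> + h n))) \<longlonglongrightarrow> v x"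
      by (simp add: W_loss_abs[OF W])
    then show "(\<lambda>n. ennreal (v (max 0 (\<bar>x\<bar> + h n)))) \<longlonglongrightarrow> ennreal (v x)" by (rule tendsto_ennrealI)
  qed
qed

lemma nn_integral_truncation_limits:
  fixes f :: "real \<Rightarrow> ennreal" and a :: "nat \<Rightarrow> real"
  assumes f: "f \<in> borel_measurable \<mu>" and fin: "(\<integral>\<^sup>+x. f x \<partial>\<mu>) < \<infinity>" and a: "filterlim a at_top sequentially"
    and sets: "sets \<mu> = sets borel"
  shows "(\<lambda>n. \<integral>\<^sup>+x. f x * indicator {x. \<bar>x\<bar> < a n} x \<partial>\<mu>) \<longlonglongrightarrow> (\<integral>\<^sup>+x. f x \<partial>\<mu>)"
    and "(\<lambda>n. \<integral>\<^sup>+x. f x * indicator {x. a n \<le> \<bar>x\<bar>} x \<partial>\<mu>) \<longlonglongrightarrow> 0"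
proof -
  note [measurable] = f
  note [measurable_cong] = sets
  have ev: "eventually (\<lambda>n. \<bar>x\<bar> < a n) sequentially" for x
    using a by (simp add: filterlim_at_top_dense)
  show "(\<lambda>n. \<integral>\<^sup>+x. f x * indicator {x. \<bar>x\<bar> < a n} x \<partial>\<mu>) \<longlonglongrightarrow> (\<integral>\<^sup>+x. f x \<partial>\<mu>)"
  proof (rule nn_integral_dominated_convergence[OF _ _ f _ fin])
    show "AE x in \<mu>. (\<lambda>n. f x * indicator {x. \<bar>x\<bar> < a n} x) \<longlonglongrightarrow> f x"
    proof (rule AE_I2)
      fix x
      show "(\<lambda>n. f x * indicator {x. \<bar>x\<bar> < a n} x) \<longlonglongrightarrow> f x"
        by (intro tendsto_eventually eventually_mono[OF ev[of x]]) simp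
    qed
  qed (auto simp: indicator_def)
  have "(\<lambda>n. \<integral>\<^sup>+x. f x * indicator {x. a n \<le> \<bar>x\<bar>} x \<partial>\<mu>) \<longlonglongrightarrow> (\<integral>\<^sup>+x. 0 \<partial>\<mu>)"
  proof (rule nn_integral_dominated_convergence[OF _ _ f _ fin])
    show "AE x in \<mu>. (\<lambda>n. f x * indicator {x. a n \<le> \<bar>x\<bar>} x) \<longlonglongrightarrow> 0"
    proof (rule AE_I2)
      fix x
      show "(\<lambda>n. f x * indicator {x. a n \<le> \<bar>x\<bar>} x) \<longlonglongrightarrow> 0"
        by (intro tendsto_eventually eventually_mono[OF ev[of x]]) simp
    qed
  qed (auto simp: indicator_def)
  then show "(\<lambda>n. \<integral>\<^sup>+x. f x * indicator {x. a n \<le> \<bar>x\<bar>} x \<partial>\<mu>) \<longlonglongrightarrow> 0" by simp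
qed

context normal_location_experiment
begin

text \<open>In terms of \<open>y = sqrt (I N) * \<theta> + \<xi> N\<close>, the observed value scaled by \<open>sqrt (I N)\<close>: if \<open>y > \<Lambda>\<close>, the
  estimate is localized at the observation. Otherwise monotonicity gives the upper bound at
  \<open>y = \<Lambda> + 1\<close>, while the lower bound is positivity of the estimate; since then
  \<open>sqrt (I N) * \<theta> \<le> \<Lambda> - \<xi> N\<close>, both are controlled by \<open>\<xi> N\<close> alone.\<close>

lemma uniform_prior_estimator_bounds:
  assumes unif: "\<forall>\<theta>>0. \<rho> \<theta> = 1" and \<epsilon>: "0 < \<epsilon>" "\<epsilon> \<le> 1"
    and \<Lambda>: "0 < \<Lambda>" "gaussian_risk l 0 < truncated_risk l \<Lambda> \<epsilon>" and \<theta>: "0 < \<theta>" and N: "1 \<le> N"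
  shows "AE \<omega> in M.
      (\<Lambda> < sqrt (I N) * \<theta> + \<xi> N \<omega> \<longrightarrow> \<bar>sqrt (I N) * (estimator \<theta> N \<omega> - \<theta>) - \<xi> N \<omega>\<bar> < \<epsilon>) \<and>
      (sqrt (I N) * \<theta> + \<xi> N \<omega> \<le> \<Lambda> \<longrightarrow> \<bar>sqrt (I N) * (estimator \<theta> N \<omega> - \<theta>)\<bar> \<le> \<Lambda> + 2 + \<bar>\<xi> N \<omega>\<bar>)"
  using \<theta>h_eq[OF N, of \<theta>] well_defined[OF \<theta> N]
proof eventually_elim
  case (elim \<omega>)
  define s where "s = sqrt (I N)"
  have I: "0 < I N" and s: "0 < s" using I_pos[OF N] by (auto simp: s_def)
  have ext: "extended_prior \<rho> = indicator {0<..}"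
    by (auto simp: extended_prior_def fun_eq_iff indicator_def unif)
  define x where "x = \<theta>h \<theta> N \<omega>"
  have x: "x = \<theta> + \<xi> N \<omega> / s" "s * x = s * \<theta> + \<xi> N \<omega>"
    using elim(1) s by (auto simp: x_def s_def algebra_simps)
  have wd: "bayes_well_defined \<rho> l (I N) x" using elim(2) by (simp add: x_def)
  define b where "b = bayes_estimate \<rho> l (I N) x"
  have est: "estimator \<theta> N \<omega> = b" by (simp add: estimator_def b_def x_def)
  have loc: "scaled_risk (extended_prior \<rho>) l s y 0 < scaled_risk (extended_prior \<rho>) l s y r"
    if "\<Lambda> < s * y" "\<epsilon> \<le> \<bar>r\<bar>" for y r
    unfolding ext using that \<epsilon> by (intro uniform_prior_risk_localization[OF loss_W _ _ s _ \<Lambda>(2)]) auto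
  have "\<bar>s * (b - \<theta>) - \<xi> N \<omega>\<bar> < \<epsilon>" if far: "\<Lambda> < s * \<theta> + \<xi> N \<omega>"
  proof -
    have "0 < s * x" using far x(2) \<Lambda> by simp
    then have x0: "0 < x" using s by (simp add: zero_less_mult_iff)
    have "\<bar>s * (b - x)\<bar> < \<epsilon>"
      unfolding b_def s_def using far x(2)
      by (intro bayes_estimate_localized[OF prior loss_W wd I x0 \<epsilon>(1)] loc[unfolded s_def]) (auto simp: s_def)
    then show ?thesis using x(2) by (simp add: algebra_simps)
  qed
  moreover have "\<bar>s * (b - \<theta>)\<bar> \<le> \<Lambda> + 2 + \<bar>\<xi> N \<omega>\<bar>" if near: "s * \<theta> + \<xi> N \<omega> \<le> \<Lambda>"
  proof -
    \<comment> \<open>Any point with \<open>s x0 > \<Lambda>\<close> would do; it only has to be fixed on the scale \<open>1 / s\<close>.\<close>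
    define x0 where "x0 = (\<Lambda> + 1) / s"
    have sx0: "s * x0 = \<Lambda> + 1" using s by (simp add: x0_def)
    have "s * x \<le> s * x0" using near x(2) sx0 by simp
    then have x_le: "x \<le> x0" using s by simp
    have "0 < x0" using s \<Lambda> by (simp add: x0_def)
    then have "s * b < s * x0 + \<epsilon>"
      unfolding b_def s_def using sx0
      by (intro bayes_estimate_upper_bound[OF prior loss_W wd I x_le _ \<epsilon>(1)] loc[unfolded s_def]) (auto simp: s_def)
    moreover have "0 < s * b" using bayes_estimate_minimizes(1)[OF prior loss_W wd] s by (simp add: b_def)
    moreover have "0 < s * \<theta>" using s \<theta> by simp
    ultimately have "\<bar>s * b - s * \<theta>\<bar> \<le> \<Lambda> + 2 + \<bar>\<xi> N \<omega>\<bar>" using near sx0 \<epsilon> by linarith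
    then show ?thesis by (simp add: algebra_simps)
  qed
  ultimately show ?case unfolding est s_def[symmetric] by blast
qed

text \<open>The normalized error is within \<open>\<epsilon>\<close> of \<open>\<xi> N\<close> unless \<open>\<bar>\<xi> N\<bar>\<close> exceeds a threshold that tends to infinity,
  and beyond the threshold it is dominated by \<open>\<Lambda> + 2 + \<bar>\<xi> N\<bar>\<close>. Both bounds are integrals over the
  standard normal law and are uniform over parameters \<open>\<theta> \<ge> \<theta>'\<close>.\<close>

lemma uniform_prior_risk_bounds:
  assumes unif: "\<forall>\<theta>>0. \<rho> \<theta> = 1" and \<epsilon>: "0 < \<epsilon>" "\<epsilon> \<le> 1"
    and \<Lambda>: "0 < \<Lambda>" "gaussian_risk l 0 < truncated_risk l \<Lambda> \<epsilon>" and N: "1 \<le> N"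
    and \<theta>: "0 < \<theta>'" "\<theta>' \<le> \<theta>" and v: "v \<in> W_p"
  defines "a \<equiv> \<theta>' * sqrt (I N) - \<Lambda>"
  shows "(\<integral>\<^sup>+\<omega>. ennreal (v (sqrt (I N) * (estimator \<theta> N \<omega> - \<theta>))) \<partial>M)
      \<le> (\<integral>\<^sup>+x. ennreal (v (max 0 (\<bar>x\<bar> + \<epsilon>))) \<partial>std_normal_distribution)
        + (\<integral>\<^sup>+x. ennreal (v (\<Lambda> + 2 + \<bar>x\<bar>)) * indicator {x. a \<le> \<bar>x\<bar>} x \<partial>std_normal_distribution)"
    and "(\<integral>\<^sup>+x. ennreal (v (max 0 (\<bar>x\<bar> + - \<epsilon>))) * indicator {x. \<bar>x\<bar> < a} x \<partial>std_normal_distribution)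
      \<le> (\<integral>\<^sup>+\<omega>. ennreal (v (sqrt (I N) * (estimator \<theta> N \<omega> - \<theta>))) \<partial>M)"
proof -
  have W: "v \<in> W_loss" using v by (simp add: W_p_def)
  note [measurable] = W_loss_measurable[OF W] \<xi>_measurable[OF N]
  have \<theta>0: "0 < \<theta>" using \<theta> by simp
  have "0 < sqrt (I N)" using I_pos[OF N] by simp
  then have a_le: "a \<le> sqrt (I N) * \<theta> - \<Lambda>" using \<theta> by (simp add: a_def mult.commute)
  define Z where "Z \<omega> = sqrt (I N) * (estimator \<theta> N \<omega> - \<theta>)" for \<omega>
  have close: "AE \<omega> in M. (\<bar>\<xi> N \<omega>\<bar> < a \<longrightarrow> \<bar>Z \<omega> - \<xi> N \<omega>\<bar> < \<epsilon>) \<and>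
      (\<bar>Z \<omega> - \<xi> N \<omega>\<bar> < \<epsilon> \<or> (a \<le> \<bar>\<xi> N \<omega>\<bar> \<and> \<bar>Z \<omega>\<bar> \<le> \<Lambda> + 2 + \<bar>\<xi> N \<omega>\<bar>))"
    using uniform_prior_estimator_bounds[OF unif \<epsilon> \<Lambda> \<theta>0 N]
    by eventually_elim (use a_le in \<open>auto simp: Z_def abs_if split: if_splits\<close>)
  let ?u = "\<lambda>x. ennreal (v (max 0 (\<bar>x\<bar> + \<epsilon>))) + ennreal (v (\<Lambda> + 2 + \<bar>x\<bar>)) * indicator {x. a \<le> \<bar>x\<bar>} x"
  let ?l = "\<lambda>x. ennreal (v (max 0 (\<bar>x\<bar> + - \<epsilon>))) * indicator {x. \<bar>x\<bar> < a} x"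
  have "(\<integral>\<^sup>+\<omega>. ennreal (v (Z \<omega>)) \<partial>M) \<le> (\<integral>\<^sup>+\<omega>. ?u (\<xi> N \<omega>) \<partial>M)"
  proof (rule nn_integral_mono_AE, use close in eventually_elim)
    fix \<omega> assume *: "(\<bar>\<xi> N \<omega>\<bar> < a \<longrightarrow> \<bar>Z \<omega> - \<xi> N \<omega>\<bar> < \<epsilon>) \<and>
      (\<bar>Z \<omega> - \<xi> N \<omega>\<bar> < \<epsilon> \<or> (a \<le> \<bar>\<xi> N \<omega>\<bar> \<and> \<bar>Z \<omega>\<bar> \<le> \<Lambda> + 2 + \<bar>\<xi> N \<omega>\<bar>))"
    then consider "\<bar>Z \<omega> - \<xi> N \<omega>\<bar> < \<epsilon>" | "a \<le> \<bar>\<xi> N \<omega>\<bar>" "\<bar>Z \<omega>\<bar> \<le> \<Lambda> + 2 + \<bar>\<xi> N \<omega>\<bar>" by blast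
    then show "ennreal (v (Z \<omega>)) \<le> ?u (\<xi> N \<omega>)"
    proof cases
      case 1
      then have "v (Z \<omega>) \<le> v (max 0 (\<bar>\<xi> N \<omega>\<bar> + \<epsilon>))" using \<epsilon> by (intro W_loss_mono[OF W]) auto
      then show ?thesis by (intro add_increasing2 ennreal_leI) auto
    next
      case 2
      then have "v (Z \<omega>) \<le> v (\<Lambda> + 2 + \<bar>\<xi> N \<omega>\<bar>)" using \<Lambda> by (intro W_loss_mono[OF W]) auto
      then show ?thesis using 2 by (intro add_increasing) (auto intro: ennreal_leI)
    qed
  qed
  also have "\<dots> = (\<integral>\<^sup>+x. ?u x \<partial>std_normal_distribution)" by (rule \<xi>_nn_integral[OF N]) measurable
  also have "\<dots> = (\<integral>\<^sup>+x. ennreal (v (max 0 (\<bar>x\<bar> + \<epsilon>))) \<partial>std_normal_distribution)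
        + (\<integral>\<^sup>+x. ennreal (v (\<Lambda> + 2 + \<bar>x\<bar>)) * indicator {x. a \<le> \<bar>x\<bar>} x \<partial>std_normal_distribution)"
    by (rule nn_integral_add) measurable
  finally show "(\<integral>\<^sup>+\<omega>. ennreal (v (sqrt (I N) * (estimator \<theta> N \<omega> - \<theta>))) \<partial>M)
      \<le> (\<integral>\<^sup>+x. ennreal (v (max 0 (\<bar>x\<bar> + \<epsilon>))) \<partial>std_normal_distribution)
        + (\<integral>\<^sup>+x. ennreal (v (\<Lambda> + 2 + \<bar>x\<bar>)) * indicator {x. a \<le> \<bar>x\<bar>} x \<partial>std_normal_distribution)"
    unfolding Z_def .
  have "(\<integral>\<^sup>+x. ?l x \<partial>std_normal_distribution) = (\<integral>\<^sup>+\<omega>. ?l (\<xi> N \<omega>) \<partial>M)"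
    by (rule \<xi>_nn_integral[OF N, symmetric]) measurable
  also have "\<dots> \<le> (\<integral>\<^sup>+\<omega>. ennreal (v (Z \<omega>)) \<partial>M)"
  proof (rule nn_integral_mono_AE, use close in eventually_elim)
    fix \<omega> assume *: "(\<bar>\<xi> N \<omega>\<bar> < a \<longrightarrow> \<bar>Z \<omega> - \<xi> N \<omega>\<bar> < \<epsilon>) \<and>
      (\<bar>Z \<omega> - \<xi> N \<omega>\<bar> < \<epsilon> \<or> (a \<le> \<bar>\<xi> N \<omega>\<bar> \<and> \<bar>Z \<omega>\<bar> \<le> \<Lambda> + 2 + \<bar>\<xi> N \<omega>\<bar>))"
    show "?l (\<xi> N \<omega>) \<le> ennreal (v (Z \<omega>))"
    proof (cases "\<bar>\<xi> N \<omega>\<bar> < a")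
      case True
      then have "v (max 0 (\<bar>\<xi> N \<omega>\<bar> + - \<epsilon>)) \<le> v (Z \<omega>)" using * by (intro W_loss_mono[OF W]) auto
      then show ?thesis using True by (simp add: ennreal_leI)
    qed simp
  qed
  finally show "(\<integral>\<^sup>+x. ennreal (v (max 0 (\<bar>x\<bar> + - \<epsilon>))) * indicator {x. \<bar>x\<bar> < a} x \<partial>std_normal_distribution)
      \<le> (\<integral>\<^sup>+\<omega>. ennreal (v (sqrt (I N) * (estimator \<theta> N \<omega> - \<theta>))) \<partial>M)"
    unfolding Z_def .
qed

lemma uniform_prior_risk_tendsto:
  assumes unif: "\<forall>\<theta>>0. \<rho> \<theta> = 1" and v: "v \<in> W_p" and \<delta>: "0 < \<delta>" "\<delta> < \<theta>0"
  shows "(\<lambda>N. SUP \<theta>\<in>{\<theta>. \<theta> > 0 \<and> \<bar>\<theta> - \<theta>0\<bar> < \<delta>}. \<integral>\<^sup>+\<omega>. ennreal (v (sqrt (I N) * (estimator \<theta> N \<omega> - \<theta>))) \<partial>M)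
     \<longlonglongrightarrow> (\<integral>\<^sup>+x. ennreal (v x) \<partial>std_normal_distribution)"
    (is "?S \<longlonglongrightarrow> ?V")
proof -
  have W: "v \<in> W_loss" using v by (simp add: W_p_def)
  note [measurable] = W_loss_measurable[OF W]
  define \<epsilon> where "\<epsilon> n = 1 / real (Suc n)" for n
  have \<epsilon>: "0 < \<epsilon> n" "\<epsilon> n \<le> 1" for n by (auto simp: \<epsilon>_def)
  have \<epsilon>_lim: "\<epsilon> \<longlonglongrightarrow> 0" unfolding \<epsilon>_def[abs_def] by (rule LIMSEQ_Suc[OF lim_1_over_n])
  define \<theta>' where "\<theta>' = \<theta>0 - \<delta>"
  have \<theta>': "0 < \<theta>'" using \<delta> by (simp add: \<theta>'_def)
  have a_lim: "filterlim (\<lambda>N. \<theta>' * sqrt (I N) - \<Lambda>) at_top sequentially" for \<Lambda>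
  proof -
    have "filterlim (\<lambda>N. - \<Lambda> + \<theta>' * sqrt (I N)) at_top sequentially"
      using \<theta>' by (intro filterlim_tendsto_add_at_top[OF tendsto_const] filterlim_tendsto_pos_mult_at_top[OF tendsto_const _ sqrt_I_at_top])
    then show ?thesis by simp
  qed
  show ?thesis
  proof (rule order_tendstoI)
    fix u assume "?V < u"
    moreover have "(\<lambda>n. \<integral>\<^sup>+x. ennreal (v (max 0 (\<bar>x\<bar> + \<epsilon> n))) \<partial>std_normal_distribution) \<longlonglongrightarrow> ?V"
      using less_imp_le[OF \<epsilon>(1)] \<epsilon>(2) by (intro std_normal_risk_continuous[OF v \<epsilon>_lim]) auto
    ultimately have "eventually (\<lambda>n. (\<integral>\<^sup>+x. ennreal (v (max 0 (\<bar>x\<bar> + \<epsilon> n))) \<partial>std_normal_distribution) < u) sequentially"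
      by (rule order_tendstoD(2)[rotated])
    then obtain n where n: "(\<integral>\<^sup>+x. ennreal (v (max 0 (\<bar>x\<bar> + \<epsilon> n))) \<partial>std_normal_distribution) < u" (is "?U < u")
      using eventually_happens' sequentially_bot by blast
    obtain \<Lambda> where \<Lambda>: "0 < \<Lambda>" "gaussian_risk l 0 < truncated_risk l \<Lambda> (\<epsilon> n)"
      using gaussian_risk_strict_gap[OF loss _ strict_min, of "\<epsilon> n"] \<epsilon>(1)[of n] by auto
    have "(\<lambda>N. \<integral>\<^sup>+x. ennreal (v (\<Lambda> + 2 + \<bar>x\<bar>)) * indicator {x. \<theta>' * sqrt (I N) - \<Lambda> \<le> \<bar>x\<bar>} x \<partial>std_normal_distribution) \<longlonglongrightarrow> 0"
      by (rule nn_integral_truncation_limits(2)[OF _ nn_integral_std_normal_shifted_finite[OF v] a_lim]) auto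
    then have "(\<lambda>N. ?U + (\<integral>\<^sup>+x. ennreal (v (\<Lambda> + 2 + \<bar>x\<bar>)) * indicator {x. \<theta>' * sqrt (I N) - \<Lambda> \<le> \<bar>x\<bar>} x \<partial>std_normal_distribution)) \<longlonglongrightarrow> ?U + 0"
      by (intro tendsto_add tendsto_const)
    then have "eventually (\<lambda>N. ?U + (\<integral>\<^sup>+x. ennreal (v (\<Lambda> + 2 + \<bar>x\<bar>)) * indicator {x. \<theta>' * sqrt (I N) - \<Lambda> \<le> \<bar>x\<bar>} x \<partial>std_normal_distribution) < u) sequentially"
      using n by (intro order_tendstoD(2)) auto
    then show "eventually (\<lambda>N. ?S N < u) sequentially"
      using eventually_ge_at_top[of 1]
    proof eventually_elim
      case (elim N)
      have "?S N \<le> ?U + (\<integral>\<^sup>+x. ennreal (v (\<Lambda> + 2 + \<bar>x\<bar>)) * indicator {x. \<theta>' * sqrt (I N) - \<Lambda> \<le> \<bar>x\<bar>} x \<partial>std_normal_distribution)"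
      proof (rule SUP_least)
        fix \<theta> assume "\<theta> \<in> {\<theta>. 0 < \<theta> \<and> \<bar>\<theta> - \<theta>0\<bar> < \<delta>}"
        then have "\<theta>' \<le> \<theta>" by (auto simp: \<theta>'_def)
        then show "(\<integral>\<^sup>+\<omega>. ennreal (v (sqrt (I N) * (estimator \<theta> N \<omega> - \<theta>))) \<partial>M)
          \<le> ?U + (\<integral>\<^sup>+x. ennreal (v (\<Lambda> + 2 + \<bar>x\<bar>)) * indicator {x. \<theta>' * sqrt (I N) - \<Lambda> \<le> \<bar>x\<bar>} x \<partial>std_normal_distribution)"
          by (rule uniform_prior_risk_bounds(1)[OF unif \<epsilon> \<Lambda> elim(2) \<theta>' _ v])
      qed
      then show ?case using elim(1) by (rule le_less_trans)
    qed
  next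
    fix u assume "u < ?V"
    moreover have "(\<lambda>n. \<integral>\<^sup>+x. ennreal (v (max 0 (\<bar>x\<bar> + - \<epsilon> n))) \<partial>std_normal_distribution) \<longlonglongrightarrow> ?V"
      using less_imp_le[OF \<epsilon>(1)] \<epsilon>(2) tendsto_minus[OF \<epsilon>_lim] by (intro std_normal_risk_continuous[OF v]) auto
    ultimately have "eventually (\<lambda>n. u < (\<integral>\<^sup>+x. ennreal (v (max 0 (\<bar>x\<bar> + - \<epsilon> n))) \<partial>std_normal_distribution)) sequentially"
      by (rule order_tendstoD(1)[rotated])
    then obtain n where n: "u < (\<integral>\<^sup>+x. ennreal (v (max 0 (\<bar>x\<bar> + - \<epsilon> n))) \<partial>std_normal_distribution)" (is "u < ?L")
      using eventually_happens' sequentially_bot by blast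
    obtain \<Lambda> where \<Lambda>: "0 < \<Lambda>" "gaussian_risk l 0 < truncated_risk l \<Lambda> (\<epsilon> n)"
      using gaussian_risk_strict_gap[OF loss _ strict_min, of "\<epsilon> n"] \<epsilon>(1)[of n] by auto
    have "?L \<le> (\<integral>\<^sup>+x. ennreal (v (1 + \<bar>x\<bar>)) \<partial>std_normal_distribution)"
    proof (intro nn_integral_mono ennreal_leI W_loss_mono[OF W])
      fix x show "\<bar>max 0 (\<bar>x\<bar> + - \<epsilon> n)\<bar> \<le> \<bar>1 + \<bar>x\<bar>\<bar>" using \<epsilon>(1)[of n] by (auto simp: max_def)
    qed
    then have "?L < \<infinity>" using nn_integral_std_normal_shifted_finite[OF v, of 1] by (rule le_less_trans)
    then have "(\<lambda>N. \<integral>\<^sup>+x. ennreal (v (max 0 (\<bar>x\<bar> + - \<epsilon> n))) * indicator {x. \<bar>x\<bar> < \<theta>' * sqrt (I N) - \<Lambda>} x \<partial>std_normal_distribution) \<longlonglongrightarrow> ?L"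
      by (intro nn_integral_truncation_limits(1)[OF _ _ a_lim]) auto
    then have "eventually (\<lambda>N. u < (\<integral>\<^sup>+x. ennreal (v (max 0 (\<bar>x\<bar> + - \<epsilon> n))) * indicator {x. \<bar>x\<bar> < \<theta>' * sqrt (I N) - \<Lambda>} x \<partial>std_normal_distribution)) sequentially"
      using n by (intro order_tendstoD(1))
    then show "eventually (\<lambda>N. u < ?S N) sequentially"
      using eventually_ge_at_top[of 1]
    proof eventually_elim
      case (elim N)
      have "\<theta>' \<le> \<theta>0" using \<delta> by (simp add: \<theta>'_def)
      then have "(\<integral>\<^sup>+x. ennreal (v (max 0 (\<bar>x\<bar> + - \<epsilon> n))) * indicator {x. \<bar>x\<bar> < \<theta>' * sqrt (I N) - \<Lambda>} x \<partial>std_normal_distribution)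
          \<le> (\<integral>\<^sup>+\<omega>. ennreal (v (sqrt (I N) * (estimator \<theta>0 N \<omega> - \<theta>0))) \<partial>M)"
        by (rule uniform_prior_risk_bounds(2)[OF unif \<epsilon> \<Lambda> elim(2) \<theta>' _ v])
      also have "\<dots> \<le> ?S N" using \<delta> by (intro SUP_upper) auto
      finally show ?case using elim(1) by (rule less_le_trans[rotated])
    qed
  qed
qed

text \<open>For every radius below \<open>\<theta>0\<close> the suprema already converge to the limiting risk, so the outer limit is
  one of an eventually constant function.\<close>

theorem uniform_prior_risk_limit:
  assumes unif: "\<forall>\<theta>>0. \<rho> \<theta> = 1" and v: "v \<in> W_p" and \<theta>0: "0 < \<theta>0"
  shows "((\<lambda>\<delta>. liminf (\<lambda>N. SUP \<theta>\<in>{\<theta>. \<theta> > 0 \<and> \<bar>\<theta> - \<theta>0\<bar> < \<delta>}.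
        \<integral>\<^sup>+\<omega>. ennreal (v (sqrt (I N) * (estimator \<theta> N \<omega> - \<theta>))) \<partial>M))
      \<longlongrightarrow> (\<integral>\<^sup>+x. ennreal (v x) \<partial>std_normal_distribution)) (at_right 0)"
proof (rule tendsto_eventually)
  have "eventually (\<lambda>\<delta>. \<delta> \<in> {0<..<\<theta>0}) (at_right 0)" using \<theta>0 by (rule eventually_at_right_real)
  then show "eventually (\<lambda>\<delta>. liminf (\<lambda>N. SUP \<theta>\<in>{\<theta>. \<theta> > 0 \<and> \<bar>\<theta> - \<theta>0\<bar> < \<delta>}.
        \<integral>\<^sup>+\<omega>. ennreal (v (sqrt (I N) * (estimator \<theta> N \<omega> - \<theta>))) \<partial>M)
      = (\<integral>\<^sup>+x. ennreal (v x) \<partial>std_normal_distribution)) (at_right 0)"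
  proof (rule eventually_mono)
    fix \<delta> assume "\<delta> \<in> {0<..<\<theta>0}"
    then have "0 < \<delta>" "\<delta> < \<theta>0" by auto
    then show "liminf (\<lambda>N. SUP \<theta>\<in>{\<theta>. \<theta> > 0 \<and> \<bar>\<theta> - \<theta>0\<bar> < \<delta>}.
        \<integral>\<^sup>+\<omega>. ennreal (v (sqrt (I N) * (estimator \<theta> N \<omega> - \<theta>))) \<partial>M)
      = (\<integral>\<^sup>+x. ennreal (v x) \<partial>std_normal_distribution)"
      by (intro lim_imp_Liminf uniform_prior_risk_tendsto[OF unif v]) auto
  qed
qed

end

section \<open>The Bayes estimator of the drift parameter\<close>

theorem proposition4p12:
  fixes M :: "'a measure" and F :: "real \<Rightarrow> 'a measure"
    and w :: "nat \<Rightarrow> real \<Rightarrow> 'a \<Rightarrow> real" and u0 :: "nat \<Rightarrow> 'a \<Rightarrow> real"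
    and \<mu> q :: "nat \<Rightarrow> real" and \<sigma> T :: real
    and \<rho> l :: "real \<Rightarrow> real" and B :: "real set"
  defines "I \<equiv> \<lambda>N. fisher_info T \<sigma> \<mu> q N"
    and "\<theta>h \<equiv> \<lambda>\<theta> N \<omega>. theta_hat M T \<mu> q (fourier_mode \<sigma> \<mu> q w u0 \<theta>) N \<omega>"
    and "\<xi> \<equiv> \<lambda>N \<omega>. xi_stat T \<sigma> \<mu> q w N \<omega>"
  defines "bt \<equiv> \<lambda>\<theta> N \<omega>. bayes_estimate \<rho> l (I N) (\<theta>h \<theta> N \<omega>)"
  assumes basis: "usual_stochastic_basis M F"
    and bm: "independent_brownian_motions M F w"
    and u0_meas: "\<And>k. k \<ge> 1 \<Longrightarrow> u0 k \<in> borel_measurable (F 0)"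
    and u0_nz: "\<And>k. k \<ge> 1 \<Longrightarrow> AE \<omega> in M. u0 k \<omega> \<noteq> 0"
    and mu_pos: "\<And>k. k \<ge> 1 \<Longrightarrow> \<mu> k > 0"
    and mu_lim: "filterlim \<mu> at_top sequentially"
    and q_pos: "\<And>k. k \<ge> 1 \<Longrightarrow> q k > 0"
    and sigma_pos: "\<sigma> > 0" and T_pos: "T > 0"
    and well_posed: "\<exists>\<theta>b>0. \<exists>N0. \<exists>c>0. \<forall>k\<ge>1. k \<ge> N0 \<longrightarrow> 2 * \<theta>b - \<sigma>\<^sup>2 * (q k)\<^sup>2 / \<mu> k \<ge> c"
    and prior: "\<rho> \<in> Q_e2" and loss: "l \<in> W_e2"
    and strict_min: "\<And>r. r \<noteq> 0 \<Longrightarrow>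
      (LBINT y. l y * exp (- (y\<^sup>2 / 2))) < (LBINT y. l (y + r) * exp (- (y\<^sup>2 / 2)))"
    and bayes_wd: "\<And>\<theta> N. \<theta> > 0 \<Longrightarrow> N \<ge> 1 \<Longrightarrow>
      AE \<omega> in M. bayes_well_defined \<rho> l (I N) (\<theta>h \<theta> N \<omega>)"
    and B: "compact B" "B \<subseteq> {0<..}"
  shows
   "(\<forall>\<epsilon>>0. (\<lambda>N. SUP \<theta>0\<in>B. emeasure M {\<omega> \<in> space M. \<bar>bt \<theta>0 N \<omega> - \<theta>0\<bar> > \<epsilon>}) \<longlonglongrightarrow> 0) \<and>
    (\<forall>g :: real \<Rightarrow> real. continuous_on UNIV g \<and> bounded (range g) \<longrightarrow>
      (\<lambda>N. SUP \<theta>0\<in>B. ennreal \<bar>(\<integral>\<omega>. g (sqrt (I N) * (bt \<theta>0 N \<omega> - \<theta>0)) \<partial>M)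
              - (\<integral>x. g x \<partial>std_normal_distribution)\<bar>) \<longlonglongrightarrow> 0) \<and>
    (\<forall>\<epsilon>>0. (\<lambda>N. SUP \<theta>0\<in>B. emeasure M
              {\<omega> \<in> space M. \<bar>sqrt (I N) * (bt \<theta>0 N \<omega> - \<theta>0) - \<xi> N \<omega>\<bar> > \<epsilon>}) \<longlonglongrightarrow> 0) \<and>
    (\<forall>\<theta>0>0. AE \<omega> in M. (\<lambda>N. bt \<theta>0 N \<omega>) \<longlonglongrightarrow> \<theta>0) \<and>
    ((\<forall>\<theta>>0. \<rho> \<theta> = 1) \<longrightarrow> (\<forall>v\<in>W_p. \<forall>\<theta>0\<in>B.
      ((\<lambda>\<delta>. liminf (\<lambda>N. SUP \<theta>\<in>{\<theta>. \<theta> > 0 \<and> \<bar>\<theta> - \<theta>0\<bar> < \<delta>}.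
          \<integral>\<^sup>+\<omega>. ennreal (v (sqrt (I N) * (bt \<theta> N \<omega> - \<theta>))) \<partial>M))
        \<longlongrightarrow> (\<integral>\<^sup>+x. ennreal (v x) \<partial>std_normal_distribution)) (at_right 0)))"
proof -
  interpret prob_space M using basis by (simp add: usual_stochastic_basis_def)
  interpret E: normal_location_experiment M I \<xi> \<theta>h \<rho> l
  proof (rule normal_location_experiment.intro[OF prob_space_axioms normal_location_experiment_axioms.intro])
    show "complete_measure M" using basis by (simp add: usual_stochastic_basis_def)
    show "0 < I N" if "1 \<le> N" for N
      unfolding I_def by (rule fisher_info_pos[OF T_pos sigma_pos that mu_pos q_pos])
    show "eventually (\<lambda>N. real N \<le> I N) sequentially"
      unfolding I_def by (rule fisher_info_growth[OF T_pos sigma_pos mu_pos q_pos mu_lim well_posed])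
    show "distributed M lborel (\<xi> N) std_normal_density" if "1 \<le> N" for N
      unfolding \<xi>_def by (rule xi_stat_standard_normal[OF basis bm T_pos sigma_pos mu_pos q_pos that])
    show "\<theta>h \<theta> N \<in> borel_measurable M" for \<theta> N
      unfolding \<theta>h_def by (rule theta_hat_decomposition(1)[OF basis bm u0_meas u0_nz T_pos sigma_pos mu_pos q_pos])
    show "AE \<omega> in M. \<theta>h \<theta> N \<omega> = \<theta> + \<xi> N \<omega> / sqrt (I N)" if "1 \<le> N" for \<theta> N
      unfolding \<theta>h_def \<xi>_def I_def by (rule theta_hat_decomposition(2)[OF basis bm u0_meas u0_nz T_pos sigma_pos mu_pos q_pos that])
  qed (use prior loss strict_min bayes_wd in auto)
  have bt: "bt = E.estimator"
    by (simp add: bt_def E.estimator_def fun_eq_iff)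
  show ?thesis
    unfolding bt
    using E.estimator_consistent[OF B] E.estimator_asymptotically_normal[OF B] E.estimator_expansion[OF B]
      E.estimator_strongly_consistent E.uniform_prior_risk_limit B(2)
    by (auto simp: subset_iff)
qed

end
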